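(* Let $(M,L)$ be a Finsler manifold with Finsler metric $g$, $\nabla$ its Cartan connection, and $T$ the (h)hv-torsion of $\nabla$. Then for all $\pi$-vector fields $X,Y,Z$ and every vector field $A$ on $\mathcal TM$: (a) $T(X,Y,Z)=T(X,Z,Y)$; (b) $(\nabla_AT)(X,Y,Z)=g((\nabla_AT)(X,Y),Z)=g((\nabla_AT)(X,Z),Y)$; (c) $T(X,\eta)=0$; (d) $(\nabla_{\gamma X}T)(Y,Z)=(\nabla_{\gamma Y}T)(X,Z)$; (e) $(\nabla_{\gamma\eta}T)(X,Y)=-T(X,Y)$; (f) $T$ is totally symmetric, i.e. $T(X,Y,Z)$ is invariant under all permutations of $X,Y,Z$.
   Context: $M$ is a real paracompact $C^\infty$ manifold of finite dimension, $\mathcal TM\subset TM$ is the set of nonzero tangent vectors, $\pi:\mathcal TM\to M$ the projection, $\pi^{-1}(TM)\to\mathcal TM$ the pullback of $TM$ by $\pi$; everything is $C^\infty$. Sections of $\pi^{-1}(TM)$ are called $\pi$-vector fields. $\eta$ is the $\pi$-vector field $\eta(u)=(u,u)$. $\rho:T(\mathcal TM)\to\pi^{-1}(TM)$ is $\rho(A)=(u,d\pi(A))$ for $A\in T_u(\mathcal TM)$, and $\gamma:\pi^{-1}(TM)\to T(\mathcal TM)$ is the vertical lift $\gamma(u,v)=\frac{d}{dt}|_{t=0}(u+tv)$; $V=\ker\rho=\operatorname{im}\gamma$. $(M,L)$ is a Finsler manifold: $L:TM\to[0,\infty)$ is smooth and positive on $\mathcal TM$, positively homogeneous of degree 1 on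 fibres, and the fibrewise Hessian of $E=\frac12L^2$ is positive definite on $\mathcal TM$; this Hessian (in coordinates $g_{ij}=\frac12\partial^2L^2/\partial y^i\partial y^j$) is the Finsler metric $g$ on $\pi^{-1}(TM)$. For a linear connection $D$ on $\pi^{-1}(TM)$, put $K(A)=D_A\eta$ and $H=\ker K$. $D$ is regular if $T(\mathcal TM)=V\oplus H$; then $\beta:=(\rho|_H)^{-1}:\pi^{-1}(TM)\to H$. Torsion: $\mathbf T(A,B)=D_A\rho B-D_B\rho A-\rho[A,B]$; $Q(X,Y)=\mathbf T(\beta X,\beta Y)$ is the (h)h-torsion and $T(X,Y)=\mathbf T(\gamma X,\beta Y)$ the (h)hv-torsion. The Cartan connection $\nabla$ is the unique regular connection on $\pi^{-1}(TM)$ with $\nabla g=0$, $Q=0$, and $g(T(X,Y),Z)=g(T(X,Z),Y)$. Notation: $T(X,Y,Z):=g(T(X,Y),Z)$; $(\nabla_AT)(X,Y)=\nabla_A(T(X,Y))-T(\nabla_AX,Y)-T(X,\nabla_AY)$; $(\nabla_AT)(X,Y,Z)$ (three arguments) is the covariant derivative of the scalar-valued trilinear form $T(X,Y,Z)$. *)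

theory Defs
  imports "HOL-Analysis.Analysis" "HOL-Library.Function_Algebras"
begin

text \<open>Tangent vectors are represented below by functions, so functions into a real vector
  space get the pointwise vector space structure.\<close>

instantiation "fun" :: (type, real_vector) real_vector
begin

definition scaleR_fun :: "real \<Rightarrow> ('a \<Rightarrow> 'b) \<Rightarrow> 'a \<Rightarrow> 'b"
  where "scaleR_fun r f = (\<lambda>x. r *\<^sub>R f x)"

instance
  by standard (auto simp: scaleR_fun_def fun_eq_iff scaleR_add_right scaleR_add_left)

end

lemma scaleR_fun_apply [simp]: "(r *\<^sub>R f) x = r *\<^sub>R f x"
  by (simp add: scaleR_fun_def)


section \<open>Smooth manifolds\<close>

text \<open>\<open>Ck_on\<close> and \<open>smooth_on\<close> are only used for open \<open>S\<close>.\<close>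

fun Ck_on :: "nat \<Rightarrow> 'e::euclidean_space set \<Rightarrow> ('e \<Rightarrow> 'b::real_normed_vector) \<Rightarrow> bool" where
  "Ck_on 0 S f \<longleftrightarrow> continuous_on S f"
| "Ck_on (Suc k) S f \<longleftrightarrow> (\<forall>x\<in>S. f differentiable (at x)) \<and>
     (\<forall>v. Ck_on k S (\<lambda>x. frechet_derivative f (at x) v))"

definition smooth_on :: "'e::euclidean_space set \<Rightarrow> ('e \<Rightarrow> 'b::real_normed_vector) \<Rightarrow> bool" where
  "smooth_on S f \<longleftrightarrow> (\<forall>k. Ck_on k S f)"

text \<open>A chart is a domain together with a coordinate map, which matters only on the domain.\<close>

type_synonym ('a, 'e) chart = "'a set \<times> ('a \<Rightarrow> 'e)"

abbreviation chart_dom :: "('a, 'e) chart \<Rightarrow> 'a set" where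
  "chart_dom c \<equiv> fst c"

abbreviation chart_map :: "('a, 'e) chart \<Rightarrow> 'a \<Rightarrow> 'e" where
  "chart_map c \<equiv> snd c"

definition chart_image :: "('a, 'e) chart \<Rightarrow> 'e set" where
  "chart_image c = chart_map c ` chart_dom c"

definition chart_inv :: "('a, 'e) chart \<Rightarrow> 'e \<Rightarrow> 'a" where
  "chart_inv c = inv_into (chart_dom c) (chart_map c)"

definition carrier_of :: "('a, 'e) chart set \<Rightarrow> 'a set" where
  "carrier_of \<A> = (\<Union>c\<in>\<A>. chart_dom c)"

definition paracompact_space :: "'a topology \<Rightarrow> bool" where
  "paracompact_space X \<longleftrightarrow>
     (\<forall>\<U>. (\<forall>U\<in>\<U>. openin X U) \<and> \<Union>\<U> = topspace X \<longrightarrow>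
       (\<exists>\<V>. (\<forall>V\<in>\<V>. openin X V) \<and> \<Union>\<V> = topspace X \<and>
            (\<forall>V\<in>\<V>. \<exists>U\<in>\<U>. V \<subseteq> U) \<and> locally_finite_in X \<V>))"

text \<open>The atlas need not be maximal.  The dimension of the manifold is \<open>DIM('e)\<close>.\<close>

definition smooth_manifold :: "'a topology \<Rightarrow> ('a, 'e::euclidean_space) chart set \<Rightarrow> bool" where
  "smooth_manifold M \<A> \<longleftrightarrow>
     Hausdorff_space M \<and> paracompact_space M \<and> carrier_of \<A> = topspace M \<and>
     (\<forall>c\<in>\<A>. openin M (chart_dom c) \<and> open (chart_image c) \<and>
        homeomorphic_map (subtopology M (chart_dom c)) (top_of_set (chart_image c)) (chart_map c)) \<and>
     (\<forall>c\<in>\<A>. \<forall>d\<in>\<A>.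
        smooth_on (chart_map c ` (chart_dom c \<inter> chart_dom d)) (chart_map d \<circ> chart_inv c))"


section \<open>Tangent vectors and vector fields\<close>

text \<open>A tangent vector at \<open>p\<close> is the family of its components in all charts around \<open>p\<close>, related by
  the derivatives of the transition maps; components in the other charts are \<open>0\<close> by convention.\<close>

type_synonym ('a, 'e) tvec = "('a, 'e) chart \<Rightarrow> 'e"

definition tangent_space ::
    "('a, 'e::euclidean_space) chart set \<Rightarrow> 'a \<Rightarrow> ('a, 'e) tvec set" where
  "tangent_space \<A> p =
     {v. (\<forall>c. \<not> (c \<in> \<A> \<and> p \<in> chart_dom c) \<longrightarrow> v c = 0) \<and>
         (\<forall>c\<in>\<A>. \<forall>d\<in>\<A>. p \<in> chart_dom c \<inter> chart_dom d \<longrightarrow>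
            v d = frechet_derivative (chart_map d \<circ> chart_inv c) (at (chart_map c p)) (v c))}"

text \<open>The derivative of \<open>f\<close> at \<open>p\<close> along \<open>a\<close>; by the chain rule it does not depend on the chosen
  chart.\<close>

definition dir_deriv :: "('a, 'e::euclidean_space) chart set \<Rightarrow> 'a \<Rightarrow> ('a, 'e) tvec \<Rightarrow>
    ('a \<Rightarrow> 'b::real_normed_vector) \<Rightarrow> 'b" where
  "dir_deriv \<A> p a f =
     (let c = (SOME c. c \<in> \<A> \<and> p \<in> chart_dom c)
      in frechet_derivative (f \<circ> chart_inv c) (at (chart_map c p)) (a c))"

definition tangent_map :: "('a, 'e::euclidean_space) chart set \<Rightarrow>
    ('b, 'f::euclidean_space) chart set \<Rightarrow> ('a \<Rightarrow> 'b) \<Rightarrow> 'a \<Rightarrow> ('a, 'e) tvec \<Rightarrow> ('b, 'f) tvec" where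
  "tangent_map \<A> \<B> f p a =
     (\<lambda>d. if d \<in> \<B> \<and> f p \<in> chart_dom d then dir_deriv \<A> p a (chart_map d \<circ> f) else 0)"

definition velocity ::
    "('a, 'e::euclidean_space) chart set \<Rightarrow> (real \<Rightarrow> 'a) \<Rightarrow> real \<Rightarrow> ('a, 'e) tvec" where
  "velocity \<A> \<sigma> t =
     (\<lambda>c. if c \<in> \<A> \<and> \<sigma> t \<in> chart_dom c then vector_derivative (chart_map c \<circ> \<sigma>) (at t) else 0)"

definition smooth_fun :: "('a, 'e::euclidean_space) chart set \<Rightarrow> ('a \<Rightarrow> real) \<Rightarrow> bool" where
  "smooth_fun \<A> f \<longleftrightarrow> (\<forall>c\<in>\<A>. smooth_on (chart_image c) (f \<circ> chart_inv c))"

text \<open>Fields are extended by \<open>0\<close> outside the manifold, so that equality of fields is equality of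
  functions.\<close>

definition vector_fields ::
    "('a, 'e::euclidean_space) chart set \<Rightarrow> ('a \<Rightarrow> ('a, 'e) tvec) set" where
  "vector_fields \<A> =
     {A. (\<forall>p\<in>carrier_of \<A>. A p \<in> tangent_space \<A> p) \<and> (\<forall>p. p \<notin> carrier_of \<A> \<longrightarrow> A p = 0) \<and>
         (\<forall>c\<in>\<A>. smooth_on (chart_image c) (\<lambda>x. A (chart_inv c x) c))}"

text \<open>In a chart, \<open>[A, B]\<^sup>i = A\<^sup>j \<partial>\<^sub>j B\<^sup>i - B\<^sup>j \<partial>\<^sub>j A\<^sup>i\<close>, that is \<open>[A, B] f = A (B f) - B (A f)\<close>.\<close>

definition lie_bracket :: "('a, 'e::euclidean_space) chart set \<Rightarrow>
    ('a \<Rightarrow> ('a, 'e) tvec) \<Rightarrow> ('a \<Rightarrow> ('a, 'e) tvec) \<Rightarrow> 'a \<Rightarrow> ('a, 'e) tvec" where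
  "lie_bracket \<A> A B p =
     (\<lambda>c. if c \<in> \<A> \<and> p \<in> chart_dom c
          then frechet_derivative (\<lambda>x. B (chart_inv c x) c) (at (chart_map c p)) (A p c)
             - frechet_derivative (\<lambda>x. A (chart_inv c x) c) (at (chart_map c p)) (B p c)
          else 0)"


section \<open>The slit tangent bundle and the pullback bundle\<close>

type_synonym ('a, 'e) tpoint = "'a \<times> ('a, 'e) tvec"

definition tangent_bundle :: "('a, 'e::euclidean_space) chart set \<Rightarrow> ('a, 'e) tpoint set" where
  "tangent_bundle \<A> = Sigma (carrier_of \<A>) (tangent_space \<A>)"

definition slit :: "('a, 'e::euclidean_space) chart set \<Rightarrow> ('a, 'e) tpoint set" where
  "slit \<A> = {u \<in> tangent_bundle \<A>. snd u \<noteq> 0}"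

definition slit_chart :: "('a, 'e::euclidean_space) chart set \<Rightarrow> ('a, 'e) chart \<Rightarrow>
    (('a, 'e) tpoint, 'e \<times> 'e) chart" where
  "slit_chart \<A> c = ({u \<in> slit \<A>. fst u \<in> chart_dom c}, \<lambda>u. (chart_map c (fst u), snd u c))"

definition slit_atlas :: "('a, 'e::euclidean_space) chart set \<Rightarrow>
    (('a, 'e) tpoint, 'e \<times> 'e) chart set" where
  "slit_atlas \<A> = slit_chart \<A> ` \<A>"

text \<open>Tangent vectors of the slit tangent bundle do not carry their foot point; those of type
  \<open>ttvec\<close> below are always used together with a point \<open>u\<close>.  Similarly, an element \<open>(u, v)\<close> of the
  pullback bundle is given by \<open>u\<close> and \<open>v\<close> in the tangent space at \<open>fst u\<close>.\<close>

type_synonym ('a, 'e) ttvec = "(('a, 'e) tpoint, 'e \<times> 'e) tvec"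

type_synonym ('a, 'e) pi_field = "('a, 'e) tpoint \<Rightarrow> ('a, 'e) tvec"

type_synonym ('a, 'e) slit_field = "('a, 'e) tpoint \<Rightarrow> ('a, 'e) ttvec"

definition on_slit :: "('a, 'e::euclidean_space) chart set \<Rightarrow>
    (('a, 'e) tpoint \<Rightarrow> 'b::zero) \<Rightarrow> ('a, 'e) tpoint \<Rightarrow> 'b" where
  "on_slit \<A> F = (\<lambda>u. if u \<in> slit \<A> then F u else 0)"

definition pi_fields :: "('a, 'e::euclidean_space) chart set \<Rightarrow> ('a, 'e) pi_field set" where
  "pi_fields \<A> =
     {X. (\<forall>u\<in>slit \<A>. X u \<in> tangent_space \<A> (fst u)) \<and> (\<forall>u. u \<notin> slit \<A> \<longrightarrow> X u = 0) \<and>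
         (\<forall>c\<in>\<A>. smooth_on (chart_image (slit_chart \<A> c))
                  (\<lambda>z. X (chart_inv (slit_chart \<A> c) z) c))}"

definition eta :: "('a, 'e::euclidean_space) chart set \<Rightarrow> ('a, 'e) pi_field" where
  "eta \<A> = on_slit \<A> snd"

definition rho :: "('a, 'e::euclidean_space) chart set \<Rightarrow>
    ('a, 'e) tpoint \<Rightarrow> ('a, 'e) ttvec \<Rightarrow> ('a, 'e) tvec" where
  "rho \<A> u a = tangent_map (slit_atlas \<A>) \<A> fst u a"

definition gam :: "('a, 'e::euclidean_space) chart set \<Rightarrow>
    ('a, 'e) tpoint \<Rightarrow> ('a, 'e) tvec \<Rightarrow> ('a, 'e) ttvec" where
  "gam \<A> u v = velocity (slit_atlas \<A>) (\<lambda>t. (fst u, snd u + t *\<^sub>R v)) 0"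

definition vertical_space ::
    "('a, 'e::euclidean_space) chart set \<Rightarrow> ('a, 'e) tpoint \<Rightarrow> ('a, 'e) ttvec set" where
  "vertical_space \<A> u = {a \<in> tangent_space (slit_atlas \<A>) u. rho \<A> u a = 0}"

definition rho_field ::
    "('a, 'e::euclidean_space) chart set \<Rightarrow> ('a, 'e) slit_field \<Rightarrow> ('a, 'e) pi_field" where
  "rho_field \<A> A = on_slit \<A> (\<lambda>u. rho \<A> u (A u))"

definition gam_field ::
    "('a, 'e::euclidean_space) chart set \<Rightarrow> ('a, 'e) pi_field \<Rightarrow> ('a, 'e) slit_field" where
  "gam_field \<A> X = on_slit \<A> (\<lambda>u. gam \<A> u (X u))"


section \<open>Finsler manifolds\<close>

text \<open>The fibrewise Hessian of \<open>E = L\<^sup>2 / 2\<close> at \<open>u\<close>.\<close>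

definition finsler_metric ::
    "(('a, 'e) tpoint \<Rightarrow> real) \<Rightarrow> ('a, 'e) tpoint \<Rightarrow>
     ('a, 'e::euclidean_space) tvec \<Rightarrow> ('a, 'e) tvec \<Rightarrow> real" where
  "finsler_metric L u v w =
     deriv (\<lambda>s. deriv (\<lambda>t. (L (fst u, snd u + s *\<^sub>R v + t *\<^sub>R w))\<^sup>2 / 2) 0) 0"

definition finsler_manifold :: "'a topology \<Rightarrow> ('a, 'e::euclidean_space) chart set \<Rightarrow>
    (('a, 'e) tpoint \<Rightarrow> real) \<Rightarrow> bool" where
  "finsler_manifold M \<A> L \<longleftrightarrow>
     smooth_manifold M \<A> \<and>
     (\<forall>u\<in>tangent_bundle \<A>. L u \<ge> 0) \<and>
     smooth_fun (slit_atlas \<A>) L \<and>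
     (\<forall>u\<in>slit \<A>. L u > 0) \<and>
     (\<forall>(p, v)\<in>tangent_bundle \<A>. \<forall>r>0. L (p, r *\<^sub>R v) = r * L (p, v)) \<and>
     (\<forall>u\<in>slit \<A>. \<forall>v\<in>tangent_space \<A> (fst u). v \<noteq> 0 \<longrightarrow> finsler_metric L u v v > 0)"


section \<open>Connections on the pullback bundle\<close>

text \<open>\<open>D u a X\<close> is the covariant derivative of the \<open>\<pi>\<close>-vector field \<open>X\<close> along the tangent vector
  \<open>a\<close> at \<open>u\<close>.\<close>

type_synonym ('a, 'e) pi_connection =
  "('a, 'e) tpoint \<Rightarrow> ('a, 'e) ttvec \<Rightarrow> ('a, 'e) pi_field \<Rightarrow> ('a, 'e) tvec"

definition cov :: "('a, 'e::euclidean_space) chart set \<Rightarrow> ('a, 'e) pi_connection \<Rightarrow>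
    ('a, 'e) slit_field \<Rightarrow> ('a, 'e) pi_field \<Rightarrow> ('a, 'e) pi_field" where
  "cov \<A> D A X = on_slit \<A> (\<lambda>u. D u (A u) X)"

definition linear_connection ::
    "('a, 'e::euclidean_space) chart set \<Rightarrow> ('a, 'e) pi_connection \<Rightarrow> bool" where
  "linear_connection \<A> D \<longleftrightarrow>
     (\<forall>u\<in>slit \<A>. \<forall>a\<in>tangent_space (slit_atlas \<A>) u. \<forall>X\<in>pi_fields \<A>.
        D u a X \<in> tangent_space \<A> (fst u) \<and>
        (\<forall>b\<in>tangent_space (slit_atlas \<A>) u. D u (a + b) X = D u a X + D u b X) \<and>
        (\<forall>r. D u (r *\<^sub>R a) X = r *\<^sub>R D u a X) \<and>
        (\<forall>Y\<in>pi_fields \<A>. D u a (X + Y) = D u a X + D u a Y) \<and>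
        (\<forall>f. smooth_fun (slit_atlas \<A>) f \<longrightarrow>
           D u a (\<lambda>w. f w *\<^sub>R X w) = dir_deriv (slit_atlas \<A>) u a f *\<^sub>R X u + f u *\<^sub>R D u a X)) \<and>
     (\<forall>A\<in>vector_fields (slit_atlas \<A>). \<forall>X\<in>pi_fields \<A>. cov \<A> D A X \<in> pi_fields \<A>)"

definition horizontal_space :: "('a, 'e::euclidean_space) chart set \<Rightarrow>
    ('a, 'e) pi_connection \<Rightarrow> ('a, 'e) tpoint \<Rightarrow> ('a, 'e) ttvec set" where
  "horizontal_space \<A> D u = {a \<in> tangent_space (slit_atlas \<A>) u. D u a (eta \<A>) = 0}"

definition regular_connection ::
    "('a, 'e::euclidean_space) chart set \<Rightarrow> ('a, 'e) pi_connection \<Rightarrow> bool" where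
  "regular_connection \<A> D \<longleftrightarrow>
     linear_connection \<A> D \<and>
     (\<forall>u\<in>slit \<A>.
        tangent_space (slit_atlas \<A>) u =
          {a + b |a b. a \<in> vertical_space \<A> u \<and> b \<in> horizontal_space \<A> D u} \<and>
        vertical_space \<A> u \<inter> horizontal_space \<A> D u = {0})"

definition bet :: "('a, 'e::euclidean_space) chart set \<Rightarrow> ('a, 'e) pi_connection \<Rightarrow>
    ('a, 'e) tpoint \<Rightarrow> ('a, 'e) tvec \<Rightarrow> ('a, 'e) ttvec" where
  "bet \<A> D u = inv_into (horizontal_space \<A> D u) (rho \<A> u)"

definition bet_field :: "('a, 'e::euclidean_space) chart set \<Rightarrow> ('a, 'e) pi_connection \<Rightarrow>
    ('a, 'e) pi_field \<Rightarrow> ('a, 'e) slit_field" where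
  "bet_field \<A> D X = on_slit \<A> (\<lambda>u. bet \<A> D u (X u))"

definition torsion :: "('a, 'e::euclidean_space) chart set \<Rightarrow> ('a, 'e) pi_connection \<Rightarrow>
    ('a, 'e) slit_field \<Rightarrow> ('a, 'e) slit_field \<Rightarrow> ('a, 'e) pi_field" where
  "torsion \<A> D A B =
     cov \<A> D A (rho_field \<A> B) - cov \<A> D B (rho_field \<A> A)
       - rho_field \<A> (lie_bracket (slit_atlas \<A>) A B)"

definition hh_torsion :: "('a, 'e::euclidean_space) chart set \<Rightarrow> ('a, 'e) pi_connection \<Rightarrow>
    ('a, 'e) pi_field \<Rightarrow> ('a, 'e) pi_field \<Rightarrow> ('a, 'e) pi_field" where
  "hh_torsion \<A> D X Y = torsion \<A> D (bet_field \<A> D X) (bet_field \<A> D Y)"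

definition hv_torsion :: "('a, 'e::euclidean_space) chart set \<Rightarrow> ('a, 'e) pi_connection \<Rightarrow>
    ('a, 'e) pi_field \<Rightarrow> ('a, 'e) pi_field \<Rightarrow> ('a, 'e) pi_field" where
  "hv_torsion \<A> D X Y = torsion \<A> D (gam_field \<A> X) (bet_field \<A> D Y)"

definition metric_connection :: "('a, 'e::euclidean_space) chart set \<Rightarrow>
    (('a, 'e) tpoint \<Rightarrow> real) \<Rightarrow> ('a, 'e) pi_connection \<Rightarrow> bool" where
  "metric_connection \<A> L D \<longleftrightarrow>
     (\<forall>A\<in>vector_fields (slit_atlas \<A>). \<forall>X\<in>pi_fields \<A>. \<forall>Y\<in>pi_fields \<A>. \<forall>u\<in>slit \<A>.
        dir_deriv (slit_atlas \<A>) u (A u) (\<lambda>w. finsler_metric L w (X w) (Y w))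
          - finsler_metric L u (cov \<A> D A X u) (Y u)
          - finsler_metric L u (X u) (cov \<A> D A Y u) = 0)"

definition cartan_connection :: "('a, 'e::euclidean_space) chart set \<Rightarrow>
    (('a, 'e) tpoint \<Rightarrow> real) \<Rightarrow> ('a, 'e) pi_connection \<Rightarrow> bool" where
  "cartan_connection \<A> L D \<longleftrightarrow>
     regular_connection \<A> D \<and>
     metric_connection \<A> L D \<and>
     (\<forall>X\<in>pi_fields \<A>. \<forall>Y\<in>pi_fields \<A>. hh_torsion \<A> D X Y = 0) \<and>
     (\<forall>X\<in>pi_fields \<A>. \<forall>Y\<in>pi_fields \<A>. \<forall>Z\<in>pi_fields \<A>. \<forall>u\<in>slit \<A>.
        finsler_metric L u (hv_torsion \<A> D X Y u) (Z u) =
        finsler_metric L u (hv_torsion \<A> D X Z u) (Y u))"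

definition hv_form :: "('a, 'e::euclidean_space) chart set \<Rightarrow> (('a, 'e) tpoint \<Rightarrow> real) \<Rightarrow>
    ('a, 'e) pi_connection \<Rightarrow> ('a, 'e) pi_field \<Rightarrow> ('a, 'e) pi_field \<Rightarrow> ('a, 'e) pi_field \<Rightarrow>
    ('a, 'e) tpoint \<Rightarrow> real" where
  "hv_form \<A> L D X Y Z u = finsler_metric L u (hv_torsion \<A> D X Y u) (Z u)"

definition cov_hv_torsion :: "('a, 'e::euclidean_space) chart set \<Rightarrow> ('a, 'e) pi_connection \<Rightarrow>
    ('a, 'e) slit_field \<Rightarrow> ('a, 'e) pi_field \<Rightarrow> ('a, 'e) pi_field \<Rightarrow> ('a, 'e) pi_field" where
  "cov_hv_torsion \<A> D A X Y =
     cov \<A> D A (hv_torsion \<A> D X Y)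
       - hv_torsion \<A> D (cov \<A> D A X) Y - hv_torsion \<A> D X (cov \<A> D A Y)"

definition cov_hv_form :: "('a, 'e::euclidean_space) chart set \<Rightarrow> (('a, 'e) tpoint \<Rightarrow> real) \<Rightarrow>
    ('a, 'e) pi_connection \<Rightarrow> ('a, 'e) slit_field \<Rightarrow>
    ('a, 'e) pi_field \<Rightarrow> ('a, 'e) pi_field \<Rightarrow> ('a, 'e) pi_field \<Rightarrow> ('a, 'e) tpoint \<Rightarrow> real" where
  "cov_hv_form \<A> L D A X Y Z u =
     dir_deriv (slit_atlas \<A>) u (A u) (hv_form \<A> L D X Y Z)
       - hv_form \<A> L D (cov \<A> D A X) Y Z u
       - hv_form \<A> L D X (cov \<A> D A Y) Z u
       - hv_form \<A> L D X Y (cov \<A> D A Z) u"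

end

(* In a chart, rho[gamma X, beta Y] is the fibre derivative F_X Y of the components of Y, so
   T(X, Y) = D_(gamma X) Y - F_X Y.  Subtracting the product rule for the fibre derivative of g(Y, Z)
   from metricity leaves E'''(X, Y, Z) = g(T(X, Y), Z) + g(Y, T(X, Z)) = 2 T(X, Y, Z), where E''' is
   the third fibre derivative of the energy.  Hence T is totally symmetric, and T(X, eta) = 0 because g
   is homogeneous of degree 0.  Twice the covariant derivative of T along gamma X is the fourth fibre
   derivative of E minus symmetric quadratic terms in T, which gives (d); (e) is (d) for eta, since
   D_(gamma X) eta = X.  These formulas hold for global pi-vector fields, so no localisation is needed
   except to see that beta Y is differentiable, which the Lie bracket requires: there the coefficients of
   K = D eta are read off from global vector fields obtained with bump functions. *)

theory Submission
  imports Defs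
begin

section \<open>Calculus of iterated directional derivatives\<close>

text \<open>\<open>frechet_derivative\<close> is an arbitrary value where a function is not
  differentiable. The bracket in \<open>hv_torsion\<close> differentiates the chart components of
  \<beta>Y, and \<beta> is only a pointwise inverse on the horizontal spaces, so without
  differentiability nothing can be said about the torsion. A single derivative of \<beta>Y occurs,
  and its base components are those of Y; hence differentiability at each point suffices, and it
  follows from solving a linear system for the fibre components. For the same reason
  \<open>dir_deriv\<close>, which uses an unspecified chart, is moved to a given chart only for
  functions differentiable in the charts around the point.

  Identities are checked at one point in one chart, where the increments \<open>(0, v)\<close> are
  the fibre directions. Transition maps of the slit bundle are linear on fibres, which makes
  \<gamma> and the fibre derivative of a field independent of the chart. The result is an equality
  of g-values against all test fields, and positive definiteness turns it into an equality of
  fields.\<close>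

definition dd :: "'e \<Rightarrow> ('e::euclidean_space \<Rightarrow> 'b::real_normed_vector) \<Rightarrow> 'e \<Rightarrow> 'b" where
  "dd v f x = frechet_derivative f (at x) v"

lemma dd_eq: "(f has_derivative f') (at x) \<Longrightarrow> dd v f x = f' v"
  unfolding dd_def using frechet_derivative_at by fastforce

lemma has_derivative_dd: "f differentiable (at x) \<Longrightarrow> (f has_derivative (\<lambda>v. dd v f x)) (at x)"
  unfolding dd_def by (simp add: frechet_derivative_works[symmetric] eta_contract_eq)

text \<open>Functions that agree near x have the same set of derivatives at x, so the choice
  operator inside \<open>frechet_derivative\<close> returns the same map even where there is no
  derivative.\<close>

lemma dd_cong:
  assumes "open S" "x \<in> S" "\<And>y. y \<in> S \<Longrightarrow> f y = g y"
  shows "dd v f x = dd v g x"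
proof (cases "f differentiable (at x)")
  case True
  then have "(g has_derivative (\<lambda>v. dd v f x)) (at x)"
    using has_derivative_dd has_derivative_transform_within_open assms by blast
  then show ?thesis by (simp add: dd_eq)
next
  case False
  have "(f has_derivative D) (at x) \<longleftrightarrow> (g has_derivative D) (at x)" for D
    using has_derivative_transform_within_open[OF _ assms(1,2)] assms(3) by metis
  then show ?thesis unfolding dd_def frechet_derivative_def by simp
qed

lemma differentiable_cong_open:
  assumes "open S" "x \<in> S" "\<And>y. y \<in> S \<Longrightarrow> f y = g y" "f differentiable (at x)"
  shows "g differentiable (at x)"
  using assms has_derivative_transform_within_open unfolding differentiable_def by metis

section \<open>Closure properties of C^k functions\<close>

lemma Ck_on_Suc_dd:
  "Ck_on (Suc k) S f \<longleftrightarrow> (\<forall>x\<in>S. f differentiable (at x)) \<and> (\<forall>v. Ck_on k S (dd v f))"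
  by (simp add: dd_def[abs_def])

declare Ck_on.simps(2) [simp del]

lemma Ck_on_cong_imp:
  assumes "open S"
  shows "(\<And>x. x \<in> S \<Longrightarrow> f x = g x) \<Longrightarrow> Ck_on k S f \<Longrightarrow> Ck_on k S g"
proof (induction k arbitrary: f g)
  case 0 then show ?case using continuous_on_cong by (metis Ck_on.simps(1))
next
  case (Suc k)
  have "Ck_on k S (dd v g)" for v
    by (rule Suc.IH[of "dd v f"]) (use Suc.prems dd_cong[OF assms] Ck_on_Suc_dd in blast)+
  moreover have "g differentiable (at x)" if "x \<in> S" for x
    using Suc.prems differentiable_cong_open[OF assms that] Ck_on_Suc_dd that by blast
  ultimately show ?case by (simp add: Ck_on_Suc_dd)
qed

text \<open>Replaces \<open>frechet_derivative\<close> by an explicit formula for the derivative;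
  the inductions for constants, sums, products and compositions below all go through this
  rule.\<close>

lemma Ck_on_SucI:
  assumes "open S" "\<And>x. x \<in> S \<Longrightarrow> (f has_derivative f' x) (at x)" "\<And>v. Ck_on k S (\<lambda>x. f' x v)"
  shows "Ck_on (Suc k) S f"
proof -
  have "Ck_on k S (dd v f)" for v
    by (rule Ck_on_cong_imp[OF assms(1) _ assms(3)[of v]]) (use assms(2) dd_eq in metis)
  then show ?thesis using assms(2) unfolding Ck_on_Suc_dd differentiable_def by blast
qed

lemma Ck_on_continuous: "Ck_on k S f \<Longrightarrow> continuous_on S f"
proof (cases k)
  case (Suc n)
  assume "Ck_on k S f"
  then have "\<forall>x\<in>S. f differentiable (at x)" by (simp add: Suc Ck_on_Suc_dd)
  then show ?thesis
    by (meson continuous_at_imp_continuous_on differentiable_imp_continuous_within)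
qed simp

lemma Ck_on_SucD: "Ck_on (Suc k) S f \<Longrightarrow> Ck_on k S f"
proof (induction k arbitrary: f)
  case 0 then show ?case using Ck_on_continuous by auto
next
  case (Suc k) then show ?case using Ck_on_Suc_dd by blast
qed

lemma Ck_on_const: "open S \<Longrightarrow> Ck_on k S (\<lambda>x. c)"
proof (induction k arbitrary: c)
  case (Suc k) then show ?case by (intro Ck_on_SucI[where f'="\<lambda>x v. 0"]) auto
qed auto

lemma Ck_on_add: "open S \<Longrightarrow> Ck_on k S f \<Longrightarrow> Ck_on k S g \<Longrightarrow> Ck_on k S (\<lambda>x. f x + g x)"
proof (induction k arbitrary: f g)
  case 0 then show ?case by (auto intro: continuous_on_add)
next
  case (Suc k)
  then show ?case
    by (intro Ck_on_SucI[where f'="\<lambda>x v. dd v f x + dd v g x"] has_derivative_add has_derivative_dd)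
       (auto simp: Ck_on_Suc_dd)
qed

lemma Ck_on_linear:
  fixes l :: "'a::real_normed_vector \<Rightarrow> 'b::real_normed_vector"
  assumes "open S" "bounded_linear l"
  shows "Ck_on k S f \<Longrightarrow> Ck_on k S (\<lambda>x. l (f x))"
proof (induction k arbitrary: f)
  case 0 then show ?case using assms by (simp add: bounded_linear.continuous_on)
next
  case (Suc k)
  then show ?case
    by (intro Ck_on_SucI[where f'="\<lambda>x v. l (dd v f x)"]
        bounded_linear.has_derivative[OF assms(2)] has_derivative_dd)
       (auto simp: Ck_on_Suc_dd assms)
qed

lemma Ck_on_scaleR:
  "open S \<Longrightarrow> Ck_on k S f \<Longrightarrow> Ck_on k S g \<Longrightarrow> Ck_on k S (\<lambda>x. f x *\<^sub>R g x)"
proof (induction k arbitrary: f g)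
  case 0 then show ?case by (auto intro: continuous_on_scaleR)
next
  case (Suc k)
  have *: "Ck_on k S f" "Ck_on k S g" using Suc.prems Ck_on_SucD by blast+
  show ?case
    by (intro Ck_on_SucI[where f'="\<lambda>x v. f x *\<^sub>R dd v g x + dd v f x *\<^sub>R g x"] has_derivative_scaleR
        has_derivative_dd Ck_on_add Suc.IH *)
       (use Suc.prems in \<open>auto simp: Ck_on_Suc_dd\<close>)
qed

lemma Ck_on_sum:
  "open S \<Longrightarrow> (\<And>i. i \<in> I \<Longrightarrow> Ck_on k S (f i)) \<Longrightarrow> Ck_on k S (\<lambda>x. \<Sum>i\<in>I. f i x)"
  by (induction I rule: infinite_finite_induct) (auto intro!: Ck_on_const Ck_on_add)

lemma dd_linear:
  assumes "f differentiable (at x)" shows "linear (\<lambda>v. dd v f x)"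
  unfolding dd_def using linear_frechet_derivative[OF assms] by (simp add: eta_contract_eq)

lemma linear_basis_sum:
  assumes "linear l" shows "l v = (\<Sum>b\<in>Basis. (v \<bullet> b) *\<^sub>R l b)"
proof -
  have "l v = l (\<Sum>b\<in>Basis. (v \<bullet> b) *\<^sub>R b)" by (simp add: euclidean_representation)
  also have "\<dots> = (\<Sum>b\<in>Basis. (v \<bullet> b) *\<^sub>R l b)"
    by (simp only: linear_sum[OF assms] linear_scale[OF assms])
  finally show ?thesis .
qed

text \<open>The chain rule differentiates f in the direction \<open>dd v g x\<close>, which varies
  with x, whereas the induction hypothesis speaks of fixed directions only. Expanding the direction
  in the basis leaves fixed directions with C^k coefficients.\<close>

lemma Ck_on_compose:
  fixes f :: "'f::euclidean_space \<Rightarrow> 'b::real_normed_vector"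
  assumes "open S" "open T"
  shows "Ck_on k T f \<Longrightarrow> Ck_on k S g \<Longrightarrow> g ` S \<subseteq> T \<Longrightarrow> Ck_on k S (\<lambda>x. f (g x))"
proof (induction k arbitrary: f)
  case 0 then show ?case by (auto intro: continuous_on_compose2)
next
  case (Suc k)
  have df: "f differentiable (at (g x))" if "x \<in> S" for x
    using Suc.prems that by (auto simp: Ck_on_Suc_dd)
  have dg: "g differentiable (at x)" if "x \<in> S" for x
    using Suc.prems that by (auto simp: Ck_on_Suc_dd)
  have "((\<lambda>x. f (g x)) has_derivative (\<lambda>v. dd (dd v g x) f (g x))) (at x)" if "x \<in> S" for x
    using diff_chain_at[OF has_derivative_dd[OF dg[OF that]] has_derivative_dd[OF df[OF that]]]
    by (simp add: o_def)
  moreover have "dd (dd v g x) f (g x) = (\<Sum>b\<in>Basis. (dd v g x \<bullet> b) *\<^sub>R dd b f (g x))"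
    if "x \<in> S" for x v by (rule linear_basis_sum[OF dd_linear[OF df[OF that]]])
  ultimately have "((\<lambda>x. f (g x)) has_derivative
      (\<lambda>v. \<Sum>b\<in>Basis. (dd v g x \<bullet> b) *\<^sub>R dd b f (g x))) (at x)" if "x \<in> S" for x
    using that by auto
  moreover have "Ck_on k S (\<lambda>x. \<Sum>b\<in>Basis. (dd v g x \<bullet> b) *\<^sub>R dd b f (g x))" for v
  proof (intro Ck_on_sum Ck_on_scaleR \<open>open S\<close>)
    show "Ck_on k S (\<lambda>x. dd v g x \<bullet> i)" for i
      using Suc.prems by (intro Ck_on_linear[OF \<open>open S\<close> bounded_linear_inner_left])
        (auto simp: Ck_on_Suc_dd)
    show "Ck_on k S (\<lambda>x. dd i f (g x))" for i
      using Suc.prems Ck_on_SucD[of k S g] by (intro Suc.IH) (simp_all add: Ck_on_Suc_dd)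
  qed
  ultimately show ?case by (rule Ck_on_SucI[OF \<open>open S\<close>])
qed

lemma Ck_on_local:
  assumes "\<And>x. x \<in> S \<Longrightarrow> \<exists>T. open T \<and> x \<in> T \<and> Ck_on k T f"
  shows "Ck_on k S f"
  using assms
proof (induction k arbitrary: f)
  case 0
  then show ?case
    by (metis Ck_on.simps(1) continuous_at_imp_continuous_on continuous_on_eq_continuous_at)
next
  case (Suc k)
  have "f differentiable (at x)" if "x \<in> S" for x
    using Suc.prems[OF that] by (auto simp: Ck_on_Suc_dd)
  moreover have "Ck_on k S (dd v f)" for v
    by (rule Suc.IH) (use Suc.prems Ck_on_Suc_dd in metis)
  ultimately show ?case by (auto simp: Ck_on_Suc_dd)
qed

lemma smooth_on_cong: "open S \<Longrightarrow> (\<And>x. x \<in> S \<Longrightarrow> f x = g x) \<Longrightarrow> smooth_on S f \<Longrightarrow> smooth_on S g"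
  unfolding smooth_on_def using Ck_on_cong_imp by blast

lemma smooth_on_const: "open S \<Longrightarrow> smooth_on S (\<lambda>x. c)"
  unfolding smooth_on_def using Ck_on_const by blast

lemma smooth_on_add: "open S \<Longrightarrow> smooth_on S f \<Longrightarrow> smooth_on S g \<Longrightarrow> smooth_on S (\<lambda>x. f x + g x)"
  unfolding smooth_on_def using Ck_on_add by blast

lemma smooth_on_linear:
  "open S \<Longrightarrow> bounded_linear l \<Longrightarrow> smooth_on S f \<Longrightarrow> smooth_on S (\<lambda>x. l (f x))"
  unfolding smooth_on_def using Ck_on_linear by blast

lemma smooth_on_scaleR:
  "open S \<Longrightarrow> smooth_on S f \<Longrightarrow> smooth_on S g \<Longrightarrow> smooth_on S (\<lambda>x. f x *\<^sub>R g x)"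
  unfolding smooth_on_def using Ck_on_scaleR by blast

lemma smooth_on_sum:
  "open S \<Longrightarrow> (\<And>i. i \<in> I \<Longrightarrow> smooth_on S (f i)) \<Longrightarrow> smooth_on S (\<lambda>x. \<Sum>i\<in>I. f i x)"
  unfolding smooth_on_def by (intro allI Ck_on_sum) auto

lemma smooth_on_compose:
  fixes f :: "'f::euclidean_space \<Rightarrow> 'b::real_normed_vector"
  shows "open S \<Longrightarrow> open T \<Longrightarrow> smooth_on T f \<Longrightarrow> smooth_on S g \<Longrightarrow> g ` S \<subseteq> T \<Longrightarrow>
    smooth_on S (\<lambda>x. f (g x))"
  unfolding smooth_on_def using Ck_on_compose by blast

lemma smooth_on_local:
  "(\<And>x. x \<in> S \<Longrightarrow> \<exists>T. open T \<and> x \<in> T \<and> smooth_on T f) \<Longrightarrow> smooth_on S f"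
  unfolding smooth_on_def using Ck_on_local by meson

lemma smooth_on_dd: "smooth_on S f \<Longrightarrow> smooth_on S (dd v f)"
  unfolding smooth_on_def using Ck_on_Suc_dd by blast

lemma smooth_on_differentiable: "smooth_on S f \<Longrightarrow> x \<in> S \<Longrightarrow> f differentiable (at x)"
  unfolding smooth_on_def using Ck_on_Suc_dd by blast

lemma smooth_on_continuous: "smooth_on S f \<Longrightarrow> continuous_on S f"
  unfolding smooth_on_def using Ck_on_continuous by blast

lemma smooth_on_ident: "open S \<Longrightarrow> smooth_on S (\<lambda>x. x)"
proof -
  assume S: "open S"
  have "Ck_on (Suc k) S (\<lambda>x. x)" for k
    by (rule Ck_on_SucI[OF S has_derivative_ident Ck_on_const[OF S]])
  then show ?thesis unfolding smooth_on_def using Ck_on_SucD by blast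
qed

lemma smooth_on_bounded_linear: "open S \<Longrightarrow> bounded_linear l \<Longrightarrow> smooth_on S l"
  using smooth_on_linear[OF _ _ smooth_on_ident, of S l] by simp

lemma smooth_on_Pair:
  assumes "open S" "smooth_on S f" "smooth_on S g"
  shows "smooth_on S (\<lambda>x. (f x, g x))"
proof -
  have "bounded_linear (\<lambda>a::'b. (a, 0::'c))" "bounded_linear (\<lambda>a::'c. (0::'b, a))"
    by (auto intro!: bounded_linear_Pair bounded_linear_ident bounded_linear_zero)
  then have "smooth_on S (\<lambda>x. (f x, 0) + (0, g x))"
    using assms by (intro smooth_on_add smooth_on_linear[where l="\<lambda>a. (a, 0)"]
        smooth_on_linear[where l="\<lambda>a. (0, a)"])
  then show ?thesis by simp
qed

section \<open>Symmetry of second derivatives\<close>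

text \<open>Differentiate \<open>f (z + s a + t b)\<close> by the mean value theorem in both orders.\<close>

lemma second_difference_mvt:
  fixes f :: "'e::euclidean_space \<Rightarrow> real"
  assumes "0 < h" "\<And>s t. 0 \<le> s \<Longrightarrow> s \<le> h \<Longrightarrow> 0 \<le> t \<Longrightarrow> t \<le> h \<Longrightarrow> z + s *\<^sub>R a + t *\<^sub>R b \<in> S"
    and f: "smooth_on S f"
  shows "\<exists>s t. 0 < s \<and> s < h \<and> 0 < t \<and> t < h \<and>
    f (z + h *\<^sub>R a + h *\<^sub>R b) - f (z + h *\<^sub>R a) - (f (z + h *\<^sub>R b) - f z) =
      h * h * dd b (dd a f) (z + s *\<^sub>R a + t *\<^sub>R b)"
proof -
  have chain: "((\<lambda>t. g (w + t *\<^sub>R c)) has_derivative (\<lambda>x. x * dd c g (w + t *\<^sub>R c))) (at t within T)"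
    if "g differentiable (at (w + t *\<^sub>R c))" for g :: "'e \<Rightarrow> real" and w c t T
  proof -
    have "((\<lambda>t. w + t *\<^sub>R c) has_derivative (\<lambda>x. x *\<^sub>R c)) (at t)"
      by (auto intro!: derivative_eq_intros)
    from diff_chain_at[OF this has_derivative_dd[OF that]] show ?thesis
      using linear_scale[OF dd_linear[OF that]] by (simp add: o_def has_derivative_at_withinI)
  qed
  note fd_facts = smooth_on_differentiable[OF f] smooth_on_differentiable[OF smooth_on_dd[OF f]]
  have fd: "f differentiable (at (z + s *\<^sub>R a + t *\<^sub>R b))"
    "dd a f differentiable (at (z + s *\<^sub>R a + t *\<^sub>R b))"
    if "0 \<le> s" "s \<le> h" "0 \<le> t" "t \<le> h" for s t
    using fd_facts assms(2)[OF that] by auto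
  define \<phi> where "\<phi> s = f (z + s *\<^sub>R a + h *\<^sub>R b) - f (z + s *\<^sub>R a)" for s
  have "(\<phi> has_derivative (\<lambda>x. x * dd a f (z + s *\<^sub>R a + h *\<^sub>R b) - x * dd a f (z + s *\<^sub>R a)))
      (at s within {0..h})" if "0 \<le> s" "s \<le> h" for s
    unfolding \<phi>_def
    using chain[of f "z + h *\<^sub>R b" s a] chain[of f "z" s a] fd[of s h] fd[of s 0] that \<open>0 < h\<close>
    by (intro has_derivative_diff) (auto simp: algebra_simps)
  from mvt_simple[OF \<open>0 < h\<close> this] obtain s where s: "0 < s" "s < h" and
    1: "\<phi> h - \<phi> 0 = h * (dd a f (z + s *\<^sub>R a + h *\<^sub>R b) - dd a f (z + s *\<^sub>R a))"
    by (auto simp: algebra_simps)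
  have "((\<lambda>t. dd a f (z + s *\<^sub>R a + t *\<^sub>R b)) has_derivative
      (\<lambda>x. x * dd b (dd a f) (z + s *\<^sub>R a + t *\<^sub>R b))) (at t within {0..h})" if "0 \<le> t" "t \<le> h" for t
    using chain[of "dd a f" "z + s *\<^sub>R a" t b] fd[of s t] that s by auto
  from mvt_simple[OF \<open>0 < h\<close> this] obtain t where t: "0 < t" "t < h" and
    2: "dd a f (z + s *\<^sub>R a + h *\<^sub>R b) - dd a f (z + s *\<^sub>R a) =
      h * dd b (dd a f) (z + s *\<^sub>R a + t *\<^sub>R b)"
    by auto
  show ?thesis using s t 1 2 unfolding \<phi>_def by (intro exI[of _ s] exI[of _ t]) (auto simp: algebra_simps)
qed

text \<open>The second difference over a parallelogram is symmetric in a and b, so its two mean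
  value expressions agree on arbitrarily small parallelograms, and continuity of both mixed
  derivatives carries the equality to z.\<close>

lemma dd_commute:
  fixes f :: "'e::euclidean_space \<Rightarrow> real"
  assumes "open S" "smooth_on S f" "z \<in> S"
  shows "dd a (dd b f) z = dd b (dd a f) z"
proof (rule ccontr)
  \<comment> \<open>Half the supposed gap: each mixed derivative moves by less than e between z and
    its mean value point, and the two values at those points coincide.\<close>
  define e where "e = \<bar>dd a (dd b f) z - dd b (dd a f) z\<bar> / 2"
  assume "\<not> ?thesis"
  then have "e > 0" by (auto simp: e_def)
  have c: "continuous (at z) (dd a (dd b f))" "continuous (at z) (dd b (dd a f))"
    using smooth_on_continuous[OF smooth_on_dd[OF smooth_on_dd[OF assms(2)]]]
    by (simp_all add: continuous_on_eq_continuous_at[OF assms(1)] assms(3))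
  obtain r1 where r1: "r1 > 0" "\<And>y. dist y z < r1 \<Longrightarrow> \<bar>dd a (dd b f) y - dd a (dd b f) z\<bar> < e"
    using c(1) \<open>e > 0\<close> unfolding continuous_at_eps_delta dist_real_def by blast
  obtain r2 where r2: "r2 > 0" "\<And>y. dist y z < r2 \<Longrightarrow> \<bar>dd b (dd a f) y - dd b (dd a f) z\<bar> < e"
    using c(2) \<open>e > 0\<close> unfolding continuous_at_eps_delta dist_real_def by blast
  obtain r3 where r3: "r3 > 0" "ball z r3 \<subseteq> S" using assms(1,3) openE by blast
  define r where "r = min r1 (min r2 r3)"
  \<comment> \<open>The summand 1 keeps N positive when a and b are both 0. With
    \<open>h = r / (2 * N)\<close> the whole parallelogram lies within distance r / 2 of z.\<close>
  define N where "N = norm a + norm b + 1"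
  have N: "N > 0" unfolding N_def by (simp add: add_nonneg_pos)
  define h where "h = r / (2 * N)"
  have "r > 0" unfolding r_def using r1 r2 r3 by auto
  then have "h > 0" unfolding h_def using N by simp
  have near: "dist (z + s *\<^sub>R a + t *\<^sub>R b) z < r" if "0 \<le> s" "s \<le> h" "0 \<le> t" "t \<le> h" for s t
  proof -
    have "norm (s *\<^sub>R a + t *\<^sub>R b) \<le> s * norm a + t * norm b"
      using norm_triangle_ineq[of "s *\<^sub>R a" "t *\<^sub>R b"] that by simp
    also have "\<dots> \<le> h * norm a + h * norm b"
      using that by (intro add_mono mult_right_mono) auto
    also have "\<dots> \<le> h * N" unfolding N_def using \<open>h > 0\<close> by (simp add: algebra_simps)
    also have "\<dots> < r" unfolding h_def using N \<open>r > 0\<close> by simp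
    finally show ?thesis by (simp add: dist_norm algebra_simps)
  qed
  have inS: "z + s *\<^sub>R a + t *\<^sub>R b \<in> S" if "0 \<le> s" "s \<le> h" "0 \<le> t" "t \<le> h" for s t
    using near[OF that] r3(2) unfolding r_def by (auto simp: dist_commute)
  obtain s t where st: "0 < s" "s < h" "0 < t" "t < h"
    "f (z + h *\<^sub>R a + h *\<^sub>R b) - f (z + h *\<^sub>R a) - (f (z + h *\<^sub>R b) - f z) =
      h * h * dd b (dd a f) (z + s *\<^sub>R a + t *\<^sub>R b)"
    using second_difference_mvt[OF \<open>h > 0\<close> inS assms(2)] by auto
  have inS': "z + s *\<^sub>R b + t *\<^sub>R a \<in> S" if "0 \<le> s" "s \<le> h" "0 \<le> t" "t \<le> h" for s t
    using inS[of t s] that by (simp add: algebra_simps)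
  obtain s' t' where st': "0 < s'" "s' < h" "0 < t'" "t' < h"
    "f (z + h *\<^sub>R b + h *\<^sub>R a) - f (z + h *\<^sub>R b) - (f (z + h *\<^sub>R a) - f z) =
      h * h * dd a (dd b f) (z + s' *\<^sub>R b + t' *\<^sub>R a)"
    using second_difference_mvt[OF \<open>h > 0\<close> inS' assms(2)] by auto
  have "h * h * dd b (dd a f) (z + s *\<^sub>R a + t *\<^sub>R b) = h * h * dd a (dd b f) (z + t' *\<^sub>R a + s' *\<^sub>R b)"
    using st(5) st'(5) by (simp add: algebra_simps)
  then have eq: "dd b (dd a f) (z + s *\<^sub>R a + t *\<^sub>R b) = dd a (dd b f) (z + t' *\<^sub>R a + s' *\<^sub>R b)"
    using \<open>h > 0\<close> by simp
  have "\<bar>dd b (dd a f) (z + s *\<^sub>R a + t *\<^sub>R b) - dd b (dd a f) z\<bar> < e"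
    using near[of s t] st r2(2) unfolding r_def by auto
  moreover have "\<bar>dd a (dd b f) (z + t' *\<^sub>R a + s' *\<^sub>R b) - dd a (dd b f) z\<bar> < e"
    using near[of t' s'] st' r1(2) unfolding r_def by auto
  ultimately have "\<bar>dd a (dd b f) z - dd b (dd a f) z\<bar> < 2 * e" using eq by linarith
  then show False unfolding e_def by simp
qed

text \<open>A product rule for the evaluation of a varying linear map at a varying vector. Only the
  maps \<open>\<lambda>z. B z b\<close> with b fixed are known to be differentiable, so the vector
  is expanded in the basis, which turns the evaluation into finitely many scalar multiples.\<close>

lemma has_derivative_linear_family:
  fixes B :: "'z::euclidean_space \<Rightarrow> 'e::euclidean_space \<Rightarrow> 'b::real_normed_vector"
  assumes "open S" "z0 \<in> S" and lin: "\<And>z. z \<in> S \<Longrightarrow> linear (B z)"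
    and dB: "\<And>b. (\<lambda>z. B z b) differentiable (at z0)" and dY: "Y differentiable (at z0)"
  shows "((\<lambda>z. B z (Y z)) has_derivative
    (\<lambda>h. dd h (\<lambda>z. B z (Y z0)) z0 + B z0 (dd h Y z0))) (at z0)"
proof -
  have "((\<lambda>z. \<Sum>b\<in>Basis. (Y z \<bullet> b) *\<^sub>R B z b) has_derivative
    (\<lambda>h. \<Sum>b\<in>Basis. (Y z0 \<bullet> b) *\<^sub>R dd h (\<lambda>z. B z b) z0 + (dd h Y z0 \<bullet> b) *\<^sub>R B z0 b)) (at z0)"
    by (intro has_derivative_sum has_derivative_scaleR has_derivative_dd[OF dB]
        has_derivative_inner_left has_derivative_dd[OF dY])
  then have 1: "((\<lambda>z. B z (Y z)) has_derivative (\<lambda>h. \<Sum>b\<in>Basis. (Y z0 \<bullet> b) *\<^sub>R dd h (\<lambda>z. B z b) z0 +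
      (dd h Y z0 \<bullet> b) *\<^sub>R B z0 b)) (at z0)"
    by (rule has_derivative_transform_within_open[OF _ assms(1,2)])
       (use linear_basis_sum[OF lin] in auto)
  \<comment> \<open>The same expansion with coefficients frozen at z0 identifies the first group of
    terms as the derivative of \<open>\<lambda>z. B z (Y z0)\<close>.\<close>
  have "((\<lambda>z. \<Sum>b\<in>Basis. (Y z0 \<bullet> b) *\<^sub>R B z b) has_derivative
    (\<lambda>h. \<Sum>b\<in>Basis. (Y z0 \<bullet> b) *\<^sub>R dd h (\<lambda>z. B z b) z0)) (at z0)"
    by (intro has_derivative_sum has_derivative_scaleR_right has_derivative_dd[OF dB])
  then have "((\<lambda>z. B z (Y z0)) has_derivative
    (\<lambda>h. \<Sum>b\<in>Basis. (Y z0 \<bullet> b) *\<^sub>R dd h (\<lambda>z. B z b) z0)) (at z0)"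
    by (rule has_derivative_transform_within_open[OF _ assms(1,2)])
       (use linear_basis_sum[OF lin] in auto)
  then have "dd h (\<lambda>z. B z (Y z0)) z0 = (\<Sum>b\<in>Basis. (Y z0 \<bullet> b) *\<^sub>R dd h (\<lambda>z. B z b) z0)" for h
    by (rule dd_eq)
  then have "(\<lambda>h. dd h (\<lambda>z. B z (Y z0)) z0 + B z0 (dd h Y z0)) =
    (\<lambda>h. \<Sum>b\<in>Basis. (Y z0 \<bullet> b) *\<^sub>R dd h (\<lambda>z. B z b) z0 + (dd h Y z0 \<bullet> b) *\<^sub>R B z0 b)"
    by (simp only: sum.distrib linear_basis_sum[OF lin[OF assms(2)], of "dd _ Y z0", symmetric])
  with 1 show ?thesis by simp
qed

lemma smooth_on_linear_family:
  fixes B :: "'z::euclidean_space \<Rightarrow> 'e::euclidean_space \<Rightarrow> 'b::real_normed_vector"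
  assumes "open S" and lin: "\<And>z. z \<in> S \<Longrightarrow> linear (B z)"
    and dB: "\<And>b. smooth_on S (\<lambda>z. B z b)" and dY: "smooth_on S Y"
  shows "smooth_on S (\<lambda>z. B z (Y z))"
proof (rule smooth_on_cong[OF assms(1)])
  show "smooth_on S (\<lambda>z. \<Sum>b\<in>Basis. (Y z \<bullet> b) *\<^sub>R B z b)"
    by (intro smooth_on_sum smooth_on_scaleR assms smooth_on_linear[OF _ bounded_linear_inner_left])
qed (use linear_basis_sum[OF lin] in auto)

lemma sum_Basis_prod:
  fixes f :: "'a::euclidean_space \<times> 'b::euclidean_space \<Rightarrow> 'c::comm_monoid_add"
  shows "sum f Basis = (\<Sum>i\<in>Basis. f (i, 0)) + (\<Sum>i\<in>Basis. f (0, i))"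
proof -
  have "inj_on (\<lambda>u. (u, 0::'b)) (Basis :: 'a set)" "inj_on (\<lambda>u. (0::'a, u)) (Basis :: 'b set)"
    by (auto intro!: inj_onI)
  then show ?thesis
    unfolding Basis_prod_def by (subst sum.union_disjoint) (auto simp: sum.reindex)
qed

lemma differentiable_bounded_linear:
  "bounded_linear l \<Longrightarrow> f differentiable F \<Longrightarrow> (\<lambda>x. l (f x)) differentiable F"
  unfolding differentiable_def using bounded_linear.has_derivative by blast

text \<open>Since g vanishes at z0 it is of the order of the distance to z0 there, so
  \<open>(f z - f z0) *\<^sub>R g z\<close> is of smaller order as soon as f is continuous at z0.
  This serves for coefficients whose differentiability is still to be shown.\<close>

lemma has_derivative_scaleR_vanishing:
  fixes g :: "'z::real_normed_vector \<Rightarrow> 'b::real_normed_vector"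
  assumes "isCont f z0" "(g has_derivative g') (at z0)" "g z0 = 0"
  shows "((\<lambda>z. f z *\<^sub>R g z) has_derivative (\<lambda>h. f z0 *\<^sub>R g' h)) (at z0)"
proof -
  have bl: "bounded_linear g'" using assms(2) has_derivative_bounded_linear by blast
  obtain K where K: "\<And>h. norm (g' h) \<le> norm h * K" "K > 0"
    using bounded_linear.pos_bounded[OF bl] by blast
  have "((\<lambda>z. (f z - f z0) *\<^sub>R g z) has_derivative (\<lambda>h. 0)) (at z0)"
    unfolding has_derivative_at_alt
  proof (intro conjI allI impI bounded_linear_zero)
    fix e :: real assume "e > 0"
    obtain d1 where d1: "d1 > 0" "\<And>y. norm (y - z0) < d1 \<Longrightarrow> norm (g y - g' (y - z0)) \<le> 1 * norm (y - z0)"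
      using assms(2,3) unfolding has_derivative_at_alt by (metis diff_zero zero_less_one)
    \<comment> \<open>\<open>1 + K\<close> is the Lipschitz bound of g at z0: K from its derivative
      and 1 from the error term.\<close>
    have "e / (1 + K) > 0" using \<open>e > 0\<close> K(2) by simp
    then obtain d2 where d2: "d2 > 0" "\<And>y. dist y z0 < d2 \<Longrightarrow> dist (f y) (f z0) < e / (1 + K)"
      using assms(1) unfolding continuous_at_eps_delta by blast
    show "\<exists>d>0. \<forall>y. norm (y - z0) < d \<longrightarrow>
        norm ((f y - f z0) *\<^sub>R g y - (f z0 - f z0) *\<^sub>R g z0 - 0) \<le> e * norm (y - z0)"
    proof (intro exI[of _ "min d1 d2"] conjI allI impI)
      fix y assume y: "norm (y - z0) < min d1 d2"
      have "norm (g y) \<le> norm (g y - g' (y - z0)) + norm (g' (y - z0))"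
        by (metis diff_add_cancel norm_triangle_ineq)
      also have "\<dots> \<le> (1 + K) * norm (y - z0)"
        using d1(2)[of y] K(1)[of "y - z0"] y by (simp add: algebra_simps)
      finally have 1: "norm (g y) \<le> (1 + K) * norm (y - z0)" .
      have "\<bar>f y - f z0\<bar> * norm (g y) \<le> e / (1 + K) * ((1 + K) * norm (y - z0))"
        using d2(2)[of y] y 1 by (intro mult_mono) (auto simp: dist_norm dist_real_def)
      also have "\<dots> = e * norm (y - z0)" using K(2) by simp
      finally show "norm ((f y - f z0) *\<^sub>R g y - (f z0 - f z0) *\<^sub>R g z0 - 0) \<le> e * norm (y - z0)"
        by simp
    qed (use d1 d2 in auto)
  qed
  from has_derivative_add[OF this has_derivative_scaleR_right[OF assms(2), of "f z0"]]
  show ?thesis by (simp add: algebra_simps)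
qed

text \<open>With \<open>N\<close> a left inverse of \<open>M z0\<close> and \<open>U z = N (M z) - id\<close>, the solution satisfies
  \<open>w = N r - U w\<close>: it is bounded near \<open>z0\<close>, hence continuous there, hence differentiable there.\<close>

lemma differentiable_linear_solution:
  fixes M :: "'z::euclidean_space \<Rightarrow> 'e::euclidean_space \<Rightarrow> 'f::euclidean_space"
  assumes "open S" "z0 \<in> S" and lin: "\<And>z. z \<in> S \<Longrightarrow> linear (M z)"
    and dM: "\<And>b. (\<lambda>z. M z b) differentiable (at z0)" and dr: "r differentiable (at z0)"
    and eq: "\<And>z. z \<in> S \<Longrightarrow> M z (w z) = r z" and inj: "\<And>v. M z0 v = 0 \<Longrightarrow> v = 0"
  shows "w differentiable (at z0)"
proof -
  obtain N where N: "linear N" "N \<circ> M z0 = id"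
    using linear_injective_left_inverse[of "M z0"] lin[OF assms(2)] inj
    by (metis linear_injective_0)
  have bN: "bounded_linear N" using N(1) linear_conv_bounded_linear by blast
  define U where "U z v = N (M z v) - v" for z v
  have linU: "linear (U z)" if "z \<in> S" for z
    unfolding U_def using linear_compose_sub[OF linear_compose[OF lin[OF that] N(1)] linear_id]
    by (simp add: o_def)
  have U0: "U z0 v = 0" for v
    using N(2) unfolding U_def by (metis comp_apply diff_self id_apply)
  have dU: "(\<lambda>z. U z b) differentiable (at z0)" for b
    unfolding U_def by (intro differentiable_diff differentiable_const
        differentiable_bounded_linear[OF bN] dM)
  have dNr: "(\<lambda>z. N (r z)) differentiable (at z0)"
    by (intro differentiable_bounded_linear[OF bN] dr)
  have w_eq: "w z = N (r z) - U z (w z)" if "z \<in> S" for z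
    unfolding U_def using eq[OF that] by simp
  \<comment> \<open>A bound for the operator norm of \<open>U z\<close>; it tends to 0 because
    \<open>U z0\<close> is the zero map.\<close>
  define \<kappa> where "\<kappa> z = (\<Sum>b\<in>Basis. norm (U z b))" for z
  have Ubound: "norm (U z v) \<le> norm v * \<kappa> z" if "z \<in> S" for z v
  proof -
    have "norm (U z v) \<le> (\<Sum>b\<in>Basis. norm ((v \<bullet> b) *\<^sub>R U z b))"
      unfolding linear_basis_sum[OF linU[OF that], of v] by (rule norm_sum)
    also have "\<dots> \<le> (\<Sum>b\<in>Basis. norm v * norm (U z b))"
      by (intro sum_mono) (auto intro!: mult_right_mono Basis_le_norm)
    finally show ?thesis unfolding \<kappa>_def by (simp add: sum_distrib_left)
  qed
  have "(\<kappa> \<longlongrightarrow> (\<Sum>b\<in>(Basis::'e set). norm (0::'e))) (at z0)" unfolding \<kappa>_def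
  proof (intro tendsto_sum tendsto_norm)
    fix b :: 'e
    have "isCont (\<lambda>z. U z b) z0" by (rule differentiable_imp_continuous_within[OF dU])
    then show "(\<lambda>z. U z b) \<midarrow>z0\<rightarrow> 0" using U0 by (simp add: isCont_def)
  qed
  then have \<kappa>: "(\<kappa> \<longlongrightarrow> 0) (at z0)" by simp
  have Nr: "((\<lambda>z. N (r z)) \<longlongrightarrow> N (r z0)) (at z0)"
    using differentiable_imp_continuous_within[OF dNr] by (simp add: isCont_def)
  have nearS: "\<forall>\<^sub>F z in at z0. z \<in> S" using assms(1,2) eventually_at_topological by blast
  \<comment> \<open>Below 1/2 the term \<open>U z (w z)\<close> can be absorbed: the norm of
    \<open>w z\<close> is at most that of \<open>N (r z)\<close> plus half of itself.\<close>
  have "\<forall>\<^sub>F z in at z0. \<kappa> z < 1 / 2" by (rule order_tendstoD(2)[OF \<kappa>]) simp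
  with nearS have bound: "\<forall>\<^sub>F z in at z0. norm (w z - N (r z)) \<le> 2 * norm (N (r z)) * \<kappa> z"
  proof eventually_elim
    case (elim z)
    have k0: "\<kappa> z \<ge> 0" unfolding \<kappa>_def by (simp add: sum_nonneg)
    have "w z = N (r z) - U z (w z)" by (rule w_eq[OF elim(1)])
    then have 1: "norm (w z - N (r z)) = norm (U z (w z))"
      by (metis add_diff_cancel_left' diff_diff_eq2 norm_minus_commute)
    have "norm (w z) * \<kappa> z \<le> norm (w z) * (1/2)" using elim(2) by (intro mult_left_mono) auto
    then have "norm (w z) \<le> 2 * norm (N (r z))"
      using 1 Ubound[OF elim(1), of "w z"] norm_triangle_sub[of "w z" "N (r z)"] by linarith
    then have "norm (w z) * \<kappa> z \<le> 2 * norm (N (r z)) * \<kappa> z" using k0 by (intro mult_right_mono)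
    then show ?case using 1 Ubound[OF elim(1), of "w z"] by linarith
  qed
  have "((\<lambda>z. 2 * norm (N (r z)) * \<kappa> z) \<longlongrightarrow> 2 * norm (N (r z0)) * 0) (at z0)"
    by (intro tendsto_mult \<kappa> tendsto_norm Nr tendsto_const)
  then have "((\<lambda>z. w z - N (r z)) \<longlongrightarrow> 0) (at z0)"
    by (intro Lim_null_comparison[OF bound]) simp
  from tendsto_add[OF this Nr] have "(w \<longlongrightarrow> w z0) (at z0)"
    using w_eq[OF assms(2)] U0 by simp
  then have w: "isCont w z0" by (simp add: isCont_def)
  \<comment> \<open>As \<open>U z b\<close> vanishes at z0, continuity of the coefficient
    \<open>w z \<bullet> b\<close> there is enough for the product to be differentiable.\<close>
  have "((\<lambda>z. (w z \<bullet> b) *\<^sub>R U z b) has_derivative (\<lambda>h. (w z0 \<bullet> b) *\<^sub>R dd h (\<lambda>z. U z b) z0)) (at z0)" for b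
    by (intro has_derivative_scaleR_vanishing has_derivative_dd dU U0)
       (use w in \<open>auto intro: continuous_intros\<close>)
  then have d: "(\<lambda>z. N (r z) - (\<Sum>b\<in>Basis. (w z \<bullet> b) *\<^sub>R U z b)) differentiable (at z0)"
    by (intro differentiable_diff dNr differentiable_sum) (auto simp: differentiable_def)
  show ?thesis
  proof (rule differentiable_cong_open[OF assms(1,2) _ d])
    fix z assume z: "z \<in> S"
    show "N (r z) - (\<Sum>b\<in>Basis. (w z \<bullet> b) *\<^sub>R U z b) = w z"
      using w_eq[OF z] linear_basis_sum[OF linU[OF z], of "w z"] by simp
  qed
qed

section \<open>Smooth bump functions\<close>

text \<open>The flat functions \<open>t \<mapsto> t\<^sup>-\<^sup>n exp (-1/t)\<close> (extended by \<open>0\<close>) are closed under differentiation up to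
  linear combinations.\<close>

definition flat_fun :: "nat \<Rightarrow> real \<Rightarrow> real" where
  "flat_fun n t = (if t > 0 then (1/t)^n * exp (-(1/t)) else 0)"

text \<open>With x = 1/t this is the growth of the exponential beyond every power.\<close>

lemma flat_fun_tendsto_0: "(flat_fun n \<longlongrightarrow> 0) (at_right 0)"
proof -
  have "((\<lambda>x::real. x ^ n / exp x) \<longlongrightarrow> 0) at_top" by (rule tendsto_power_div_exp_0)
  then have "((\<lambda>t::real. inverse t ^ n / exp (inverse t)) \<longlongrightarrow> 0) (at_right 0)"
    using filterlim_compose filterlim_inverse_at_top_right by blast
  moreover have "\<forall>\<^sub>F t in at_right 0. inverse t ^ n / exp (inverse t) = flat_fun n t"
    using eventually_at_right_less[of 0]
    by eventually_elim (simp add: flat_fun_def exp_minus divide_inverse)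
  ultimately show ?thesis by (rule Lim_transform_eventually)
qed

text \<open>The delicate point is t = 0, where the difference quotient is 0 on the left and
  \<open>flat_fun (Suc n)\<close> on the right, which tends to 0; away from 0 the formula is the
  product rule.\<close>

lemma flat_fun_has_derivative:
  "(flat_fun n has_field_derivative (flat_fun (n + 2) t - real n * flat_fun (n + 1) t)) (at t)"
proof -
  consider "t < 0" | "t > 0" | "t = 0" by linarith
  then show ?thesis
  proof cases
    case 1
    have "((\<lambda>t. 0) has_field_derivative 0) (at t)" by simp
    moreover have "flat_fun (n + 2) t - real n * flat_fun (n + 1) t = 0"
      using 1 by (simp add: flat_fun_def)
    ultimately show ?thesis
      using has_field_derivative_transform_within_open[of "\<lambda>t. 0" 0 t "{..<0}" "flat_fun n"] 1
      by (auto simp: flat_fun_def)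
  next
    case 2
    have "((\<lambda>t. inverse t ^ n * exp (- inverse t)) has_field_derivative
        (real n * (- (inverse t ^ 2)) * inverse t ^ (n - 1)) * exp (- inverse t) +
        exp (- inverse t) * inverse t ^ 2 * inverse t ^ n) (at t)"
      using 2 by (auto intro!: derivative_eq_intros simp: power2_eq_square)
    moreover have "(real n * (- (inverse t ^ 2)) * inverse t ^ (n - 1)) * exp (- inverse t) +
        exp (- inverse t) * inverse t ^ 2 * inverse t ^ n =
        flat_fun (n + 2) t - real n * flat_fun (n + 1) t"
      using 2 by (cases n) (auto simp: flat_fun_def divide_inverse power2_eq_square)
    ultimately have "((\<lambda>t. inverse t ^ n * exp (- inverse t)) has_field_derivative
        flat_fun (n + 2) t - real n * flat_fun (n + 1) t) (at t)" by simp
    then show ?thesis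
      by (rule has_field_derivative_transform_within_open[where S="{0<..}"])
         (use 2 in \<open>auto simp: flat_fun_def divide_inverse\<close>)
  next
    case 3
    have "((\<lambda>h. flat_fun n h / h) \<longlongrightarrow> 0) (at 0)"
    proof (rule filterlim_split_at)
      show "((\<lambda>h. flat_fun n h / h) \<longlongrightarrow> 0) (at_left 0)"
        by (rule tendsto_eventually) (use eventually_at_left_real[of "-1" 0] in
            \<open>auto simp: flat_fun_def elim!: eventually_mono\<close>)
      have "\<forall>\<^sub>F h in at_right 0. flat_fun (Suc n) h = flat_fun n h / h"
        using eventually_at_right_less[of "0::real"]
        by eventually_elim (simp add: flat_fun_def)
      with flat_fun_tendsto_0[of "Suc n"] show "((\<lambda>h. flat_fun n h / h) \<longlongrightarrow> 0) (at_right 0)"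
        by (rule Lim_transform_eventually)
    qed
    then show ?thesis using 3 by (simp add: flat_fun_def DERIV_def)
  qed
qed

lemma smooth_flat_fun: "smooth_on UNIV (flat_fun n)"
proof -
  have "Ck_on k UNIV (flat_fun n)" for k
  proof (induction k arbitrary: n)
    case 0
    show ?case using flat_fun_has_derivative[of n]
      by (auto intro!: continuous_at_imp_continuous_on DERIV_isCont)
  next
    case (Suc k)
    show ?case
    proof (rule Ck_on_SucI)
      show "(flat_fun n has_derivative
          (*) (flat_fun (n + 2) x - real n * flat_fun (n + 1) x)) (at x)" for x
        using flat_fun_has_derivative[of n] by (simp add: has_field_derivative_def)
      fix v :: real
      have "Ck_on k UNIV (\<lambda>x. v * flat_fun (n + 2) x + (- (v * real n)) * flat_fun (n + 1) x)"
        by (intro Ck_on_add Ck_on_linear[OF _ bounded_linear_mult_right] Suc.IH) auto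
      then show "Ck_on k UNIV (\<lambda>x. (flat_fun (n + 2) x - real n * flat_fun (n + 1) x) * v)"
        by (simp add: algebra_simps)
    qed simp
  qed
  then show ?thesis by (simp add: smooth_on_def)
qed

lemma exists_bump:
  fixes x0 :: "'e::euclidean_space"
  assumes "r > 0"
  obtains \<psi> :: "'e \<Rightarrow> real" where "smooth_on UNIV \<psi>" "\<And>x. \<psi> x \<noteq> 0 \<longleftrightarrow> x \<in> ball x0 r"
proof
  \<comment> \<open>This is the square of r minus the squared distance to x0, positive exactly on
    the ball. It is spelled out as a sum of scaled products so that the closure rules for
    \<open>smooth_on\<close> apply.\<close>
  define q :: "'e \<Rightarrow> real" where
    "q x = r\<^sup>2 + (-1) *\<^sub>R (\<Sum>b\<in>Basis. ((x + - x0) \<bullet> b) *\<^sub>R ((x + - x0) \<bullet> b))" for x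
  have "smooth_on UNIV (\<lambda>x. (x + - x0) \<bullet> b)" for b
    by (intro smooth_on_linear[OF _ bounded_linear_inner_left] smooth_on_add smooth_on_ident
        smooth_on_const) auto
  then have "smooth_on UNIV q" unfolding q_def
    by (intro smooth_on_add smooth_on_const smooth_on_linear[OF _ bounded_linear_scaleR_right]
        smooth_on_sum smooth_on_scaleR) auto
  then show "smooth_on UNIV (\<lambda>x. flat_fun 0 (q x))"
    by (intro smooth_on_compose[OF _ _ smooth_flat_fun]) auto
  have q: "q x = r\<^sup>2 - (norm (x - x0))\<^sup>2" for x
    unfolding q_def power2_norm_eq_inner euclidean_inner[of "x - x0" "x - x0"] by simp
  show "flat_fun 0 (q x) \<noteq> 0 \<longleftrightarrow> x \<in> ball x0 r" for x
  proof -
    have "(norm (x - x0))\<^sup>2 < r\<^sup>2 \<longleftrightarrow> norm (x - x0) < r"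
      using assms power2_less_imp_less[of "norm (x - x0)" r]
        power_strict_mono[of "norm (x - x0)" r 2] by auto
    then show ?thesis unfolding q flat_fun_def by (simp add: dist_norm norm_minus_commute)
  qed
qed

section \<open>Tangent vectors in charts\<close>

lemma has_vector_derivative_line:
  assumes "f differentiable (at z)"
  shows "((\<lambda>t. f (z + t *\<^sub>R h)) has_vector_derivative dd h f z) (at 0)"
proof -
  have "((\<lambda>t. z + t *\<^sub>R h) has_derivative (\<lambda>t. t *\<^sub>R h)) (at 0)"
    by (auto intro!: derivative_eq_intros)
  moreover have "(f has_derivative (\<lambda>v. dd v f z)) (at (z + 0 *\<^sub>R h))"
    using has_derivative_dd[OF assms] by simp
  ultimately have "((\<lambda>t. f (z + t *\<^sub>R h)) has_derivative (\<lambda>t. dd (t *\<^sub>R h) f z)) (at 0)"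
    by (rule has_derivative_compose)
  then show ?thesis
    unfolding has_vector_derivative_def using linear_scale[OF dd_linear[OF assms]] by simp
qed

text \<open>Reads a directional derivative off the restriction to a line. In fibre directions this
  restriction is often affine or constant, which avoids a formula for the total derivative.\<close>

lemma dd_line_eq:
  assumes "f differentiable (at z)" "((\<lambda>t. f (z + t *\<^sub>R h)) has_vector_derivative D) (at 0)"
  shows "dd h f z = D"
  using has_vector_derivative_line[OF assms(1)] assms(2) vector_derivative_unique_at by blast

lemma fun_sum_apply: "(\<Sum>i\<in>I. f i) x = (\<Sum>i\<in>I. f i x :: 'b::comm_monoid_add)"
  by (induction I rule: infinite_finite_induct) auto

text \<open>Collects what tangent vectors require of an atlas without mentioning a topology, so that
  it covers both \<open>\<A>\<close> and \<open>slit_atlas \<A>\<close>, for which no topology is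
  fixed.\<close>

locale smooth_atlas =
  fixes B :: "('a, 'e::euclidean_space) chart set"
  assumes inj_chart: "c \<in> B \<Longrightarrow> inj_on (chart_map c) (chart_dom c)"
    and open_overlap: "c \<in> B \<Longrightarrow> d \<in> B \<Longrightarrow> open (chart_map c ` (chart_dom c \<inter> chart_dom d))"
    and smooth_trans: "c \<in> B \<Longrightarrow> d \<in> B \<Longrightarrow>
      smooth_on (chart_map c ` (chart_dom c \<inter> chart_dom d)) (chart_map d \<circ> chart_inv c)"
begin

lemma inv_map: "c \<in> B \<Longrightarrow> p \<in> chart_dom c \<Longrightarrow> chart_inv c (chart_map c p) = p"
  unfolding chart_inv_def using inj_chart by simp

lemma map_inv: "x \<in> chart_image c \<Longrightarrow> chart_map c (chart_inv c x) = x"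
  unfolding chart_inv_def chart_image_def by (rule f_inv_into_f)

lemma inv_in_dom: "x \<in> chart_image c \<Longrightarrow> chart_inv c x \<in> chart_dom c"
  unfolding chart_inv_def chart_image_def by (rule inv_into_into)

lemma map_in_image: "p \<in> chart_dom c \<Longrightarrow> chart_map c p \<in> chart_image c"
  unfolding chart_image_def by simp

lemma open_chart_image: "c \<in> B \<Longrightarrow> open (chart_image c)"
  using open_overlap[of c c] unfolding chart_image_def by simp

text \<open>The Jacobian at p of the change of coordinates from c to d.\<close>

definition tD :: "('a, 'e) chart \<Rightarrow> ('a, 'e) chart \<Rightarrow> 'a \<Rightarrow> 'e \<Rightarrow> 'e" where
  "tD c d p v = dd v (chart_map d \<circ> chart_inv c) (chart_map c p)"

lemma differentiable_trans:
  assumes "c \<in> B" "d \<in> B" "p \<in> chart_dom c" "p \<in> chart_dom d"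
  shows "(chart_map d \<circ> chart_inv c) differentiable (at (chart_map c p))"
  by (rule smooth_on_differentiable[OF smooth_trans[OF assms(1,2)]]) (use assms in auto)

lemma tD_linear:
  assumes "c \<in> B" "d \<in> B" "p \<in> chart_dom c" "p \<in> chart_dom d"
  shows "linear (tD c d p)"
  using dd_linear[OF differentiable_trans[OF assms]] unfolding tD_def[abs_def] .

lemma tD_self:
  assumes "c \<in> B" "p \<in> chart_dom c"
  shows "tD c c p v = v"
proof -
  have "dd v (chart_map c \<circ> chart_inv c) (chart_map c p) = dd v (\<lambda>x. x) (chart_map c p)"
    by (rule dd_cong[OF open_chart_image[OF assms(1)] map_in_image[OF assms(2)]]) (simp add: map_inv)
  then show ?thesis unfolding tD_def dd_def by simp
qed

lemma tD_cocycle: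
  assumes B: "c \<in> B" "d \<in> B" "e \<in> B" and p: "p \<in> chart_dom c" "p \<in> chart_dom d" "p \<in> chart_dom e"
  shows "tD d e p (tD c d p v) = tD c e p v"
proof -
  let ?S = "chart_map c ` (chart_dom c \<inter> chart_dom d)"
  have eq: "((chart_map e \<circ> chart_inv d) \<circ> (chart_map d \<circ> chart_inv c)) x = (chart_map e \<circ> chart_inv c) x"
    if "x \<in> ?S" for x using that B by (auto simp: inv_map)
  have "(chart_map e \<circ> chart_inv d) differentiable at ((chart_map d \<circ> chart_inv c) (chart_map c p))"
    using differentiable_trans[OF B(2,3) p(2,3)] B p by (simp add: inv_map)
  from dd_eq[OF diff_chain_at[OF has_derivative_dd[OF differentiable_trans[OF B(1,2) p(1,2)]]
        has_derivative_dd[OF this]], of v]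
  have "dd v ((chart_map e \<circ> chart_inv d) \<circ> (chart_map d \<circ> chart_inv c)) (chart_map c p) =
      tD d e p (tD c d p v)"
    using B p by (simp add: tD_def inv_map o_def)
  moreover have "dd v ((chart_map e \<circ> chart_inv d) \<circ> (chart_map d \<circ> chart_inv c)) (chart_map c p) =
      tD c e p v"
    unfolding tD_def by (rule dd_cong[OF open_overlap[OF B(1,2)] _ eq]) (use p in auto)
  ultimately show ?thesis by simp
qed

lemma tangent_space_iff:
  "v \<in> tangent_space B p \<longleftrightarrow> (\<forall>c. \<not> (c \<in> B \<and> p \<in> chart_dom c) \<longrightarrow> v c = 0) \<and>
     (\<forall>c\<in>B. \<forall>d\<in>B. p \<in> chart_dom c \<longrightarrow> p \<in> chart_dom d \<longrightarrow> v d = tD c d p (v c))"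
  unfolding tangent_space_def tD_def dd_def by auto

lemma tangent_tD:
  "v \<in> tangent_space B p \<Longrightarrow> c \<in> B \<Longrightarrow> d \<in> B \<Longrightarrow> p \<in> chart_dom c \<Longrightarrow> p \<in> chart_dom d \<Longrightarrow>
    v d = tD c d p (v c)"
  unfolding tangent_space_iff by blast

text \<open>The tangent vector at p whose component in the chart c is x.\<close>

definition tvec_of :: "('a, 'e) chart \<Rightarrow> 'a \<Rightarrow> 'e \<Rightarrow> ('a, 'e) tvec" where
  "tvec_of c p x = (\<lambda>d. if d \<in> B \<and> p \<in> chart_dom d then tD c d p x else 0)"

lemma tvec_of_apply: "d \<in> B \<Longrightarrow> p \<in> chart_dom d \<Longrightarrow> tvec_of c p x d = tD c d p x"
  by (simp add: tvec_of_def)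

lemma tvec_of_in:
  assumes "c \<in> B" "p \<in> chart_dom c"
  shows "tvec_of c p x \<in> tangent_space B p"
  unfolding tangent_space_iff using tD_cocycle[OF assms(1) _ _ assms(2)] by (simp add: tvec_of_def)

lemma tvec_of_same: "c \<in> B \<Longrightarrow> p \<in> chart_dom c \<Longrightarrow> tvec_of c p x c = x"
  by (simp add: tvec_of_def tD_self)

text \<open>One component determines all others through the transition maps, and components in
  charts away from p are 0 by convention. This reduces equalities of tangent vectors to a single
  convenient chart.\<close>

lemma tangent_eqI:
  assumes "v \<in> tangent_space B p" "w \<in> tangent_space B p" "c \<in> B" "p \<in> chart_dom c" "v c = w c"
  shows "v = w"
proof
  fix d
  show "v d = w d"
  proof (cases "d \<in> B \<and> p \<in> chart_dom d")
    case True
    then show ?thesis using tangent_tD assms by metis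
  next
    case False
    then have "v d = 0" "w d = 0" using assms(1,2) unfolding tangent_space_iff by blast+
    then show ?thesis by simp
  qed
qed

lemma tangent_zero: "0 \<in> tangent_space B p"
  unfolding tangent_space_iff using tD_linear by (auto simp: linear_0)

lemma tangentI:
  assumes "\<And>c. \<not> (c \<in> B \<and> p \<in> chart_dom c) \<Longrightarrow> v c = 0"
    and "\<And>c d. c \<in> B \<Longrightarrow> d \<in> B \<Longrightarrow> p \<in> chart_dom c \<Longrightarrow> p \<in> chart_dom d \<Longrightarrow> v d = tD c d p (v c)"
  shows "v \<in> tangent_space B p"
  using assms unfolding tangent_space_iff by blast

lemma tangent_out:
  "v \<in> tangent_space B p \<Longrightarrow> \<not> (c \<in> B \<and> p \<in> chart_dom c) \<Longrightarrow> v c = 0"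
  unfolding tangent_space_iff by blast

lemma tangent_add:
  assumes "v \<in> tangent_space B p" "w \<in> tangent_space B p"
  shows "v + w \<in> tangent_space B p"
proof (rule tangentI)
  show "(v + w) c = 0" if "\<not> (c \<in> B \<and> p \<in> chart_dom c)" for c
    using tangent_out[OF assms(1) that] tangent_out[OF assms(2) that] by simp
  show "(v + w) d = tD c d p ((v + w) c)"
    if "c \<in> B" "d \<in> B" "p \<in> chart_dom c" "p \<in> chart_dom d" for c d
    unfolding plus_fun_apply linear_add[OF tD_linear[OF that]]
    using tangent_tD[OF assms(1) that] tangent_tD[OF assms(2) that] by (rule arg_cong2)
qed

lemma tangent_scaleR:
  assumes "v \<in> tangent_space B p"
  shows "r *\<^sub>R v \<in> tangent_space B p"
proof (rule tangentI)
  show "(r *\<^sub>R v) c = 0" if "\<not> (c \<in> B \<and> p \<in> chart_dom c)" for c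
    using tangent_out[OF assms(1) that] by simp
  show "(r *\<^sub>R v) d = tD c d p ((r *\<^sub>R v) c)"
    if "c \<in> B" "d \<in> B" "p \<in> chart_dom c" "p \<in> chart_dom d" for c d
    unfolding scaleR_fun_apply linear_scale[OF tD_linear[OF that]]
    using tangent_tD[OF assms(1) that] by (rule arg_cong)
qed

lemma tangent_diff: "v \<in> tangent_space B p \<Longrightarrow> w \<in> tangent_space B p \<Longrightarrow> v - w \<in> tangent_space B p"
  using tangent_add[of v p "- 1 *\<^sub>R w"] tangent_scaleR[of w p "- 1"] by simp

lemma tangent_sum: "(\<And>i. i \<in> I \<Longrightarrow> f i \<in> tangent_space B p) \<Longrightarrow> (\<Sum>i\<in>I. f i) \<in> tangent_space B p"
  by (induction I rule: infinite_finite_induct) (auto simp: tangent_zero tangent_add)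

text \<open>The chart selected by \<open>SOME\<close> depends on the point alone, so one chart
  serves all directions and all functions, differentiable or not.\<close>

lemma dir_deriv_chart:
  assumes "p \<in> carrier_of B"
  obtains c where "c \<in> B" "p \<in> chart_dom c"
    "\<And>a (f :: 'a \<Rightarrow> 'b::real_normed_vector).
      dir_deriv B p a f = dd (a c) (f \<circ> chart_inv c) (chart_map c p)"
proof
  define c where "c = (SOME c. c \<in> B \<and> p \<in> chart_dom c)"
  have "\<exists>c. c \<in> B \<and> p \<in> chart_dom c" using assms unfolding carrier_of_def by auto
  then have "c \<in> B \<and> p \<in> chart_dom c" unfolding c_def by (rule someI_ex)
  then show "c \<in> B" "p \<in> chart_dom c" by auto
  show "dir_deriv B p a f = dd (a c) (f \<circ> chart_inv c) (chart_map c p)"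
    for a and f :: "'a \<Rightarrow> 'b"
    unfolding dir_deriv_def dd_def c_def Let_def ..
qed

end

locale smooth_mfd =
  fixes M :: "'a topology" and \<A> :: "('a, 'e::euclidean_space) chart set"
  assumes smooth_manifold: "smooth_manifold M \<A>"
begin

lemma chart_homeo:
  assumes "c \<in> \<A>"
  shows "openin M (chart_dom c)" "open (chart_image c)"
    "homeomorphic_map (subtopology M (chart_dom c)) (top_of_set (chart_image c)) (chart_map c)"
  using smooth_manifold assms unfolding smooth_manifold_def by auto

lemma open_image_chart:
  assumes "c \<in> \<A>" "openin M U" "U \<subseteq> chart_dom c"
  shows "open (chart_map c ` U)"
proof -
  have "openin (subtopology M (chart_dom c)) U"
    using assms chart_homeo(1) by (simp add: openin_open_subtopology)
  then have "openin (top_of_set (chart_image c)) (chart_map c ` U)"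
    using chart_homeo(3)[OF assms(1)] homeomorphic_map_openness[of _ _ "chart_map c" U]
      openin_subset by blast
  then show ?thesis using chart_homeo(2)[OF assms(1)] by (simp add: openin_open_eq)
qed

end

sublocale smooth_mfd \<subseteq> smooth_atlas \<A>
proof
  fix c assume c: "c \<in> \<A>"
  have top: "topspace (subtopology M (chart_dom c)) = chart_dom c"
    by (rule topspace_subtopology_subset[OF openin_subset[OF chart_homeo(1)[OF c]]])
  then show "inj_on (chart_map c) (chart_dom c)"
    using homeomorphic_imp_injective_map[OF chart_homeo(3)[OF c]] by simp
  fix d assume d: "d \<in> \<A>"
  show "open (chart_map c ` (chart_dom c \<inter> chart_dom d))"
    using chart_homeo(1)[OF c] chart_homeo(1)[OF d] by (intro open_image_chart[OF c]) auto
  show "smooth_on (chart_map c ` (chart_dom c \<inter> chart_dom d)) (chart_map d \<circ> chart_inv c)"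
    using smooth_manifold c d unfolding smooth_manifold_def by blast
qed

section \<open>The slit tangent bundle\<close>

context smooth_mfd
begin

abbreviation "sl \<equiv> slit_chart \<A>"

lemma sl_dom: "u \<in> chart_dom (sl c) \<longleftrightarrow> u \<in> slit \<A> \<and> fst u \<in> chart_dom c"
  by (auto simp: slit_chart_def)

lemma sl_map: "chart_map (sl c) u = (chart_map c (fst u), snd u c)"
  by (simp add: slit_chart_def)

lemma slitD: "u \<in> slit \<A> \<Longrightarrow> fst u \<in> carrier_of \<A> \<and> snd u \<in> tangent_space \<A> (fst u) \<and> snd u \<noteq> 0"
  by (auto simp: slit_def tangent_bundle_def)

lemma slit_snd_nonzero:
  assumes "u \<in> slit \<A>" "c \<in> \<A>" "fst u \<in> chart_dom c"
  shows "snd u c \<noteq> 0"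
  using tangent_eqI[OF _ tangent_zero assms(2,3), of "snd u"] slitD[OF assms(1)]
  by auto

lemma slit_chart_ex:
  assumes "u \<in> slit \<A>"
  obtains c where "c \<in> \<A>" "fst u \<in> chart_dom c"
  using slitD[OF assms] unfolding carrier_of_def by auto

lemma slitI:
  assumes "c \<in> \<A>" "p \<in> chart_dom c" "v \<in> tangent_space \<A> p" "v c \<noteq> 0"
  shows "(p, v) \<in> slit \<A>"
  using assms unfolding slit_def tangent_bundle_def carrier_of_def by auto

text \<open>A nonzero tangent vector has a nonzero component in every chart around its foot point,
  and each nonzero y is the component of \<open>tvec_of c p y\<close>. The slit fibres are therefore
  complete in coordinates, and all chart images are products.\<close>

lemma sl_overlap:
  assumes "c \<in> \<A>" "d \<in> \<A>"
  shows "chart_map (sl c) ` (chart_dom (sl c) \<inter> chart_dom (sl d)) =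
    (chart_map c ` (chart_dom c \<inter> chart_dom d)) \<times> (- {0::'e})"
proof (intro set_eqI iffI)
  fix z assume "z \<in> chart_map (sl c) ` (chart_dom (sl c) \<inter> chart_dom (sl d))"
  then show "z \<in> (chart_map c ` (chart_dom c \<inter> chart_dom d)) \<times> (- {0::'e})"
    using slit_snd_nonzero[OF _ assms(1)] by (auto simp: sl_dom sl_map)
next
  fix z assume "z \<in> (chart_map c ` (chart_dom c \<inter> chart_dom d)) \<times> (- {0::'e})"
  then obtain p y where z: "z = (chart_map c p, y)" "p \<in> chart_dom c" "p \<in> chart_dom d" "y \<noteq> 0"
    by auto
  have "(p, tvec_of c p y) \<in> slit \<A>"
    using z by (intro slitI[OF assms(1)] tvec_of_in[OF assms(1)]) (auto simp: tvec_of_same assms)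
  moreover have "chart_map (sl c) (p, tvec_of c p y) = z"
    using z by (simp add: sl_map tvec_of_same assms)
  ultimately show "z \<in> chart_map (sl c) ` (chart_dom (sl c) \<inter> chart_dom (sl d))"
    using z by (force simp: sl_dom image_iff)
qed

lemma sl_image: "c \<in> \<A> \<Longrightarrow> chart_image (sl c) = chart_image c \<times> (- {0::'e})"
  using sl_overlap[of c c] unfolding chart_image_def by simp

lemma sl_inj: assumes "c \<in> \<A>" shows "inj_on (chart_map (sl c)) (chart_dom (sl c))"
proof (rule inj_onI)
  fix u w assume uw: "u \<in> chart_dom (sl c)" "w \<in> chart_dom (sl c)" "chart_map (sl c) u = chart_map (sl c) w"
  then have "fst u = fst w" using inj_chart[OF assms] by (auto simp: sl_map sl_dom inj_on_def)
  moreover have "snd u = snd w"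
  proof (rule tangent_eqI[OF _ _ assms])
    show "snd u \<in> tangent_space \<A> (fst u)" "snd w \<in> tangent_space \<A> (fst u)"
      using slitD[of u] slitD[of w] uw(1,2) \<open>fst u = fst w\<close> by (simp_all add: sl_dom)
  qed (use uw in \<open>auto simp: sl_map sl_dom\<close>)
  ultimately show "u = w" by (rule prod_eqI)
qed

lemma sl_inv:
  assumes "c \<in> \<A>" "x \<in> chart_image c" "y \<noteq> 0"
  shows "chart_inv (sl c) (x, y) = (chart_inv c x, tvec_of c (chart_inv c x) y)"
proof -
  have 1: "(chart_inv c x, tvec_of c (chart_inv c x) y) \<in> chart_dom (sl c)"
    using assms inv_in_dom[OF assms(2)]
    by (auto simp: sl_dom tvec_of_same intro!: slitI[OF assms(1)] tvec_of_in)
  have 2: "chart_map (sl c) (chart_inv c x, tvec_of c (chart_inv c x) y) = (x, y)"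
    using assms inv_in_dom[OF assms(2)] by (simp add: sl_map map_inv tvec_of_same)
  show ?thesis unfolding chart_inv_def[of "sl c"] using inv_into_f_f[OF sl_inj[OF assms(1)] 1] 2 by simp
qed

lemma sl_trans:
  assumes "c \<in> \<A>" "d \<in> \<A>" "z \<in> chart_map c ` (chart_dom c \<inter> chart_dom d) \<times> (- {0::'e})"
  shows "(chart_map (sl d) \<circ> chart_inv (sl c)) z =
    ((chart_map d \<circ> chart_inv c) (fst z), dd (snd z) (chart_map d \<circ> chart_inv c) (fst z))"
proof -
  have x: "fst z \<in> chart_image c" and y: "snd z \<noteq> 0" using assms(3) by (auto simp: chart_image_def)
  have "chart_inv c (fst z) \<in> chart_dom d" using assms(3) inv_map[OF assms(1)] by force
  then show ?thesis using sl_inv[OF assms(1) x y] inv_in_dom[OF x]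
    by (simp add: sl_map tvec_of_apply assms tD_def map_inv[OF x])
qed

text \<open>The fibre part of the transition map is the Jacobian of the base transition applied to
  y: linear in y with coefficients smooth in x, hence a case of
  \<open>smooth_on_linear_family\<close>.\<close>

lemma smooth_sl_trans:
  assumes "c \<in> \<A>" "d \<in> \<A>"
  shows "smooth_on (chart_map (sl c) ` (chart_dom (sl c) \<inter> chart_dom (sl d)))
    (chart_map (sl d) \<circ> chart_inv (sl c))"
proof -
  let ?U = "chart_map c ` (chart_dom c \<inter> chart_dom d)" and ?t = "chart_map d \<circ> chart_inv c"
  have U: "open ?U" by (rule open_overlap[OF assms])
  then have S: "open (?U \<times> - {0::'e})" by (intro open_Times open_Compl) auto
  have comp: "smooth_on (?U \<times> - {0::'e}) (\<lambda>z. f (fst z))" if "smooth_on ?U f" for f :: "'e \<Rightarrow> 'e"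
    by (rule smooth_on_compose[OF S U that]) (auto intro: smooth_on_bounded_linear[OF S bounded_linear_fst])
  have "smooth_on (?U \<times> - {0::'e}) (\<lambda>z. (?t (fst z), dd (snd z) ?t (fst z)))"
  proof (rule smooth_on_Pair[OF S comp[OF smooth_trans[OF assms]]],
      rule smooth_on_linear_family[OF S, where B="\<lambda>z v. dd v ?t (fst z)"])
    show "linear (\<lambda>v. dd v ?t (fst z))" if "z \<in> ?U \<times> - {0}" for z
      using that by (intro dd_linear smooth_on_differentiable[OF smooth_trans[OF assms]]) auto
    show "smooth_on (?U \<times> - {0::'e}) (\<lambda>z. dd b ?t (fst z))" for b
      by (rule comp[OF smooth_on_dd[OF smooth_trans[OF assms]]])
    show "smooth_on (?U \<times> - {0::'e}) snd" by (rule smooth_on_bounded_linear[OF S bounded_linear_snd])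
  qed
  then have "smooth_on (?U \<times> - {0::'e}) (chart_map (sl d) \<circ> chart_inv (sl c))"
    by (rule smooth_on_cong[OF S, rotated]) (rule sl_trans[OF assms, symmetric])
  then show ?thesis by (simp only: sl_overlap[OF assms])
qed

end

sublocale smooth_mfd \<subseteq> slit: smooth_atlas "slit_atlas \<A>"
proof
  fix c' assume "c' \<in> slit_atlas \<A>"
  then obtain c where c: "c \<in> \<A>" "c' = sl c" by (auto simp: slit_atlas_def)
  show "inj_on (chart_map c') (chart_dom c')" unfolding c(2) by (rule sl_inj[OF c(1)])
  fix d' assume "d' \<in> slit_atlas \<A>"
  then obtain d where d: "d \<in> \<A>" "d' = sl d" by (auto simp: slit_atlas_def)
  show "open (chart_map c' ` (chart_dom c' \<inter> chart_dom d'))"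
    unfolding c d sl_overlap[OF c(1) d(1)] using open_overlap[OF c(1) d(1)] by (intro open_Times open_Compl) auto
  show "smooth_on (chart_map c' ` (chart_dom c' \<inter> chart_dom d')) (chart_map d' \<circ> chart_inv c')"
    unfolding c d by (rule smooth_sl_trans[OF c(1) d(1)])
qed

context smooth_mfd
begin

lemma sl_in: "c \<in> \<A> \<Longrightarrow> sl c \<in> slit_atlas \<A>"
  by (simp add: slit_atlas_def)

lemma slit_carrier: "carrier_of (slit_atlas \<A>) = slit \<A>"
proof (intro equalityI subsetI)
  fix u assume u: "u \<in> slit \<A>"
  obtain c where "c \<in> \<A>" "fst u \<in> chart_dom c" using slit_chart_ex[OF u] .
  then show "u \<in> carrier_of (slit_atlas \<A>)"
    unfolding carrier_of_def by (intro UN_I[OF sl_in]) (use u sl_dom in auto)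
qed (auto simp: carrier_of_def slit_atlas_def sl_dom)

text \<open>The Jacobian of a slit transition map is block triangular. Its base block ignores the
  fibre increment, which makes \<rho> well defined, and on vertical vectors it acts as the base
  Jacobian, which does the same for \<gamma>.\<close>

lemma tD_sl:
  assumes c: "c \<in> \<A>" "d \<in> \<A>" and u: "u \<in> slit \<A>" "fst u \<in> chart_dom c" "fst u \<in> chart_dom d"
  shows "fst (slit.tD (sl c) (sl d) u a) = tD c d (fst u) (fst a)"
    and "slit.tD (sl c) (sl d) u (0, w) = (0, tD c d (fst u) w)"
proof -
  let ?T = "chart_map (sl d) \<circ> chart_inv (sl c)" and ?t = "chart_map d \<circ> chart_inv c"
  let ?U = "chart_map c ` (chart_dom c \<inter> chart_dom d)"
  let ?z = "chart_map (sl c) u"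
  have y: "snd u c \<noteq> 0" by (rule slit_snd_nonzero[OF u(1) c(1) u(2)])
  have dT: "?T differentiable (at ?z)"
    by (rule slit.differentiable_trans) (use c u in \<open>auto simp: sl_in sl_dom\<close>)
  have S: "open (?U \<times> - {0::'e})" using open_overlap[OF c] by (intro open_Times open_Compl) auto
  have zS: "?z \<in> ?U \<times> - {0}" using y u by (auto simp: sl_map)
  have dt: "?t differentiable (at (chart_map c (fst u)))"
    by (rule differentiable_trans[OF c u(2,3)])
  have "((\<lambda>z. fst (?T z)) has_derivative (\<lambda>h. fst (dd h ?T ?z))) (at ?z)"
    by (rule bounded_linear.has_derivative[OF bounded_linear_fst has_derivative_dd[OF dT]])
  moreover have "((\<lambda>z. ?t (fst z)) has_derivative (\<lambda>h. dd (fst h) ?t (fst ?z))) (at ?z)"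
  proof (rule has_derivative_compose[of fst fst])
    show "(fst has_derivative fst) (at ?z)" by (rule bounded_linear_imp_has_derivative[OF bounded_linear_fst])
    show "(?t has_derivative (\<lambda>h. dd h ?t (fst ?z))) (at (fst ?z))"
      using has_derivative_dd[OF dt] by (simp add: sl_map)
  qed
  then have "((\<lambda>z. fst (?T z)) has_derivative (\<lambda>h. dd (fst h) ?t (fst ?z))) (at ?z)"
    by (rule has_derivative_transform_within_open[OF _ S zS]) (simp only: sl_trans[OF c] fst_conv)
  ultimately have "(\<lambda>h. fst (dd h ?T ?z)) = (\<lambda>h. dd (fst h) ?t (fst ?z))"
    by (rule has_derivative_unique)
  then show "fst (slit.tD (sl c) (sl d) u a) = tD c d (fst u) (fst a)"
    unfolding slit.tD_def tD_def by (metis fst_conv sl_map)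
  show "slit.tD (sl c) (sl d) u (0, w) = (0, tD c d (fst u) w)"
    unfolding slit.tD_def
  proof (rule dd_line_eq[OF dT])
    let ?x = "chart_map c (fst u)"
    note lin = dd_linear[OF dt]
    \<comment> \<open>Along a vertical line the base point stays fixed and the transition map is
      affine in t, as long as the line avoids the zero vector.\<close>
    have "((\<lambda>t. (?t ?x, dd (snd u c) ?t ?x + t *\<^sub>R dd w ?t ?x)) has_vector_derivative
        (0, dd w ?t ?x)) (at 0)"
      by (auto intro!: derivative_eq_intros)
    then have "((\<lambda>t. ?T (?z + t *\<^sub>R (0, w))) has_vector_derivative (0, dd w ?t ?x)) (at 0)"
    proof (rule has_vector_derivative_transform_within_open)
      show "open ((\<lambda>t. ?z + t *\<^sub>R (0, w)) -` (?U \<times> - {0::'e}))"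
        by (rule open_vimage[OF S]) (intro continuous_intros)
      show "0 \<in> (\<lambda>t. ?z + t *\<^sub>R (0, w)) -` (?U \<times> - {0::'e})"
        using zS by (simp add: zero_prod_def[symmetric])
      fix t assume "t \<in> (\<lambda>t. ?z + t *\<^sub>R (0, w)) -` (?U \<times> - {0::'e})"
      then have "?z + t *\<^sub>R (0, w) \<in> ?U \<times> - {0::'e}" by (rule vimageD)
      from sl_trans[OF c this]
      show "(?t ?x, dd (snd u c) ?t ?x + t *\<^sub>R dd w ?t ?x) = ?T (?z + t *\<^sub>R (0, w))"
        by (simp add: sl_map linear_add[OF lin] linear_scale[OF lin])
    qed
    then show "((\<lambda>t. ?T (?z + t *\<^sub>R (0, w))) has_vector_derivative (0, tD c d (fst u) w)) (at 0)"
      unfolding tD_def .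
  qed
qed

text \<open>The formula holds for every family a, with c the chart that \<open>dir_deriv\<close>
  happens to select. It can thus be applied to a Lie bracket without first proving that the bracket
  is a tangent vector.\<close>

lemma rho_chart:
  assumes u: "u \<in> slit \<A>"
  obtains c where "c \<in> \<A>" "fst u \<in> chart_dom c"
    "\<And>a. rho \<A> u a = tvec_of c (fst u) (fst (a (sl c)))"
proof -
  obtain c' where c': "c' \<in> slit_atlas \<A>" "u \<in> chart_dom c'"
    "\<And>a (f :: _ \<Rightarrow> 'e). dir_deriv (slit_atlas \<A>) u a f = dd (a c') (f \<circ> chart_inv c') (chart_map c' u)"
    using slit.dir_deriv_chart u slit_carrier by metis
  then obtain c where c: "c \<in> \<A>" "c' = sl c" by (auto simp: slit_atlas_def)
  then have uc: "fst u \<in> chart_dom c" using c'(2) sl_dom by blast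
  have "dir_deriv (slit_atlas \<A>) u a (chart_map d \<circ> fst) = tD c d (fst u) (fst (a (sl c)))"
    if d: "d \<in> \<A>" "fst u \<in> chart_dom d" for a d
  proof -
    let ?T = "chart_map (sl d) \<circ> chart_inv (sl c)"
    have "?T differentiable (at (chart_map (sl c) u))"
      by (rule slit.differentiable_trans) (use c d u uc in \<open>auto simp: sl_in sl_dom\<close>)
    then have "((\<lambda>z. fst (?T z)) has_derivative (\<lambda>h. fst (dd h ?T (chart_map (sl c) u))))
        (at (chart_map (sl c) u))"
      by (intro bounded_linear.has_derivative[OF bounded_linear_fst] has_derivative_dd)
    moreover have "chart_map d \<circ> fst \<circ> chart_inv (sl c) = (\<lambda>z. fst (?T z))"
      by (auto simp: sl_map)
    ultimately have "dir_deriv (slit_atlas \<A>) u a (chart_map d \<circ> fst) =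
        fst (slit.tD (sl c) (sl d) u (a (sl c)))"
      unfolding c'(3) c(2) slit.tD_def by (simp add: dd_eq)
    then show ?thesis using tD_sl(1)[OF c(1) d(1) u uc d(2)] by simp
  qed
  then have "rho \<A> u a = tvec_of c (fst u) (fst (a (sl c)))" for a
    unfolding rho_def tangent_map_def tvec_of_def by auto
  then show thesis using that c(1) uc by blast
qed

lemma rho_in: "u \<in> slit \<A> \<Longrightarrow> rho \<A> u a \<in> tangent_space \<A> (fst u)"
  by (metis rho_chart tvec_of_in)

lemma rho_apply:
  assumes u: "u \<in> slit \<A>" and a: "a \<in> tangent_space (slit_atlas \<A>) u"
    and d: "d \<in> \<A>" "fst u \<in> chart_dom d"
  shows "rho \<A> u a d = fst (a (sl d))"
proof -
  obtain c where c: "c \<in> \<A>" "fst u \<in> chart_dom c"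
    and r: "\<And>a. rho \<A> u a = tvec_of c (fst u) (fst (a (sl c)))"
    using rho_chart[OF u] by blast
  have "a (sl d) = slit.tD (sl c) (sl d) u (a (sl c))"
    by (rule slit.tangent_tD[OF a]) (use c d u in \<open>auto simp: sl_in sl_dom\<close>)
  then show ?thesis unfolding r using tD_sl(1)[OF c(1) d(1) u c(2) d(2)]
    by (simp add: tvec_of_apply[OF d])
qed

lemma gam_apply:
  assumes u: "u \<in> slit \<A>" and c: "c \<in> \<A>" "fst u \<in> chart_dom c"
  shows "gam \<A> u v (sl c) = (0, v c)"
proof -
  have "chart_map (sl c) \<circ> (\<lambda>t. (fst u, snd u + t *\<^sub>R v)) =
      (\<lambda>t. (chart_map c (fst u), snd u c + t *\<^sub>R v c))"
    by (auto simp: sl_map)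
  moreover have "((\<lambda>t. (chart_map c (fst u), snd u c + t *\<^sub>R v c)) has_vector_derivative (0, v c)) (at 0)"
    by (auto intro!: derivative_eq_intros)
  ultimately show ?thesis
    unfolding gam_def velocity_def using sl_in[OF c(1)] sl_dom u c(2)
    by (simp add: vector_derivative_at)
qed

lemma gam_in:
  assumes u: "u \<in> slit \<A>" and v: "v \<in> tangent_space \<A> (fst u)"
  shows "gam \<A> u v \<in> tangent_space (slit_atlas \<A>) u"
proof (rule slit.tangentI)
  show "gam \<A> u v c' = 0" if "\<not> (c' \<in> slit_atlas \<A> \<and> u \<in> chart_dom c')" for c'
    using that unfolding gam_def velocity_def by auto
  fix c' d' assume "c' \<in> slit_atlas \<A>" "d' \<in> slit_atlas \<A>" and dom: "u \<in> chart_dom c'" "u \<in> chart_dom d'"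
  then obtain c d where c: "c \<in> \<A>" "c' = sl c" and d: "d \<in> \<A>" "d' = sl d"
    by (auto simp: slit_atlas_def)
  have uc: "fst u \<in> chart_dom c" "fst u \<in> chart_dom d" using dom c d sl_dom by auto
  show "gam \<A> u v d' = slit.tD c' d' u (gam \<A> u v c')"
    unfolding c d gam_apply[OF u c(1) uc(1)] gam_apply[OF u d(1) uc(2)] tD_sl(2)[OF c(1) d(1) u uc]
    using tangent_tD[OF v c(1) d(1) uc] by simp
qed

lemma rho_gam: 
  assumes u: "u \<in> slit \<A>" and v: "v \<in> tangent_space \<A> (fst u)"
  shows "rho \<A> u (gam \<A> u v) = 0"
proof -
  obtain c where c: "c \<in> \<A>" "fst u \<in> chart_dom c" using slit_chart_ex[OF u] .
  show ?thesis
    by (rule tangent_eqI[OF rho_in[OF u] tangent_zero c])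
       (simp add: rho_apply[OF u gam_in[OF u v] c] gam_apply[OF u c])
qed

section \<open>Fields on the slit bundle in coordinates\<close>

definition pcomp :: "('a, 'e) chart \<Rightarrow> ('a, 'e) pi_field \<Rightarrow> 'e \<times> 'e \<Rightarrow> 'e" where
  "pcomp c X z = X (chart_inv (sl c) z) c"

lemma open_sl_image: "c \<in> \<A> \<Longrightarrow> open (chart_image (sl c))"
  by (rule slit.open_chart_image[OF sl_in])

lemma sl_inv_slit:
  assumes "c \<in> \<A>" "z \<in> chart_image (sl c)"
  shows "chart_inv (sl c) z \<in> slit \<A>" "fst (chart_inv (sl c) z) \<in> chart_dom c"
    "chart_map c (fst (chart_inv (sl c) z)) = fst z" "snd (chart_inv (sl c) z) c = snd z"
    "chart_map (sl c) (chart_inv (sl c) z) = z"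
proof -
  have "chart_inv (sl c) z \<in> chart_dom (sl c)" by (rule slit.inv_in_dom[OF assms(2)])
  then show "chart_inv (sl c) z \<in> slit \<A>" "fst (chart_inv (sl c) z) \<in> chart_dom c"
    by (auto simp: sl_dom)
  show 1: "chart_map (sl c) (chart_inv (sl c) z) = z" by (rule slit.map_inv[OF assms(2)])
  show "chart_map c (fst (chart_inv (sl c) z)) = fst z" "snd (chart_inv (sl c) z) c = snd z"
    using 1 unfolding sl_map by (metis fst_conv, metis snd_conv)
qed

lemma sl_map_image:
  "u \<in> slit \<A> \<Longrightarrow> fst u \<in> chart_dom c \<Longrightarrow> chart_map (sl c) u \<in> chart_image (sl c)"
  by (rule slit.map_in_image) (simp add: sl_dom)

lemma sl_inv_map:
  "u \<in> slit \<A> \<Longrightarrow> c \<in> \<A> \<Longrightarrow> fst u \<in> chart_dom c \<Longrightarrow> chart_inv (sl c) (chart_map (sl c) u) = u"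
  by (rule slit.inv_map[OF sl_in]) (simp_all add: sl_dom)

lemma pi_fieldD:
  assumes "X \<in> pi_fields \<A>"
  shows "u \<in> slit \<A> \<Longrightarrow> X u \<in> tangent_space \<A> (fst u)" "u \<notin> slit \<A> \<Longrightarrow> X u = 0"
    "c \<in> \<A> \<Longrightarrow> smooth_on (chart_image (sl c)) (pcomp c X)"
  using assms unfolding pi_fields_def pcomp_def[abs_def] by blast+

lemma pi_fieldI:
  assumes "\<And>u. u \<in> slit \<A> \<Longrightarrow> X u \<in> tangent_space \<A> (fst u)" "\<And>u. u \<notin> slit \<A> \<Longrightarrow> X u = 0"
    "\<And>c. c \<in> \<A> \<Longrightarrow> smooth_on (chart_image (sl c)) (pcomp c X)"
  shows "X \<in> pi_fields \<A>"
  using assms unfolding pi_fields_def pcomp_def[abs_def] by auto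

lemma pi_field_zero: "0 \<in> pi_fields \<A>"
proof (rule pi_fieldI)
  show "smooth_on (chart_image (sl c)) (pcomp c 0)" if "c \<in> \<A>" for c
    unfolding pcomp_def[abs_def] using smooth_on_const[OF open_sl_image[OF that], of 0] by simp
qed (auto simp: tangent_zero)

lemma pi_field_add:
  assumes "X \<in> pi_fields \<A>" "Y \<in> pi_fields \<A>"
  shows "X + Y \<in> pi_fields \<A>"
proof (rule pi_fieldI)
  show "smooth_on (chart_image (sl c)) (pcomp c (X + Y))" if "c \<in> \<A>" for c
    using smooth_on_add[OF open_sl_image[OF that] pi_fieldD(3)[OF assms(1) that]
        pi_fieldD(3)[OF assms(2) that]]
    by (simp add: pcomp_def[abs_def])
qed (use assms in \<open>auto simp: pi_fieldD tangent_add\<close>)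

lemma pi_field_scaleR:
  assumes "X \<in> pi_fields \<A>"
  shows "r *\<^sub>R X \<in> pi_fields \<A>"
proof (rule pi_fieldI)
  show "smooth_on (chart_image (sl c)) (pcomp c (r *\<^sub>R X))" if "c \<in> \<A>" for c
    using smooth_on_linear[OF open_sl_image[OF that] bounded_linear_scaleR_right[of r]
        pi_fieldD(3)[OF assms that]]
    by (simp add: pcomp_def[abs_def])
qed (use assms in \<open>auto simp: pi_fieldD tangent_scaleR\<close>)

lemma pi_field_diff: "X \<in> pi_fields \<A> \<Longrightarrow> Y \<in> pi_fields \<A> \<Longrightarrow> X - Y \<in> pi_fields \<A>"
  using pi_field_add[of X "- 1 *\<^sub>R Y"] pi_field_scaleR[of Y "- 1"] by simp

lemma eta_in: "eta \<A> \<in> pi_fields \<A>"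
proof (rule pi_fieldI)
  show "smooth_on (chart_image (sl c)) (pcomp c (eta \<A>))" if "c \<in> \<A>" for c
  proof (rule smooth_on_cong[OF open_sl_image[OF that]])
    show "smooth_on (chart_image (sl c)) snd"
      by (rule smooth_on_bounded_linear[OF open_sl_image[OF that] bounded_linear_snd])
  qed (use sl_inv_slit[OF that] in \<open>simp add: pcomp_def eta_def on_slit_def\<close>)
qed (auto simp: eta_def on_slit_def slitD)

lemma vector_fieldD:
  assumes "V \<in> vector_fields (slit_atlas \<A>)"
  shows "u \<in> slit \<A> \<Longrightarrow> V u \<in> tangent_space (slit_atlas \<A>) u"
  using assms unfolding vector_fields_def slit_carrier by auto

lemma vector_fieldI:
  assumes "\<And>u. u \<in> slit \<A> \<Longrightarrow> V u \<in> tangent_space (slit_atlas \<A>) u" "\<And>u. u \<notin> slit \<A> \<Longrightarrow> V u = 0"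
    "\<And>c. c \<in> \<A> \<Longrightarrow> smooth_on (chart_image (sl c)) (\<lambda>z. V (chart_inv (sl c) z) (sl c))"
  shows "V \<in> vector_fields (slit_atlas \<A>)"
  using assms unfolding vector_fields_def slit_carrier by (auto simp: slit_atlas_def)

lemma gam_field_in:
  assumes X: "X \<in> pi_fields \<A>"
  shows "gam_field \<A> X \<in> vector_fields (slit_atlas \<A>)"
proof (rule vector_fieldI)
  show "gam_field \<A> X u \<in> tangent_space (slit_atlas \<A>) u" if "u \<in> slit \<A>" for u
    using gam_in[OF that pi_fieldD(1)[OF X that]] that by (simp add: gam_field_def on_slit_def)
  show "gam_field \<A> X u = 0" if "u \<notin> slit \<A>" for u
    using that by (simp add: gam_field_def on_slit_def)
  fix c assume c: "c \<in> \<A>"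
  show "smooth_on (chart_image (sl c)) (\<lambda>z. gam_field \<A> X (chart_inv (sl c) z) (sl c))"
  proof (rule smooth_on_cong[OF open_sl_image[OF c]])
    show "smooth_on (chart_image (sl c)) (\<lambda>z. (0::'e, pcomp c X z))"
      by (intro smooth_on_Pair open_sl_image smooth_on_const pi_fieldD(3) c X)
    fix z assume z: "z \<in> chart_image (sl c)"
    show "(0, pcomp c X z) = gam_field \<A> X (chart_inv (sl c) z) (sl c)"
      using gam_apply[OF sl_inv_slit(1)[OF c z] c sl_inv_slit(2)[OF c z]] sl_inv_slit(1)[OF c z]
      by (simp add: gam_field_def on_slit_def pcomp_def)
  qed
qed

text \<open>Compact sets are closed in a Hausdorff space. The complement is then open, as needed to
  continue a field with compactly supported base cutoff by 0.\<close>

lemma compact_chart_image_closed: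
  assumes c: "c \<in> \<A>" and C: "compact C" "C \<subseteq> chart_image c"
  shows "closedin M (chart_inv c ` C)"
proof -
  \<comment> \<open>\<open>chart_inv\<close> is a mere set-theoretic inverse; continuity comes from
    the inverse homeomorphism g, which agrees with it on C.\<close>
  obtain g where g: "homeomorphic_maps (subtopology M (chart_dom c)) (top_of_set (chart_image c)) (chart_map c) g"
    using chart_homeo(3)[OF c] homeomorphic_map_maps by blast
  have top: "topspace (subtopology M (chart_dom c)) = chart_dom c"
    by (rule topspace_subtopology_subset[OF openin_subset[OF chart_homeo(1)[OF c]]])
  have gc: "continuous_map (top_of_set (chart_image c)) M g"
    using g unfolding homeomorphic_maps_def continuous_map_in_subtopology by blast
  have gm: "g (chart_map c p) = p" if "p \<in> chart_dom c" for p
    using g top that unfolding homeomorphic_maps_def by simp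
  have "g x = chart_inv c x" if "x \<in> C" for x
  proof -
    have "x \<in> chart_image c" using that C by auto
    then show ?thesis using gm[OF inv_in_dom] by (simp add: map_inv)
  qed
  then have "g ` C = chart_inv c ` C" by auto
  moreover have "compactin (top_of_set (chart_image c)) C"
    using C by (simp add: compactin_subtopology)
  ultimately have "compactin M (chart_inv c ` C)"
    using image_compactin[OF _ gc] by metis
  then show ?thesis
    using compactin_imp_closedin smooth_manifold unfolding smooth_manifold_def by blast
qed

text \<open>A cutoff in the base variable alone suffices, since the domain of \<open>sl c\<close> contains the whole
  slit fibres over the domain of \<open>c\<close>.\<close>

lemma exists_global_frame:
  assumes c: "c \<in> \<A>" and x0: "x0 \<in> chart_image c"
  obtains \<psi> :: "'e \<Rightarrow> real" and F :: "'e \<times> 'e \<Rightarrow> ('a, 'e) slit_field" where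
    "\<psi> x0 \<noteq> 0" "\<And>b. F b \<in> vector_fields (slit_atlas \<A>)"
    "\<And>b u. u \<in> slit \<A> \<Longrightarrow> fst u \<in> chart_dom c \<Longrightarrow> F b u (sl c) = \<psi> (chart_map c (fst u)) *\<^sub>R b"
proof -
  \<comment> \<open>The preimage of the closed ball is compact, hence closed in M, and contains
    every point at which the cutoff is nonzero.\<close>
  obtain r where r: "r > 0" "cball x0 r \<subseteq> chart_image c"
    using open_chart_image[OF c] x0 open_contains_cball by blast
  obtain \<psi> :: "'e \<Rightarrow> real" where \<psi>: "smooth_on UNIV \<psi>" "\<And>x. \<psi> x \<noteq> 0 \<longleftrightarrow> x \<in> ball x0 r"
    using exists_bump[OF r(1)] by blast
  \<comment> \<open>The field with constant components b in the chart \<open>sl c\<close>,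
    multiplied by the cutoff and continued by 0.\<close>
  define F where "F b u = (if u \<in> slit \<A> \<and> fst u \<in> chart_dom c
    then \<psi> (chart_map c (fst u)) *\<^sub>R slit.tvec_of (sl c) u b else 0)" for b u
  have "F b \<in> vector_fields (slit_atlas \<A>)" for b
  proof (rule vector_fieldI)
    show "F b u \<in> tangent_space (slit_atlas \<A>) u" if "u \<in> slit \<A>" for u
      unfolding F_def using that
      by (auto intro!: slit.tangent_zero slit.tangent_scaleR slit.tvec_of_in sl_in c simp: sl_dom)
    show "F b u = 0" if "u \<notin> slit \<A>" for u using that by (simp add: F_def)
    fix d assume d: "d \<in> \<A>"
    show "smooth_on (chart_image (sl d)) (\<lambda>z. F b (chart_inv (sl d) z) (sl d))"
    proof (rule smooth_on_local)
      fix z assume z: "z \<in> chart_image (sl d)"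
      let ?u = "chart_inv (sl d) z"
      note u = sl_inv_slit[OF d z]
      show "\<exists>T. open T \<and> z \<in> T \<and> smooth_on T (\<lambda>z. F b (chart_inv (sl d) z) (sl d))"
      proof (cases "fst ?u \<in> chart_dom c")
        case True
        let ?T = "chart_map (sl d) ` (chart_dom (sl d) \<inter> chart_dom (sl c))"
        let ?S = "chart_map (sl c) ` (chart_dom (sl c) \<inter> chart_dom (sl d))"
        let ?dc = "chart_map (sl c) \<circ> chart_inv (sl d)" and ?cd = "chart_map (sl d) \<circ> chart_inv (sl c)"
        have T: "open ?T" "smooth_on ?T ?dc"
          by (rule slit.open_overlap slit.smooth_trans; rule sl_in; fact)+
        have S: "open ?S" "smooth_on ?S ?cd"
          by (rule slit.open_overlap slit.smooth_trans; rule sl_in; fact)+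
        have "chart_map (sl d) ?u \<in> ?T" by (rule imageI) (use u True in \<open>simp add: sl_dom\<close>)
        then have "z \<in> ?T" by (simp only: u(5))
        \<comment> \<open>In the coordinates of \<open>sl d\<close> the constant vector b becomes
          the derivative of \<open>?cd\<close> along b, taken at the \<open>sl c\<close> coordinates
          of the same point.\<close>
        moreover have "smooth_on ?T (\<lambda>z. \<psi> (fst (?dc z)) *\<^sub>R dd b ?cd (?dc z))"
        proof (intro smooth_on_scaleR T(1))
          show "smooth_on ?T (\<lambda>z. \<psi> (fst (?dc z)))"
            by (rule smooth_on_compose[OF T(1) open_UNIV \<psi>(1)
                  smooth_on_linear[OF T(1) bounded_linear_fst T(2)]]) simp
          show "smooth_on ?T (\<lambda>z. dd b ?cd (?dc z))"
          proof (rule smooth_on_compose[OF T(1) S(1) smooth_on_dd[OF S(2)] T(2)])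
            show "?dc ` ?T \<subseteq> ?S" using slit.inv_map[OF sl_in[OF d]] by auto
          qed
        qed
        then have "smooth_on ?T (\<lambda>z. F b (chart_inv (sl d) z) (sl d))"
        proof (rule smooth_on_cong[OF T(1), rotated])
          fix z assume "z \<in> ?T"
          then obtain w where w: "w \<in> chart_dom (sl d)" "w \<in> chart_dom (sl c)" "z = chart_map (sl d) w"
            by auto
          have "chart_inv (sl d) z = w" using w slit.inv_map[OF sl_in[OF d]] by simp
          then show "\<psi> (fst (?dc z)) *\<^sub>R dd b ?cd (?dc z) = F b (chart_inv (sl d) z) (sl d)"
            using w sl_in[OF d] by (simp add: F_def sl_dom slit.tvec_of_apply slit.tD_def sl_map)
        qed
        ultimately show ?thesis using T(1) by blast
      next
        case False
        \<comment> \<open>A point over the complement of the domain of c has a neighbourhood lying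
          over the open set \<open>?N\<close>, and the field vanishes over all of
          \<open>?N\<close>.\<close>
        let ?K = "chart_inv c ` cball x0 r"
        let ?N = "chart_dom d - ?K"
        let ?T = "chart_map d ` ?N \<times> (- {0::'e})"
        have "openin M ?N" 
          by (intro openin_diff chart_homeo(1)[OF d] compact_chart_image_closed[OF c compact_cball r(2)])
        then have T: "open ?T"
          using open_image_chart[OF d] by (intro open_Times open_Compl) auto
        have "?K \<subseteq> chart_dom c"
          by (rule image_subsetI, rule inv_in_dom) (use r(2) in blast)
        then have "fst ?u \<in> ?N" using u(2) False by blast
        then have "fst z \<in> chart_map d ` ?N" unfolding u(3)[symmetric] by (rule imageI)
        then have "z \<in> ?T" using u(4) slit_snd_nonzero[OF u(1) d u(2)]
          by (simp add: mem_Times_iff)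
        moreover have "smooth_on ?T (\<lambda>z. F b (chart_inv (sl d) z) (sl d))"
        proof (rule smooth_on_cong[OF T _ smooth_on_const[OF T, of 0]])
          fix z assume z: "z \<in> ?T"
          then have fz: "fst z \<in> chart_map d ` ?N" "snd z \<in> - {0}"
            by (simp_all only: mem_Times_iff)
          then obtain q where q: "fst z = chart_map d q" "q \<in> chart_dom d" "q \<notin> ?K" by blast
          have "fst z \<in> chart_image d" unfolding chart_image_def q(1) by (rule imageI[OF q(2)])
          with fz(2) have zi: "z \<in> chart_image (sl d)"
            unfolding sl_image[OF d] by (simp add: mem_Times_iff)
          note w = sl_inv_slit[OF d zi]
          have wq: "fst (chart_inv (sl d) z) = q"
            using w(2,3) q inj_chart[OF d] by (metis inj_onD)
          have "\<psi> (chart_map c q) = 0" if "q \<in> chart_dom c"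
          proof (rule ccontr)
            assume "\<psi> (chart_map c q) \<noteq> 0"
            then have "chart_map c q \<in> cball x0 r" using \<psi>(2) ball_subset_cball by blast
            then have "chart_inv c (chart_map c q) \<in> ?K" by (rule imageI)
            then show False using q(3) inv_map[OF c that] by simp
          qed
          then show "0 = F b (chart_inv (sl d) z) (sl d)" by (simp add: F_def wq)
        qed
        ultimately show ?thesis using T by blast
      qed
    qed
  qed
  moreover have "F b u (sl c) = \<psi> (chart_map c (fst u)) *\<^sub>R b"
    if "u \<in> slit \<A>" "fst u \<in> chart_dom c" for b u
    using that by (simp add: F_def slit.tvec_of_same[OF sl_in[OF c]] sl_dom)
  moreover have "\<psi> x0 \<noteq> 0" using \<psi>(2) r(1) by simp
  ultimately show thesis using that by blast
qed

end

section \<open>The Finsler metric in charts\<close>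

lemma smooth_bilinear_family:
  fixes B :: "'z::euclidean_space \<Rightarrow> 'e::euclidean_space \<Rightarrow> 'e \<Rightarrow> real"
  assumes S: "open S" "z0 \<in> S"
    and lin: "\<And>z w. z \<in> S \<Longrightarrow> linear (\<lambda>v. B z v w)" "\<And>z v. z \<in> S \<Longrightarrow> linear (\<lambda>w. B z v w)"
    and B: "\<And>v w. smooth_on S (\<lambda>z. B z v w)" and Y: "smooth_on S Y" and Z: "smooth_on S Z"
  shows "smooth_on S (\<lambda>z. B z (Y z) (Z z))"
    and "dd h (\<lambda>z. B z (Y z) (Z z)) z0 =
      dd h (\<lambda>z. B z (Y z0) (Z z0)) z0 + B z0 (dd h Y z0) (Z z0) + B z0 (Y z0) (dd h Z z0)"
proof -
  have 1: "smooth_on S (\<lambda>z. B z v (Z z))" for v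
    by (rule smooth_on_linear_family[OF S(1) lin(2) B Z])
  show "smooth_on S (\<lambda>z. B z (Y z) (Z z))"
    by (rule smooth_on_linear_family[OF S(1) lin(1) 1 Y])
  have "dd h (\<lambda>z. B z (Y z) (Z z)) z0 =
      dd h (\<lambda>z. B z (Y z0) (Z z)) z0 + B z0 (dd h Y z0) (Z z0)"
    using dd_eq[OF has_derivative_linear_family[OF S lin(1) smooth_on_differentiable[OF 1 S(2)]
          smooth_on_differentiable[OF Y S(2)]]] by simp
  moreover have "dd h (\<lambda>z. B z (Y z0) (Z z)) z0 =
      dd h (\<lambda>z. B z (Y z0) (Z z0)) z0 + B z0 (Y z0) (dd h Z z0)"
    using dd_eq[OF has_derivative_linear_family[OF S lin(2) smooth_on_differentiable[OF B S(2)]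
          smooth_on_differentiable[OF Z S(2)]]] by simp
  ultimately show "dd h (\<lambda>z. B z (Y z) (Z z)) z0 =
      dd h (\<lambda>z. B z (Y z0) (Z z0)) z0 + B z0 (dd h Y z0) (Z z0) + B z0 (Y z0) (dd h Z z0)"
    by simp
qed

lemma smooth_trilinear_family:
  fixes B :: "'z::euclidean_space \<Rightarrow> 'e::euclidean_space \<Rightarrow> 'e \<Rightarrow> 'e \<Rightarrow> real"
  assumes S: "open S" "z0 \<in> S"
    and lin: "\<And>z v w. z \<in> S \<Longrightarrow> linear (\<lambda>u. B z u v w)" "\<And>z u w. z \<in> S \<Longrightarrow> linear (\<lambda>v. B z u v w)"
      "\<And>z u v. z \<in> S \<Longrightarrow> linear (\<lambda>w. B z u v w)"
    and B: "\<And>u v w. smooth_on S (\<lambda>z. B z u v w)"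
    and X: "smooth_on S X" and Y: "smooth_on S Y" and Z: "smooth_on S Z"
  shows "dd h (\<lambda>z. B z (X z) (Y z) (Z z)) z0 =
      dd h (\<lambda>z. B z (X z0) (Y z0) (Z z0)) z0 + B z0 (dd h X z0) (Y z0) (Z z0) +
      B z0 (X z0) (dd h Y z0) (Z z0) + B z0 (X z0) (Y z0) (dd h Z z0)"
proof -
  note bil = smooth_bilinear_family[OF S lin(2,3) B Y Z]
  have "dd h (\<lambda>z. B z (X z) (Y z) (Z z)) z0 =
      dd h (\<lambda>z. B z (X z0) (Y z) (Z z)) z0 + B z0 (dd h X z0) (Y z0) (Z z0)"
    using dd_eq[OF has_derivative_linear_family[OF S lin(1) smooth_on_differentiable[OF bil(1) S(2)]
          smooth_on_differentiable[OF X S(2)]]] by simp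
  then show ?thesis using bil(2)[of h "X z0"] by simp
qed

text \<open>Linearity in the outer direction is that of a derivative; linearity in the inner one is
  obtained by exchanging the two directions.\<close>

lemma linear_dd2:
  fixes f :: "'e::euclidean_space \<Rightarrow> real"
  assumes "open S" "smooth_on S f" "z \<in> S"
  shows "linear (\<lambda>a. dd a (dd b f) z)" "linear (\<lambda>b. dd a (dd b f) z)"
proof -
  show *: "linear (\<lambda>a. dd a (dd b f) z)" for b
    by (rule dd_linear[OF smooth_on_differentiable[OF smooth_on_dd[OF assms(2)] assms(3)]])
  show "linear (\<lambda>b. dd a (dd b f) z)"
    unfolding dd_commute[OF assms, of a] by (rule *)
qed

lemma dd3_commute:
  fixes f :: "'e::euclidean_space \<Rightarrow> real"
  assumes "open S" "smooth_on S f" "z \<in> S"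
  shows "dd a (dd b (dd c f)) z = dd a (dd c (dd b f)) z"
  by (rule dd_cong[OF assms(1,3)]) (rule dd_commute[OF assms(1,2)])

lemma linear_dd3:
  fixes f :: "'e::euclidean_space \<Rightarrow> real"
  assumes "open S" "smooth_on S f" "z \<in> S"
  shows "linear (\<lambda>a. dd a (dd b (dd c f)) z)" "linear (\<lambda>b. dd a (dd b (dd c f)) z)"
    "linear (\<lambda>c. dd a (dd b (dd c f)) z)"
proof -
  show *: "linear (\<lambda>a. dd a (dd b (dd c f)) z)" "linear (\<lambda>b. dd a (dd b (dd c f)) z)" for a b c
    by (rule linear_dd2[OF assms(1) smooth_on_dd[OF assms(2)] assms(3)])+
  show "linear (\<lambda>c. dd a (dd b (dd c f)) z)"
    unfolding dd3_commute[OF assms, of a b] by (rule *)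
qed

lemma linear_vertical: "linear f \<Longrightarrow> linear (\<lambda>v. f (0, v))"
  by (rule linear_compose[of "\<lambda>v. (0, v)", unfolded o_def])
     (auto intro!: linearI)

text \<open>Links the one-variable \<open>deriv\<close> in \<open>finsler_metric\<close> to
  directional derivatives in a chart. The set T excludes parameters at which the line meets the zero
  vector.\<close>

lemma deriv_line:
  fixes f :: "'z::euclidean_space \<Rightarrow> real"
  assumes "f differentiable (at z)" "open T" "0 \<in> T" "\<And>t. t \<in> T \<Longrightarrow> h t = f (z + t *\<^sub>R k)"
  shows "deriv h 0 = dd k f z"
proof -
  have "(h has_vector_derivative dd k f z) (at 0)"
    by (rule has_vector_derivative_transform_within_open[OF has_vector_derivative_line[OF assms(1)]
          assms(2,3)]) (simp add: assms(4))
  then show ?thesis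
    by (intro DERIV_imp_deriv) (simp add: has_real_derivative_iff_has_vector_derivative)
qed

context smooth_atlas
begin

text \<open>This is the chain rule through the unspecified chart of \<open>dir_deriv\<close>. As
  that chart may be any chart around p, differentiability is assumed in all of them.\<close>

lemma dir_deriv_eq:
  fixes f :: "'a \<Rightarrow> 'b::real_normed_vector"
  assumes c: "c \<in> B" "p \<in> chart_dom c" and a: "a \<in> tangent_space B p"
    and f: "\<And>d. d \<in> B \<Longrightarrow> p \<in> chart_dom d \<Longrightarrow> (f \<circ> chart_inv d) differentiable (at (chart_map d p))"
  shows "dir_deriv B p a f = dd (a c) (f \<circ> chart_inv c) (chart_map c p)"
proof -
  have "p \<in> carrier_of B" using c unfolding carrier_of_def by blast
  then obtain d where d: "d \<in> B" "p \<in> chart_dom d"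
    "\<And>a (f :: 'a \<Rightarrow> 'b). dir_deriv B p a f = dd (a d) (f \<circ> chart_inv d) (chart_map d p)"
    using dir_deriv_chart by blast
  let ?t = "chart_map d \<circ> chart_inv c"
  have "(?t has_derivative tD c d p) (at (chart_map c p))"
    using has_derivative_dd[OF differentiable_trans[OF c(1) d(1) c(2) d(2)]] unfolding tD_def[abs_def] .
  moreover have "((f \<circ> chart_inv d) has_derivative (\<lambda>h. dd h (f \<circ> chart_inv d) (chart_map d p)))
      (at (?t (chart_map c p)))"
    using has_derivative_dd[OF f[OF d(1,2)]] c by (simp add: inv_map)
  ultimately have "((\<lambda>x. (f \<circ> chart_inv d) (?t x)) has_derivative
      (\<lambda>h. dd (tD c d p h) (f \<circ> chart_inv d) (chart_map d p))) (at (chart_map c p))"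
    by (rule has_derivative_compose)
  then have "((f \<circ> chart_inv c) has_derivative
      (\<lambda>h. dd (tD c d p h) (f \<circ> chart_inv d) (chart_map d p))) (at (chart_map c p))"
  proof (rule has_derivative_transform_within_open[OF _ open_overlap[OF c(1) d(1)]])
    show "chart_map c p \<in> chart_map c ` (chart_dom c \<inter> chart_dom d)" using c d by blast
    fix x assume "x \<in> chart_map c ` (chart_dom c \<inter> chart_dom d)"
    then obtain q where "q \<in> chart_dom c" "q \<in> chart_dom d" "x = chart_map c q" by blast
    then show "(f \<circ> chart_inv d) (?t x) = (f \<circ> chart_inv c) x"
      using c(1) d(1) by (simp add: inv_map)
  qed
  from dd_eq[OF this, of "a c"] show ?thesis
    unfolding d(3) using tangent_tD[OF a c(1) d(1) c(2) d(2)] by simp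
qed

end

context smooth_mfd
begin

lemma sl_line:
  assumes u: "u \<in> slit \<A>" and c: "c \<in> \<A>" "fst u \<in> chart_dom c"
    and v: "v \<in> tangent_space \<A> (fst u)" and t: "snd u c + t *\<^sub>R v c \<noteq> 0"
  shows "(fst u, snd u + t *\<^sub>R v) \<in> slit \<A>"
    "chart_map (sl c) u + t *\<^sub>R (0, v c) = chart_map (sl c) (fst u, snd u + t *\<^sub>R v)"
    "chart_inv (sl c) (chart_map (sl c) u + t *\<^sub>R (0, v c)) = (fst u, snd u + t *\<^sub>R v)"
proof -
  show 1: "(fst u, snd u + t *\<^sub>R v) \<in> slit \<A>"
    by (rule slitI[OF c tangent_add[OF _ tangent_scaleR[OF v]]]) (use t slitD[OF u] in auto)
  show 2: "chart_map (sl c) u + t *\<^sub>R (0, v c) = chart_map (sl c) (fst u, snd u + t *\<^sub>R v)"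
    by (simp add: sl_map)
  show "chart_inv (sl c) (chart_map (sl c) u + t *\<^sub>R (0, v c)) = (fst u, snd u + t *\<^sub>R v)"
    unfolding 2 by (rule sl_inv_map[OF 1 c(1)]) (simp add: c(2))
qed

lemma open_line: "open {t::real. (y::'e) + t *\<^sub>R v \<noteq> 0}"
  by (rule open_Collect_neq) (intro continuous_intros)+

end

locale finsler = smooth_mfd M \<A> for M :: "'a topology" and \<A> :: "('a, 'e::euclidean_space) chart set" +
  fixes L :: "('a, 'e) tpoint \<Rightarrow> real"
  assumes finsler: "finsler_manifold M \<A> L"
begin

section \<open>Fibre derivatives of the energy\<close>

definition energy :: "('a, 'e) chart \<Rightarrow> 'e \<times> 'e \<Rightarrow> real" where
  "energy c z = (L (chart_inv (sl c) z))\<^sup>2 / 2"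

lemma smooth_energy: assumes c: "c \<in> \<A>" shows "smooth_on (chart_image (sl c)) (energy c)"
proof -
  have "smooth_fun (slit_atlas \<A>) L" using finsler unfolding finsler_manifold_def by blast
  then have "smooth_on (chart_image (sl c)) (\<lambda>z. L (chart_inv (sl c) z))"
    using sl_in[OF c] unfolding smooth_fun_def o_def by blast
  then have "smooth_on (chart_image (sl c))
      (\<lambda>z. (1 / 2) *\<^sub>R (L (chart_inv (sl c) z) *\<^sub>R L (chart_inv (sl c) z)))"
    by (intro smooth_on_linear[OF open_sl_image[OF c] bounded_linear_scaleR_right]
        smooth_on_scaleR open_sl_image c)
  then show ?thesis unfolding energy_def[abs_def] by (simp add: power2_eq_square)
qed

definition g2 :: "('a, 'e) chart \<Rightarrow> 'e \<times> 'e \<Rightarrow> 'e \<Rightarrow> 'e \<Rightarrow> real" where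
  "g2 c z v w = dd (0, v) (dd (0, w) (energy c)) z"

text \<open>The derivative of the metric components in the fibre direction u, which is twice the
  classical Cartan tensor.\<close>

definition g3 :: "('a, 'e) chart \<Rightarrow> 'e \<times> 'e \<Rightarrow> 'e \<Rightarrow> 'e \<Rightarrow> 'e \<Rightarrow> real" where
  "g3 c z u v w = dd (0, u) (dd (0, v) (dd (0, w) (energy c))) z"

text \<open>In the nested \<open>deriv\<close> the inner derivative is taken at the shifted point
  \<open>(fst u, snd u + s *\<^sub>R v)\<close>, so it is computed for every s that keeps this point
  in the slit bundle, and then differentiated at s = 0.\<close>

lemma finsler_metric_chart:
  assumes u: "u \<in> slit \<A>" and c: "c \<in> \<A>" "fst u \<in> chart_dom c"
    and v: "v \<in> tangent_space \<A> (fst u)" and w: "w \<in> tangent_space \<A> (fst u)"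
  shows "finsler_metric L u v w = g2 c (chart_map (sl c) u) (v c) (w c)"
  unfolding finsler_metric_def g2_def
proof (rule deriv_line[OF _ open_line[of "snd u c" "v c"]])
  have diff: "f differentiable (at (chart_map (sl c) u'))"
    if "smooth_on (chart_image (sl c)) f" "u' \<in> slit \<A>" "fst u' \<in> chart_dom c"
    for u' and f :: "'e \<times> 'e \<Rightarrow> real"
    by (rule smooth_on_differentiable[OF that(1) sl_map_image[OF that(2,3)]])
  show "dd (0, w c) (energy c) differentiable (at (chart_map (sl c) u))"
    by (rule diff[OF smooth_on_dd[OF smooth_energy[OF c(1)]] u c(2)])
  show "0 \<in> {t. snd u c + t *\<^sub>R v c \<noteq> 0}" using slit_snd_nonzero[OF u c] by simp
  fix s assume "s \<in> {t. snd u c + t *\<^sub>R v c \<noteq> 0}"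
  then have s: "snd u c + s *\<^sub>R v c \<noteq> 0" by simp
  let ?u = "(fst u, snd u + s *\<^sub>R v)"
  note us = sl_line[OF u c v s]
  have c': "fst ?u \<in> chart_dom c" and w': "w \<in> tangent_space \<A> (fst ?u)" using c(2) w by simp_all
  show "deriv (\<lambda>t. (L (fst u, snd u + s *\<^sub>R v + t *\<^sub>R w))\<^sup>2 / 2) 0 =
      dd (0, w c) (energy c) (chart_map (sl c) u + s *\<^sub>R (0, v c))"
    unfolding us(2)
  proof (rule deriv_line[OF diff[OF smooth_energy[OF c(1)] us(1) c'] open_line[of "snd ?u c" "w c"]])
    show "0 \<in> {t. snd ?u c + t *\<^sub>R w c \<noteq> 0}" using s by simp
    fix t assume "t \<in> {t. snd ?u c + t *\<^sub>R w c \<noteq> 0}"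
    then have t: "snd ?u c + t *\<^sub>R w c \<noteq> 0" by simp
    show "(L (fst u, snd u + s *\<^sub>R v + t *\<^sub>R w))\<^sup>2 / 2 =
        energy c (chart_map (sl c) ?u + t *\<^sub>R (0, w c))"
      unfolding energy_def sl_line(3)[OF us(1) c(1) c' w' t] by simp
  qed
qed

lemma g2_linear:
  assumes "c \<in> \<A>" "z \<in> chart_image (sl c)"
  shows "linear (\<lambda>v. g2 c z v w)" "linear (\<lambda>w. g2 c z v w)"
  unfolding g2_def
  by (rule linear_vertical[OF linear_dd2(1)[OF open_sl_image smooth_energy]]
      linear_vertical[OF linear_dd2(2)[OF open_sl_image smooth_energy]]; fact)+

lemma g2_sym: "c \<in> \<A> \<Longrightarrow> z \<in> chart_image (sl c) \<Longrightarrow> g2 c z v w = g2 c z w v"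
  unfolding g2_def by (rule dd_commute[OF open_sl_image smooth_energy])

lemma smooth_g2: "c \<in> \<A> \<Longrightarrow> smooth_on (chart_image (sl c)) (\<lambda>z. g2 c z v w)"
  unfolding g2_def by (intro smooth_on_dd smooth_energy)

lemma g3_linear:
  assumes "c \<in> \<A>" "z \<in> chart_image (sl c)"
  shows "linear (\<lambda>u. g3 c z u v w)" "linear (\<lambda>v. g3 c z u v w)" "linear (\<lambda>w. g3 c z u v w)"
  unfolding g3_def
  by (rule linear_vertical[OF linear_dd3(1)[OF open_sl_image smooth_energy]]
      linear_vertical[OF linear_dd3(2)[OF open_sl_image smooth_energy]]
      linear_vertical[OF linear_dd3(3)[OF open_sl_image smooth_energy]]; fact)+

lemma g3_sym:
  assumes "c \<in> \<A>" "z \<in> chart_image (sl c)"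
  shows "g3 c z u v w = g3 c z v u w" "g3 c z u v w = g3 c z u w v"
  unfolding g3_def
  by (rule dd_commute[OF open_sl_image smooth_on_dd[OF smooth_energy]]
      dd3_commute[OF open_sl_image smooth_energy]; fact)+

lemma smooth_g3: "c \<in> \<A> \<Longrightarrow> smooth_on (chart_image (sl c)) (\<lambda>z. g3 c z u v w)"
  unfolding g3_def by (intro smooth_on_dd smooth_energy)

lemma dd_g3_sym:
  assumes "c \<in> \<A>" "z \<in> chart_image (sl c)"
  shows "dd (0, t) (\<lambda>z. g3 c z u v w) z = dd (0, u) (\<lambda>z. g3 c z t v w) z"
  unfolding g3_def[abs_def]
  by (rule dd_commute[OF open_sl_image smooth_on_dd[OF smooth_on_dd[OF smooth_energy]]]; fact)

lemma dd_g2: "dd (0, u) (\<lambda>z. g2 c z v w) z = g3 c z u v w"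
  unfolding g3_def g2_def[abs_def] ..

section \<open>Homogeneity along the fibres\<close>

lemma scaled_in_image:
  assumes "c \<in> \<A>" "z \<in> chart_image (sl c)" "r > 0"
  shows "(fst z, r *\<^sub>R snd z) \<in> chart_image (sl c)"
  using assms(2,3) unfolding sl_image[OF assms(1)] by (simp add: mem_Times_iff)

text \<open>Differentiating the scaling identity in a fibre direction produces a factor r on the
  left. Each fibre derivative thus lowers the degree by one; the energy has factor
  \<open>r\<^sup>2\<close>, its first derivative r and the metric 1.\<close>

lemma homogeneous_dd:
  fixes f :: "'e \<times> 'e \<Rightarrow> real"
  assumes c: "c \<in> \<A>" and f: "smooth_on (chart_image (sl c)) f" and r: "r > 0"
    and hom: "\<And>z. z \<in> chart_image (sl c) \<Longrightarrow> f (fst z, r *\<^sub>R snd z) = k * f z"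
    and z: "z \<in> chart_image (sl c)"
  shows "dd (0, a) f (fst z, r *\<^sub>R snd z) = k / r * dd (0, a) f z"
proof -
  have bl: "bounded_linear (\<lambda>z::'e \<times> 'e. (fst z, r *\<^sub>R snd z))"
    by (intro bounded_linear_Pair bounded_linear_fst bounded_linear_const_scaleR bounded_linear_snd)
  note df = smooth_on_differentiable[OF f scaled_in_image[OF c z r]]
  have "((\<lambda>z. f (fst z, r *\<^sub>R snd z)) has_derivative
      (\<lambda>h. dd (fst h, r *\<^sub>R snd h) f (fst z, r *\<^sub>R snd z))) (at z)"
    by (rule has_derivative_compose[OF bounded_linear_imp_has_derivative[OF bl] has_derivative_dd[OF df]])
  then have 1: "dd (0, a) (\<lambda>z. f (fst z, r *\<^sub>R snd z)) z = dd (0, r *\<^sub>R a) f (fst z, r *\<^sub>R snd z)"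
    by (simp add: dd_eq)
  have "dd (0, a) (\<lambda>z. f (fst z, r *\<^sub>R snd z)) z = dd (0, a) (\<lambda>z. k * f z) z"
    by (rule dd_cong[OF open_sl_image[OF c] z hom])
  also have "\<dots> = k * dd (0, a) f z"
    by (rule dd_eq, rule has_derivative_mult_right)
       (rule has_derivative_dd[OF smooth_on_differentiable[OF f z]])
  finally have "dd (r *\<^sub>R (0, a)) f (fst z, r *\<^sub>R snd z) = k * dd (0, a) f z" using 1 by simp
  then show ?thesis unfolding linear_scale[OF dd_linear[OF df]] using r by (simp add: field_simps)
qed

lemma energy_homogeneous:
  assumes c: "c \<in> \<A>" and z: "z \<in> chart_image (sl c)" and r: "r > 0"
  shows "energy c (fst z, r *\<^sub>R snd z) = r\<^sup>2 * energy c z"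
proof -
  let ?u = "chart_inv (sl c) z"
  note u = sl_inv_slit[OF c z]
  have t: "snd ?u \<in> tangent_space \<A> (fst ?u)" using slitD[OF u(1)] by blast
  have "(fst ?u, r *\<^sub>R snd ?u) \<in> slit \<A>"
    by (rule slitI[OF c u(2) tangent_scaleR[OF t]]) (use r slit_snd_nonzero[OF u(1) c u(2)] in auto)
  moreover have "chart_map (sl c) (fst ?u, r *\<^sub>R snd ?u) = (fst z, r *\<^sub>R snd z)"
    by (simp add: sl_map u)
  ultimately have inv: "chart_inv (sl c) (fst z, r *\<^sub>R snd z) = (fst ?u, r *\<^sub>R snd ?u)"
    using sl_inv_map[OF _ c] u(2) by (metis fst_conv)
  have "?u \<in> tangent_bundle \<A>" using u(1) by (simp add: slit_def)
  then have "L (fst ?u, r *\<^sub>R snd ?u) = r * L (fst ?u, snd ?u)"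
    using finsler r unfolding finsler_manifold_def by (metis (mono_tags, lifting) case_prodD prod.collapse)
  then show ?thesis unfolding energy_def inv by (simp add: power_mult_distrib)
qed

lemma g2_homogeneous:
  assumes c: "c \<in> \<A>" and z: "z \<in> chart_image (sl c)" and r: "r > 0"
  shows "g2 c (fst z, r *\<^sub>R snd z) v w = g2 c z v w"
proof -
  have "dd (0, w) (energy c) (fst z, r *\<^sub>R snd z) = r\<^sup>2 / r * dd (0, w) (energy c) z"
    if "z \<in> chart_image (sl c)" for z
    by (rule homogeneous_dd[OF c smooth_energy[OF c] r _ that]) (rule energy_homogeneous[OF c _ r])
  then have 1: "dd (0, w) (energy c) (fst z, r *\<^sub>R snd z) = r * dd (0, w) (energy c) z"
    if "z \<in> chart_image (sl c)" for z
    using that r by (simp add: power2_eq_square)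
  have "g2 c (fst z, r *\<^sub>R snd z) v w = r / r * g2 c z v w" unfolding g2_def
    by (rule homogeneous_dd[OF c smooth_on_dd[OF smooth_energy[OF c]] r _ z]) (rule 1)
  then show ?thesis using r by simp
qed

text \<open>Euler's relation in degree 0: the metric components are constant along the ray through
  z, whose direction is the fibre coordinate of z. The line parameter runs over t > -1 to keep the
  scaling factor 1 + t positive.\<close>

lemma g3_snd:
  assumes c: "c \<in> \<A>" and z: "z \<in> chart_image (sl c)"
  shows "g3 c z (snd z) v w = 0"
  unfolding dd_g2[symmetric]
proof (rule dd_line_eq[OF smooth_on_differentiable[OF smooth_g2[OF c] z]])
  have "((\<lambda>t::real. g2 c z v w) has_vector_derivative 0) (at 0)" by simp
  then show "((\<lambda>t. g2 c (z + t *\<^sub>R (0, snd z)) v w) has_vector_derivative 0) (at 0)"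
  proof (rule has_vector_derivative_transform_within_open[where S="{-1<..}"])
    fix t :: real assume "t \<in> {-1<..}"
    then have t: "1 + t > 0" by simp
    have "z + t *\<^sub>R (0, snd z) = (fst z, (1 + t) *\<^sub>R snd z)"
      by (simp add: prod_eq_iff scaleR_add_left)
    then show "g2 c z v w = g2 c (z + t *\<^sub>R (0, snd z)) v w"
      using g2_homogeneous[OF c z t] by simp
  qed auto
qed

abbreviation "g \<equiv> finsler_metric L"

lemma g_linear:
  assumes u: "u \<in> slit \<A>"
    and v: "v \<in> tangent_space \<A> (fst u)" "v' \<in> tangent_space \<A> (fst u)" "w \<in> tangent_space \<A> (fst u)"
  shows "g u (v + v') w = g u v w + g u v' w" "g u (v - v') w = g u v w - g u v' w"
    "g u w (v + v') = g u w v + g u w v'" "g u w (v - v') = g u w v - g u w v'"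
proof -
  obtain c where c: "c \<in> \<A>" "fst u \<in> chart_dom c" using slit_chart_ex[OF u] .
  note lin = g2_linear[OF c(1) sl_map_image[OF u c(2)]]
  note simps = finsler_metric_chart[OF u c] v tangent_add tangent_diff
  show "g u (v + v') w = g u v w + g u v' w" using linear_add[OF lin(1)] by (simp add: simps)
  show "g u w (v + v') = g u w v + g u w v'" using linear_add[OF lin(2)] by (simp add: simps)
  show "g u (v - v') w = g u v w - g u v' w"
    using linear_diff[OF lin(1)] by (simp add: simps minus_apply)
  show "g u w (v - v') = g u w v - g u w v'"
    using linear_diff[OF lin(2)] by (simp add: simps minus_apply)
qed

lemma g_sym:
  assumes u: "u \<in> slit \<A>" and v: "v \<in> tangent_space \<A> (fst u)" "w \<in> tangent_space \<A> (fst u)"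
  shows "g u v w = g u w v"
proof -
  obtain c where c: "c \<in> \<A>" "fst u \<in> chart_dom c" using slit_chart_ex[OF u] .
  show ?thesis unfolding finsler_metric_chart[OF u c v] finsler_metric_chart[OF u c v(2,1)]
    by (rule g2_sym[OF c(1) sl_map_image[OF u c(2)]])
qed

text \<open>V itself serves as the test field, by positive definiteness.\<close>

lemma pi_field_nondegenerate:
  assumes V: "V \<in> pi_fields \<A>" and z: "\<And>u W. u \<in> slit \<A> \<Longrightarrow> W \<in> pi_fields \<A> \<Longrightarrow> g u (V u) (W u) = 0"
  shows "V = 0"
proof
  fix u
  show "V u = 0 u"
  proof (cases "u \<in> slit \<A>")
    case True
    have "g u (V u) (V u) = 0" by (rule z[OF True V])
    then have "V u = 0"
      using finsler True pi_fieldD(1)[OF V True] unfolding finsler_manifold_def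
      by (metis less_irrefl)
    then show ?thesis by simp
  qed (simp add: pi_fieldD(2)[OF V])
qed

lemma pcomp_at:
  "u \<in> slit \<A> \<Longrightarrow> c \<in> \<A> \<Longrightarrow> fst u \<in> chart_dom c \<Longrightarrow> pcomp c X (chart_map (sl c) u) = X u c"
  by (simp add: pcomp_def sl_inv_map)

lemma g_chart:
  assumes c: "c \<in> \<A>" and z: "z \<in> chart_image (sl c)" and YZ: "Y \<in> pi_fields \<A>" "Z \<in> pi_fields \<A>"
  shows "g (chart_inv (sl c) z) (Y (chart_inv (sl c) z)) (Z (chart_inv (sl c) z)) =
    g2 c z (pcomp c Y z) (pcomp c Z z)"
  using finsler_metric_chart[OF sl_inv_slit(1)[OF c z] c sl_inv_slit(2)[OF c z]
      pi_fieldD(1)[OF YZ(1) sl_inv_slit(1)[OF c z]] pi_fieldD(1)[OF YZ(2) sl_inv_slit(1)[OF c z]]]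
  by (simp add: sl_inv_slit(5)[OF c z] pcomp_def)

text \<open>In the product rule the term with the components of Y and Z frozen differentiates the
  metric itself and so yields \<open>g3\<close>.\<close>

lemma g_fields_chart:
  assumes c: "c \<in> \<A>" and z: "z \<in> chart_image (sl c)" and YZ: "Y \<in> pi_fields \<A>" "Z \<in> pi_fields \<A>"
  shows "((\<lambda>u. g u (Y u) (Z u)) \<circ> chart_inv (sl c)) differentiable (at z)"
    "dd (0, x) ((\<lambda>u. g u (Y u) (Z u)) \<circ> chart_inv (sl c)) z =
      g3 c z x (pcomp c Y z) (pcomp c Z z) + g2 c z (dd (0, x) (pcomp c Y) z) (pcomp c Z z) +
      g2 c z (pcomp c Y z) (dd (0, x) (pcomp c Z) z)"
proof -
  note fam = smooth_bilinear_family[OF open_sl_image[OF c] z g2_linear[OF c] smooth_g2[OF c]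
      pi_fieldD(3)[OF YZ(1) c] pi_fieldD(3)[OF YZ(2) c]]
  have eq: "g2 c z (pcomp c Y z) (pcomp c Z z) = ((\<lambda>u. g u (Y u) (Z u)) \<circ> chart_inv (sl c)) z"
    if "z \<in> chart_image (sl c)" for z
    using g_chart[OF c that YZ] by simp
  show "((\<lambda>u. g u (Y u) (Z u)) \<circ> chart_inv (sl c)) differentiable (at z)"
    by (rule differentiable_cong_open[OF open_sl_image[OF c] z eq smooth_on_differentiable[OF fam(1) z]])
  have "dd (0, x) ((\<lambda>u. g u (Y u) (Z u)) \<circ> chart_inv (sl c)) z =
      dd (0, x) (\<lambda>z. g2 c z (pcomp c Y z) (pcomp c Z z)) z"
    by (rule dd_cong[OF open_sl_image[OF c] z]) (rule eq[symmetric])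
  then show "dd (0, x) ((\<lambda>u. g u (Y u) (Z u)) \<circ> chart_inv (sl c)) z =
      g3 c z x (pcomp c Y z) (pcomp c Z z) + g2 c z (dd (0, x) (pcomp c Y) z) (pcomp c Z z) +
      g2 c z (pcomp c Y z) (dd (0, x) (pcomp c Z) z)"
    using fam(2)[of "(0, x)"] dd_g2 by simp
qed

end

section \<open>The Cartan connection\<close>

locale cartan = finsler M \<A> L
  for M :: "'a topology" and \<A> :: "('a, 'e::euclidean_space) chart set" and L :: "('a, 'e) tpoint \<Rightarrow> real" +
  fixes D :: "('a, 'e) pi_connection"
  assumes cartan: "cartan_connection \<A> L D"
begin

section \<open>The connection and its horizontal lift\<close>

lemma linear_connection: "linear_connection \<A> D"
  using cartan unfolding cartan_connection_def regular_connection_def by blast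

lemma D_in:
  "u \<in> slit \<A> \<Longrightarrow> a \<in> tangent_space (slit_atlas \<A>) u \<Longrightarrow> X \<in> pi_fields \<A> \<Longrightarrow>
    D u a X \<in> tangent_space \<A> (fst u)"
  using linear_connection unfolding linear_connection_def by blast

lemma D_add:
  "u \<in> slit \<A> \<Longrightarrow> a \<in> tangent_space (slit_atlas \<A>) u \<Longrightarrow> b \<in> tangent_space (slit_atlas \<A>) u \<Longrightarrow>
    X \<in> pi_fields \<A> \<Longrightarrow> D u (a + b) X = D u a X + D u b X"
  using linear_connection unfolding linear_connection_def by blast

lemma D_scaleR:
  "u \<in> slit \<A> \<Longrightarrow> a \<in> tangent_space (slit_atlas \<A>) u \<Longrightarrow> X \<in> pi_fields \<A> \<Longrightarrow>
    D u (r *\<^sub>R a) X = r *\<^sub>R D u a X"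
  using linear_connection unfolding linear_connection_def by blast

lemma D_field_zero:
  assumes "u \<in> slit \<A>" "a \<in> tangent_space (slit_atlas \<A>) u"
  shows "D u a 0 = 0"
proof -
  have "D u a (0 + 0) = D u a 0 + D u a 0"
    using linear_connection assms pi_field_zero unfolding linear_connection_def by blast
  then show ?thesis by simp
qed

lemma D_sum:
  assumes u: "u \<in> slit \<A>" and X: "X \<in> pi_fields \<A>"
    and a: "\<And>i. i \<in> I \<Longrightarrow> a i \<in> tangent_space (slit_atlas \<A>) u"
  shows "D u (\<Sum>i\<in>I. r i *\<^sub>R a i) X = (\<Sum>i\<in>I. r i *\<^sub>R D u (a i) X)"
proof -
  have 0: "D u 0 X = 0" using D_scaleR[OF u slit.tangent_zero X, of 0] by simp
  show ?thesis using a
  proof (induction I rule: infinite_finite_induct)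
    case (insert x I)
    have "D u (r x *\<^sub>R a x + (\<Sum>i\<in>I. r i *\<^sub>R a i)) X =
        D u (r x *\<^sub>R a x) X + D u (\<Sum>i\<in>I. r i *\<^sub>R a i) X"
      using insert.prems by (intro D_add u X slit.tangent_sum slit.tangent_scaleR) auto
    moreover have "D u (r x *\<^sub>R a x) X = r x *\<^sub>R D u (a x) X"
      using insert.prems by (intro D_scaleR u X) auto
    moreover have "D u (\<Sum>i\<in>I. r i *\<^sub>R a i) X = (\<Sum>i\<in>I. r i *\<^sub>R D u (a i) X)"
      using insert.prems by (intro insert.IH) auto
    ultimately show ?case by (simp only: sum.insert[OF insert.hyps])
  qed (simp_all add: 0)
qed

lemma cov_in:
  "V \<in> vector_fields (slit_atlas \<A>) \<Longrightarrow> X \<in> pi_fields \<A> \<Longrightarrow> cov \<A> D V X \<in> pi_fields \<A>"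
  using linear_connection unfolding linear_connection_def by blast

lemma cov_apply: "u \<in> slit \<A> \<Longrightarrow> cov \<A> D V X u = D u (V u) X"
  by (simp add: cov_def on_slit_def)

text \<open>Any tangent vector with the base components of w has a horizontal part with the same
  image under \<rho>, because its vertical part is in the kernel. Hence \<rho> maps the horizontal
  space onto the tangent space of the base, and the choice made by \<open>inv_into\<close> is
  meaningful.\<close>

lemma bet_props:
  assumes u: "u \<in> slit \<A>" and w: "w \<in> tangent_space \<A> (fst u)"
  shows "bet \<A> D u w \<in> horizontal_space \<A> D u" "rho \<A> u (bet \<A> D u w) = w"
proof -
  obtain c where c: "c \<in> \<A>" "fst u \<in> chart_dom c" using slit_chart_ex[OF u] .
  let ?a = "slit.tvec_of (sl c) u (w c, 0)"
  have uc: "u \<in> chart_dom (sl c)" using u c by (simp add: sl_dom)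
  have a: "?a \<in> tangent_space (slit_atlas \<A>) u" by (rule slit.tvec_of_in[OF sl_in[OF c(1)] uc])
  have "tangent_space (slit_atlas \<A>) u =
      {a + b |a b. a \<in> vertical_space \<A> u \<and> b \<in> horizontal_space \<A> D u}"
    using cartan u unfolding cartan_connection_def regular_connection_def by blast
  with a obtain v b where vb: "?a = v + b" "v \<in> vertical_space \<A> u" "b \<in> horizontal_space \<A> D u"
    by auto
  have v: "v \<in> tangent_space (slit_atlas \<A>) u" "rho \<A> u v = 0"
    using vb(2) unfolding vertical_space_def by auto
  have b: "b \<in> tangent_space (slit_atlas \<A>) u" using vb(3) unfolding horizontal_space_def by auto
  have "fst (v (sl c)) = 0" using rho_apply[OF u v(1) c] v(2) by simp
  moreover have "?a (sl c) = (w c, 0)" by (rule slit.tvec_of_same[OF sl_in[OF c(1)] uc])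
  ultimately have "fst (b (sl c)) = w c" using vb(1) by (metis add_0 fst_add fst_conv plus_fun_apply)
  then have "rho \<A> u b = w"
    by (intro tangent_eqI[OF rho_in[OF u] w c]) (simp add: rho_apply[OF u b c])
  then have im: "w \<in> rho \<A> u ` horizontal_space \<A> D u" using vb(3) by blast
  show "bet \<A> D u w \<in> horizontal_space \<A> D u" unfolding bet_def by (rule inv_into_into[OF im])
  show "rho \<A> u (bet \<A> D u w) = w" unfolding bet_def by (rule f_inv_into_f[OF im])
qed

lemma bet_tangent:
  assumes u: "u \<in> slit \<A>" and w: "w \<in> tangent_space \<A> (fst u)"
  shows "bet \<A> D u w \<in> tangent_space (slit_atlas \<A>) u" "D u (bet \<A> D u w) (eta \<A>) = 0"
  using bet_props(1)[OF assms] unfolding horizontal_space_def by auto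

lemma bet_field_apply: "u \<in> slit \<A> \<Longrightarrow> bet_field \<A> D Y u = bet \<A> D u (Y u)"
  by (simp add: bet_field_def on_slit_def)

lemma gam_field_apply: "u \<in> slit \<A> \<Longrightarrow> gam_field \<A> Y u = gam \<A> u (Y u)"
  by (simp add: gam_field_def on_slit_def)

lemma horizontal_gam_zero:
  assumes u: "u \<in> slit \<A>" and v: "v \<in> tangent_space \<A> (fst u)" and D: "D u (gam \<A> u v) (eta \<A>) = 0"
  shows "gam \<A> u v = 0"
proof -
  have "vertical_space \<A> u \<inter> horizontal_space \<A> D u = {0}"
    using cartan u unfolding cartan_connection_def regular_connection_def by blast
  moreover have "gam \<A> u v \<in> vertical_space \<A> u \<inter> horizontal_space \<A> D u"
    unfolding vertical_space_def horizontal_space_def using gam_in[OF u v] rho_gam[OF u v] D by simp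
  ultimately show ?thesis by blast
qed

text \<open>In a chart, the components of \<open>\<beta> Y\<close> solve \<open>K (\<beta> Y) = 0\<close>, a linear system whose coefficients are
  smooth because \<open>K\<close> maps the global fields to \<open>\<pi>\<close>-vector fields.\<close>

lemma bet_field_differentiable:
  assumes Y: "Y \<in> pi_fields \<A>" and c: "c \<in> \<A>" and z0: "z0 \<in> chart_image (sl c)"
  shows "(\<lambda>z. bet_field \<A> D Y (chart_inv (sl c) z) (sl c)) differentiable (at z0)"
proof -
  let ?S = "chart_image (sl c)" and ?a = "\<lambda>z. bet_field \<A> D Y (chart_inv (sl c) z) (sl c)"
  have S: "open ?S" by (rule open_sl_image[OF c])
  have "fst z0 \<in> chart_image c" using z0 unfolding sl_image[OF c] by (simp add: mem_Times_iff)
  then obtain \<psi> :: "'e \<Rightarrow> real" and F :: "'e \<times> 'e \<Rightarrow> ('a, 'e) slit_field" where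
    \<psi>: "\<psi> (fst z0) \<noteq> 0" and F: "\<And>b. F b \<in> vector_fields (slit_atlas \<A>)"
    "\<And>b u. u \<in> slit \<A> \<Longrightarrow> fst u \<in> chart_dom c \<Longrightarrow> F b u (sl c) = \<psi> (chart_map c (fst u)) *\<^sub>R b"
    using exists_global_frame[OF c] by metis
  define k where "k b = pcomp c (cov \<A> D (F b) (eta \<A>))" for b
  have k: "smooth_on ?S (k b)" for b
    unfolding k_def by (rule pi_fieldD(3)[OF cov_in[OF F(1) eta_in] c])
  have dk: "k b differentiable (at z0)" for b by (rule smooth_on_differentiable[OF k z0])
  \<comment> \<open>Multiplying a by \<psi>, rather than dividing the fields by it, keeps the
    identity valid on the whole chart image, also where \<psi> is 0.\<close>
  have key: "\<psi> (fst z) *\<^sub>R D u a (eta \<A>) c = (\<Sum>b\<in>Basis. (a (sl c) \<bullet> b) *\<^sub>R k b z)"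
    if z: "z \<in> ?S" "u = chart_inv (sl c) z" and a: "a \<in> tangent_space (slit_atlas \<A>) u" for z u a
  proof -
    note u = sl_inv_slit[OF c z(1), folded z(2)]
    have Fu: "F b u \<in> tangent_space (slit_atlas \<A>) u" for b by (rule vector_fieldD[OF F(1) u(1)])
    have "\<psi> (fst z) *\<^sub>R a = (\<Sum>b\<in>Basis. (a (sl c) \<bullet> b) *\<^sub>R F b u)"
    proof (rule slit.tangent_eqI[OF slit.tangent_scaleR[OF a] _ sl_in[OF c]])
      show "(\<Sum>b\<in>Basis. (a (sl c) \<bullet> b) *\<^sub>R F b u) \<in> tangent_space (slit_atlas \<A>) u"
        by (intro slit.tangent_sum slit.tangent_scaleR Fu)
      show "u \<in> chart_dom (sl c)" using u by (simp add: sl_dom)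
      have "(\<Sum>b\<in>Basis. (a (sl c) \<bullet> b) *\<^sub>R F b u) (sl c) =
          (\<Sum>b\<in>Basis. \<psi> (fst z) *\<^sub>R ((a (sl c) \<bullet> b) *\<^sub>R b))"
        unfolding fun_sum_apply scaleR_fun_apply F(2)[OF u(1,2)] u(3)
        by (intro sum.cong) (simp_all add: mult.commute)
      also have "\<dots> = \<psi> (fst z) *\<^sub>R a (sl c)"
        by (simp only: scaleR_sum_right[symmetric] euclidean_representation)
      finally show "(\<psi> (fst z) *\<^sub>R a) (sl c) = (\<Sum>b\<in>Basis. (a (sl c) \<bullet> b) *\<^sub>R F b u) (sl c)"
        by simp
    qed
    then have "D u (\<psi> (fst z) *\<^sub>R a) (eta \<A>) = D u (\<Sum>b\<in>Basis. (a (sl c) \<bullet> b) *\<^sub>R F b u) (eta \<A>)"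
      by (rule arg_cong)
    then have "\<psi> (fst z) *\<^sub>R D u a (eta \<A>) = (\<Sum>b\<in>Basis. (a (sl c) \<bullet> b) *\<^sub>R D u (F b u) (eta \<A>))"
      unfolding D_scaleR[OF u(1) a eta_in] D_sum[OF u(1) eta_in Fu] .
    then have "(\<psi> (fst z) *\<^sub>R D u a (eta \<A>)) c =
        (\<Sum>b\<in>Basis. (a (sl c) \<bullet> b) *\<^sub>R D u (F b u) (eta \<A>)) c" by (rule fun_cong)
    then show ?thesis
      using z(2) u(1) by (simp add: fun_sum_apply k_def pcomp_def cov_apply)
  qed
  \<comment> \<open>For a tangent vector with the base components of Y and fibre components v,
    \<psi> times the component of K is \<open>r z + N z v\<close>. Only v is unknown for \<beta>Y,
    since its base components are those of Y.\<close>
  define N where "N z v = (\<Sum>b\<in>Basis. (v \<bullet> b) *\<^sub>R k (0, b) z)" for z and v :: 'e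
  define r where "r z = (\<Sum>b\<in>Basis. (pcomp c Y z \<bullet> b) *\<^sub>R k (b, 0) z)" for z
  have fst_a: "fst (?a z) = pcomp c Y z" if z: "z \<in> ?S" for z
  proof -
    note u = sl_inv_slit[OF c z]
    have Yu: "Y (chart_inv (sl c) z) \<in> tangent_space \<A> (fst (chart_inv (sl c) z))"
      by (rule pi_fieldD(1)[OF Y u(1)])
    show ?thesis using rho_apply[OF u(1) bet_tangent(1)[OF u(1) Yu] c u(2)] bet_props(2)[OF u(1) Yu]
      by (simp add: bet_field_apply[OF u(1)] pcomp_def)
  qed
  have "(\<lambda>z. snd (?a z)) differentiable (at z0)"
  proof (rule differentiable_linear_solution[OF S z0, where M=N and r="\<lambda>z. - r z"])
    show "linear (N z)" for z
      unfolding N_def by (rule linearI)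
        (simp_all add: inner_add_left scaleR_add_left sum.distrib scaleR_sum_right)
    show "(\<lambda>z. N z b) differentiable (at z0)" for b
      unfolding N_def by (intro differentiable_sum differentiable_scaleR differentiable_const dk ballI) simp
    show "(\<lambda>z. - r z) differentiable (at z0)"
      unfolding r_def
      by (intro differentiable_minus differentiable_sum differentiable_scaleR dk ballI
          differentiable_bounded_linear[OF bounded_linear_inner_left]
          smooth_on_differentiable[OF pi_fieldD(3)[OF Y c] z0]) simp
    show "N z (snd (?a z)) = - r z" if z: "z \<in> ?S" for z
    proof -
      note u = sl_inv_slit[OF c z]
      have Yu: "Y (chart_inv (sl c) z) \<in> tangent_space \<A> (fst (chart_inv (sl c) z))"
        by (rule pi_fieldD(1)[OF Y u(1)])
      have "(\<Sum>b\<in>Basis. (?a z \<bullet> b) *\<^sub>R k b z) = 0"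
        using key[OF z refl bet_tangent(1)[OF u(1) Yu]] bet_tangent(2)[OF u(1) Yu]
        by (simp add: bet_field_apply[OF u(1)])
      then have "r z + N z (snd (?a z)) = 0"
        unfolding sum_Basis_prod r_def N_def fst_a[OF z, symmetric] by (simp add: inner_prod_def)
      then show ?thesis unfolding eq_neg_iff_add_eq_0 by (simp only: add.commute)
    qed
    \<comment> \<open>A vector in the kernel of \<open>N z0\<close> gives a vertical vector with K =
      0, because \<psi> is nonzero at \<open>fst z0\<close>; regularity then makes it 0.\<close>
    fix v assume v: "N z0 v = 0"
    let ?u = "chart_inv (sl c) z0"
    note u = sl_inv_slit[OF c z0]
    let ?v = "tvec_of c (fst ?u) v"
    have vt: "?v \<in> tangent_space \<A> (fst ?u)" by (rule tvec_of_in[OF c u(2)])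
    have g: "gam \<A> ?u ?v (sl c) = (0, v)"
      using gam_apply[OF u(1) c u(2)] by (simp add: tvec_of_same[OF c u(2)])
    have "(\<Sum>b\<in>Basis. ((0, v) \<bullet> b) *\<^sub>R k b z0) = 0"
      unfolding sum_Basis_prod using v by (simp add: N_def inner_prod_def)
    then have "D ?u (gam \<A> ?u ?v) (eta \<A>) c = 0"
      using key[OF z0 refl gam_in[OF u(1) vt]] g \<psi> by simp
    then have "D ?u (gam \<A> ?u ?v) (eta \<A>) = 0"
      by (intro tangent_eqI[OF D_in[OF u(1) gam_in[OF u(1) vt] eta_in] tangent_zero c u(2)]) simp
    then have "gam \<A> ?u ?v = 0" by (rule horizontal_gam_zero[OF u(1) vt])
    then show "v = 0" using g by (simp add: zero_prod_def)
  qed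
  then have "(\<lambda>z. (0::'e, snd (?a z))) differentiable (at z0)"
    by (rule differentiable_bounded_linear[rotated])
       (intro bounded_linear_Pair bounded_linear_zero bounded_linear_ident)
  moreover have "(\<lambda>z. (pcomp c Y z, 0::'e)) differentiable (at z0)"
    by (rule differentiable_bounded_linear[OF _ smooth_on_differentiable[OF pi_fieldD(3)[OF Y c] z0]])
       (intro bounded_linear_Pair bounded_linear_zero bounded_linear_ident)
  ultimately have "(\<lambda>z. (pcomp c Y z, 0) + (0, snd (?a z))) differentiable (at z0)"
    by (rule differentiable_add[rotated])
  then show ?thesis
    by (rule differentiable_cong_open[OF S z0, rotated]) (simp add: fst_a[symmetric])
qed

section \<open>Fibre derivatives and the torsion\<close>

text \<open>The fibre derivative of \<open>Y\<close> along \<open>X\<close>, i.e. \<open>\<rho>[\<gamma>X, \<beta>Y]\<close>.\<close>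

definition vd :: "('a, 'e) pi_field \<Rightarrow> ('a, 'e) pi_field \<Rightarrow> ('a, 'e) pi_field" where
  "vd X Y u = (\<lambda>c. if u \<in> slit \<A> \<and> c \<in> \<A> \<and> fst u \<in> chart_dom c
     then dd (0, X u c) (pcomp c Y) (chart_map (sl c) u) else 0)"

lemma vd_apply:
  "u \<in> slit \<A> \<Longrightarrow> c \<in> \<A> \<Longrightarrow> fst u \<in> chart_dom c \<Longrightarrow>
    vd X Y u c = dd (0, X u c) (pcomp c Y) (chart_map (sl c) u)"
  by (simp add: vd_def)

text \<open>The components of Y in two charts are related on a whole fibre by one fixed linear map,
  which commutes with differentiation along a line in the fibre. Hence the derivatives transform
  like a tangent vector.\<close>

lemma vd_in:
  assumes X: "X \<in> pi_fields \<A>" and Y: "Y \<in> pi_fields \<A>"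
  shows "vd X Y \<in> pi_fields \<A>"
proof (rule pi_fieldI)
  show "vd X Y u = 0" if "u \<notin> slit \<A>" for u
    using that by (auto simp: vd_def fun_eq_iff)
  show "smooth_on (chart_image (sl c)) (pcomp c (vd X Y))" if c: "c \<in> \<A>" for c
  proof (rule smooth_on_cong[OF open_sl_image[OF c]])
    show "smooth_on (chart_image (sl c)) (\<lambda>z. dd (0, pcomp c X z) (pcomp c Y) z)"
      by (rule smooth_on_linear_family[where B="\<lambda>z v. dd (0, v) (pcomp c Y) z", OF open_sl_image[OF c]
            linear_vertical[OF dd_linear[OF smooth_on_differentiable[OF pi_fieldD(3)[OF Y c]]]]
            smooth_on_dd[OF pi_fieldD(3)[OF Y c]] pi_fieldD(3)[OF X c]])
    show "dd (0, pcomp c X z) (pcomp c Y) z = pcomp c (vd X Y) z" if z: "z \<in> chart_image (sl c)" for z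
      using vd_apply[OF sl_inv_slit(1)[OF c z] c sl_inv_slit(2)[OF c z]]
      by (simp add: pcomp_def sl_inv_slit(5)[OF c z])
  qed
  fix u assume u: "u \<in> slit \<A>"
  show "vd X Y u \<in> tangent_space \<A> (fst u)"
  proof (rule tangentI)
    show "vd X Y u c = 0" if "\<not> (c \<in> \<A> \<and> fst u \<in> chart_dom c)" for c
      using that by (auto simp: vd_def)
    fix c d assume c: "c \<in> \<A>" and d: "d \<in> \<A>" and uc: "fst u \<in> chart_dom c" and ud: "fst u \<in> chart_dom d"
    have Xu: "X u \<in> tangent_space \<A> (fst u)" by (rule pi_fieldD(1)[OF X u])
    let ?zc = "chart_map (sl c) u" and ?zd = "chart_map (sl d) u"
    note diff = smooth_on_differentiable[OF pi_fieldD(3)[OF Y] sl_map_image[OF u]]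
    have bl: "bounded_linear (tD c d (fst u))"
      using tD_linear[OF c d uc ud] linear_conv_bounded_linear by blast
    have "((\<lambda>t. pcomp d Y (?zd + t *\<^sub>R (0, X u d))) has_vector_derivative
        tD c d (fst u) (dd (0, X u c) (pcomp c Y) ?zc)) (at 0)"
    proof (rule has_vector_derivative_transform_within_open
        [OF bounded_linear.has_vector_derivative[OF bl has_vector_derivative_line[OF diff[OF c uc]]]])
      let ?T = "{t. snd u c + t *\<^sub>R X u c \<noteq> 0} \<inter> {t. snd u d + t *\<^sub>R X u d \<noteq> 0}"
      show "open ?T" by (intro open_Int open_line)
      show "0 \<in> ?T" using slit_snd_nonzero[OF u c uc] slit_snd_nonzero[OF u d ud] by simp
      fix t assume t: "t \<in> ?T"
      then have tc: "snd u c + t *\<^sub>R X u c \<noteq> 0" and td: "snd u d + t *\<^sub>R X u d \<noteq> 0" by auto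
      have "Y (fst u, snd u + t *\<^sub>R X u) \<in> tangent_space \<A> (fst u)"
        using pi_fieldD(1)[OF Y sl_line(1)[OF u c uc Xu tc]] by simp
      then show "tD c d (fst u) (pcomp c Y (?zc + t *\<^sub>R (0, X u c))) = pcomp d Y (?zd + t *\<^sub>R (0, X u d))"
        unfolding pcomp_def sl_line(3)[OF u c uc Xu tc] sl_line(3)[OF u d ud Xu td]
        by (rule tangent_tD[OF _ c d uc ud, symmetric])
    qed
    then show "vd X Y u d = tD c d (fst u) (vd X Y u c)"
      unfolding vd_apply[OF u c uc] vd_apply[OF u d ud] by (rule dd_line_eq[OF diff[OF d ud]])
  qed
qed

lemma vd_eta:
  assumes X: "X \<in> pi_fields \<A>"
  shows "vd X (eta \<A>) = X"
proof
  fix u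
  show "vd X (eta \<A>) u = X u"
  proof (cases "u \<in> slit \<A>")
    case u: True
    obtain c where c: "c \<in> \<A>" "fst u \<in> chart_dom c" using slit_chart_ex[OF u] .
    have "dd (0, X u c) (pcomp c (eta \<A>)) (chart_map (sl c) u) = dd (0, X u c) snd (chart_map (sl c) u)"
      by (rule dd_cong[OF open_sl_image[OF c(1)] sl_map_image[OF u c(2)]])
         (simp add: pcomp_def eta_def on_slit_def sl_inv_slit[OF c(1)])
    also have "\<dots> = X u c"
      by (simp add: dd_eq[OF bounded_linear_imp_has_derivative[OF bounded_linear_snd]])
    finally show ?thesis
      by (intro tangent_eqI[OF pi_fieldD(1)[OF vd_in[OF X eta_in] u] pi_fieldD(1)[OF X u] c])
         (simp add: vd_apply[OF u c])
  qed (use pi_fieldD(2)[OF X] in \<open>auto simp: vd_def fun_eq_iff\<close>)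
qed

text \<open>The base components of \<gamma>X are identically 0 and those of \<beta>Y are those of Y,
  so the base part of the bracket is the derivative of Y along \<open>(0, X)\<close>.
  Differentiability of both fields is what allows the projection to pass inside the
  derivative.\<close>

lemma rho_bracket:
  assumes X: "X \<in> pi_fields \<A>" and Y: "Y \<in> pi_fields \<A>" and u: "u \<in> slit \<A>"
  shows "rho \<A> u (lie_bracket (slit_atlas \<A>) (gam_field \<A> X) (bet_field \<A> D Y) u) = vd X Y u"
proof -
  obtain c where c: "c \<in> \<A>" "fst u \<in> chart_dom c"
    and r: "\<And>a. rho \<A> u a = tvec_of c (fst u) (fst (a (sl c)))"
    using rho_chart[OF u] by blast
  let ?z = "chart_map (sl c) u"
  let ?G = "\<lambda>z. gam_field \<A> X (chart_inv (sl c) z) (sl c)"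
  let ?b = "\<lambda>z. bet_field \<A> D Y (chart_inv (sl c) z) (sl c)"
  note z = sl_map_image[OF u c(2)]
  have "smooth_on (chart_image (sl c)) ?G"
    using gam_field_in[OF X] sl_in[OF c(1)] unfolding vector_fields_def by blast
  then have dG: "?G differentiable (at ?z)" by (rule smooth_on_differentiable[OF _ z])
  have db: "?b differentiable (at ?z)" by (rule bet_field_differentiable[OF Y c(1) z])
  have fst_dd: "fst (dd h f ?z) = dd h (\<lambda>z. fst (f z)) ?z" if "f differentiable (at ?z)"
    for f :: "'e \<times> 'e \<Rightarrow> 'e \<times> 'e" and h
    using dd_eq[OF bounded_linear.has_derivative[OF bounded_linear_fst has_derivative_dd[OF that]]] by simp
  have "fst (dd h ?G ?z) = dd h (\<lambda>z. 0) ?z" for h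
    unfolding fst_dd[OF dG]
  proof (rule dd_cong[OF open_sl_image[OF c(1)] z])
    fix z assume z: "z \<in> chart_image (sl c)"
    show "fst (?G z) = 0"
      using gam_apply[OF sl_inv_slit(1)[OF c(1) z] c(1) sl_inv_slit(2)[OF c(1) z]]
      by (simp add: gam_field_apply[OF sl_inv_slit(1)[OF c(1) z]])
  qed
  then have 1: "fst (dd h ?G ?z) = 0" for h by (simp add: dd_def)
  have 2: "fst (dd h ?b ?z) = dd h (pcomp c Y) ?z" for h
    unfolding fst_dd[OF db]
  proof (rule dd_cong[OF open_sl_image[OF c(1)] z])
    fix z assume z: "z \<in> chart_image (sl c)"
    note w = sl_inv_slit[OF c(1) z]
    have Yw: "Y (chart_inv (sl c) z) \<in> tangent_space \<A> (fst (chart_inv (sl c) z))"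
      by (rule pi_fieldD(1)[OF Y w(1)])
    show "fst (?b z) = pcomp c Y z"
      using rho_apply[OF w(1) bet_tangent(1)[OF w(1) Yw] c(1) w(2)] bet_props(2)[OF w(1) Yw]
      by (simp add: bet_field_apply[OF w(1)] pcomp_def)
  qed
  have "lie_bracket (slit_atlas \<A>) (gam_field \<A> X) (bet_field \<A> D Y) u (sl c) =
      dd (gam_field \<A> X u (sl c)) ?b ?z - dd (bet_field \<A> D Y u (sl c)) ?G ?z"
    unfolding lie_bracket_def dd_def using sl_in[OF c(1)] u c(2) by (simp add: sl_dom)
  then have "fst (lie_bracket (slit_atlas \<A>) (gam_field \<A> X) (bet_field \<A> D Y) u (sl c)) = vd X Y u c"
    using 1 2 by (simp add: vd_apply[OF u c] gam_field_apply[OF u] gam_apply[OF u c])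
  then show ?thesis unfolding r
    by (intro tangent_eqI[OF tvec_of_in[OF c] pi_fieldD(1)[OF vd_in[OF X Y] u] c])
       (simp add: tvec_of_same[OF c])
qed

abbreviation "T \<equiv> hv_torsion \<A> D"

abbreviation "\<gamma> \<equiv> gam_field \<A>"

text \<open>Among the three terms of the torsion, the covariant derivative along \<beta>Y acts on
  \<rho>\<gamma>X = 0, and \<rho>\<beta>Y = Y.\<close>

lemma hv_torsion_eq:
  assumes X: "X \<in> pi_fields \<A>" and Y: "Y \<in> pi_fields \<A>"
  shows "T X Y = cov \<A> D (\<gamma> X) Y - vd X Y"
proof -
  have "rho_field \<A> (bet_field \<A> D Y) = Y"
    using bet_props(2)[OF _ pi_fieldD(1)[OF Y]] pi_fieldD(2)[OF Y]
    by (auto simp: rho_field_def on_slit_def bet_field_apply fun_eq_iff)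
  moreover have "rho_field \<A> (\<gamma> X) = 0"
    using rho_gam[OF _ pi_fieldD(1)[OF X]]
    by (auto simp: rho_field_def on_slit_def gam_field_apply fun_eq_iff)
  moreover have "cov \<A> D (bet_field \<A> D Y) 0 = 0"
    using D_field_zero[OF _ bet_tangent(1)[OF _ pi_fieldD(1)[OF Y]]]
    by (auto simp: cov_def on_slit_def bet_field_apply fun_eq_iff)
  moreover have "rho_field \<A> (lie_bracket (slit_atlas \<A>) (\<gamma> X) (bet_field \<A> D Y)) = vd X Y"
    using rho_bracket[OF X Y] pi_fieldD(2)[OF vd_in[OF X Y]]
    by (auto simp: rho_field_def on_slit_def fun_eq_iff)
  ultimately show ?thesis unfolding hv_torsion_def torsion_def by simp
qed

lemma T_in:
  assumes "X \<in> pi_fields \<A>" "Y \<in> pi_fields \<A>"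
  shows "T X Y \<in> pi_fields \<A>"
  unfolding hv_torsion_eq[OF assms]
  by (intro pi_field_diff cov_in gam_field_in vd_in assms)

lemma cov_gam:
  assumes "X \<in> pi_fields \<A>" "Y \<in> pi_fields \<A>"
  shows "cov \<A> D (\<gamma> X) Y = vd X Y + T X Y"
  using hv_torsion_eq[OF assms] by simp

abbreviation "hv \<equiv> hv_form \<A> L D"

text \<open>Stated as an equality of functions, since \<open>cov_hv_form\<close> differentiates the
  form. Off the slit bundle all fields involved are 0 and the two sides coincide.\<close>

lemma hv_swap23:
  assumes "X \<in> pi_fields \<A>" "Y \<in> pi_fields \<A>" "Z \<in> pi_fields \<A>"
  shows "hv X Y Z = hv X Z Y"
proof
  fix u
  show "hv X Y Z u = hv X Z Y u"
  proof (cases "u \<in> slit \<A>")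
    case True
    then show ?thesis using cartan assms unfolding cartan_connection_def hv_form_def by blast
  next
    case False
    then show ?thesis using pi_fieldD(2) assms T_in unfolding hv_form_def by simp
  qed
qed

lemma metric:
  assumes "V \<in> vector_fields (slit_atlas \<A>)" "X \<in> pi_fields \<A>" "Y \<in> pi_fields \<A>" "u \<in> slit \<A>"
  shows "dir_deriv (slit_atlas \<A>) u (V u) (\<lambda>w. g w (X w) (Y w)) =
    g u (cov \<A> D V X u) (Y u) + g u (X u) (cov \<A> D V Y u)"
proof -
  have "metric_connection \<A> L D" using cartan unfolding cartan_connection_def by blast
  then have "dir_deriv (slit_atlas \<A>) u (V u) (\<lambda>w. g w (X w) (Y w))
      - g u (cov \<A> D V X u) (Y u) - g u (X u) (cov \<A> D V Y u) = 0"
    unfolding metric_connection_def using assms by blast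
  then show ?thesis by simp
qed

lemma dir_deriv_gam:
  fixes f :: "('a, 'e) tpoint \<Rightarrow> real"
  assumes X: "X \<in> pi_fields \<A>" and u: "u \<in> slit \<A>" and c: "c \<in> \<A>" "fst u \<in> chart_dom c"
    and f: "\<And>d. d \<in> \<A> \<Longrightarrow> fst u \<in> chart_dom d \<Longrightarrow>
      (f \<circ> chart_inv (sl d)) differentiable (at (chart_map (sl d) u))"
  shows "dir_deriv (slit_atlas \<A>) u (\<gamma> X u) f = dd (0, X u c) (f \<circ> chart_inv (sl c)) (chart_map (sl c) u)"
proof -
  have "dir_deriv (slit_atlas \<A>) u (\<gamma> X u) f =
      dd (\<gamma> X u (sl c)) (f \<circ> chart_inv (sl c)) (chart_map (sl c) u)"
  proof (rule slit.dir_deriv_eq[OF sl_in[OF c(1)]])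
    show "u \<in> chart_dom (sl c)" using u c(2) by (simp add: sl_dom)
    show "\<gamma> X u \<in> tangent_space (slit_atlas \<A>) u" by (rule vector_fieldD[OF gam_field_in[OF X] u])
    show "(f \<circ> chart_inv d) differentiable (at (chart_map d u))"
      if "d \<in> slit_atlas \<A>" "u \<in> chart_dom d" for d
      using that f by (auto simp: slit_atlas_def sl_dom)
  qed
  then show ?thesis by (simp add: gam_field_apply[OF u] gam_apply[OF u c])
qed

text \<open>By metricity, the fibre derivative of \<open>g\<close> (the third fibre derivative of the energy) is
  \<open>g (T X Y) Z + g Y (T X Z)\<close>.\<close>

lemma hv_chart:
  assumes XYZ: "X \<in> pi_fields \<A>" "Y \<in> pi_fields \<A>" "Z \<in> pi_fields \<A>"
    and u: "u \<in> slit \<A>" and c: "c \<in> \<A>" "fst u \<in> chart_dom c"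
  shows "hv X Y Z u = g3 c (chart_map (sl c) u) (X u c) (Y u c) (Z u c) / 2"
proof -
  let ?z = "chart_map (sl c) u"
  note z = sl_map_image[OF u c(2)]
  note t = pi_fieldD(1)[OF _ u]
  note gc = finsler_metric_chart[OF u c]
  have "g u (cov \<A> D (\<gamma> X) Y u) (Z u) + g u (Y u) (cov \<A> D (\<gamma> X) Z u) =
      dir_deriv (slit_atlas \<A>) u (\<gamma> X u) (\<lambda>w. g w (Y w) (Z w))"
    by (rule metric[OF gam_field_in[OF XYZ(1)] XYZ(2,3) u, symmetric])
  also have "\<dots> = dd (0, X u c) ((\<lambda>w. g w (Y w) (Z w)) \<circ> chart_inv (sl c)) ?z"
    by (rule dir_deriv_gam[OF XYZ(1) u c g_fields_chart(1)[OF _ _ XYZ(2,3)]])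
       (auto intro: sl_map_image[OF u])
  also have "\<dots> = g3 c ?z (X u c) (Y u c) (Z u c) + g2 c ?z (vd X Y u c) (Z u c) +
      g2 c ?z (Y u c) (vd X Z u c)"
    unfolding g_fields_chart(2)[OF c(1) z XYZ(2,3)]
    by (simp add: pcomp_at[OF u c] vd_apply[OF u c])
  also have "\<dots> = g3 c ?z (X u c) (Y u c) (Z u c) + g u (vd X Y u) (Z u) + g u (Y u) (vd X Z u)"
    using gc[OF t[OF vd_in[OF XYZ(1,2)]] t[OF XYZ(3)]] gc[OF t[OF XYZ(2)] t[OF vd_in[OF XYZ(1,3)]]]
    by simp
  finally have "g3 c ?z (X u c) (Y u c) (Z u c) = g u (T X Y u) (Z u) + g u (Y u) (T X Z u)"
    unfolding cov_gam[OF XYZ(1,2)] cov_gam[OF XYZ(1,3)] plus_fun_apply[of _ _ u]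
    using g_linear(1)[OF u t[OF vd_in[OF XYZ(1,2)]] t[OF T_in[OF XYZ(1,2)]] t[OF XYZ(3)]]
      g_linear(3)[OF u t[OF vd_in[OF XYZ(1,3)]] t[OF T_in[OF XYZ(1,3)]] t[OF XYZ(2)]]
    by simp
  also have "\<dots> = 2 * hv X Y Z u"
    using g_sym[OF u t[OF XYZ(2)] t[OF T_in[OF XYZ(1,3)]]] fun_cong[OF hv_swap23[OF XYZ], of u]
    unfolding hv_form_def by simp
  finally show ?thesis by simp
qed

section \<open>Symmetry of the torsion\<close>

lemma hv_swap12:
  assumes XYZ: "X \<in> pi_fields \<A>" "Y \<in> pi_fields \<A>" "Z \<in> pi_fields \<A>" and u: "u \<in> slit \<A>"
  shows "hv X Y Z u = hv Y X Z u"
proof -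
  obtain c where c: "c \<in> \<A>" "fst u \<in> chart_dom c" using slit_chart_ex[OF u] .
  show ?thesis unfolding hv_chart[OF XYZ u c] hv_chart[OF XYZ(2,1,3) u c]
    using g3_sym(1)[OF c(1) sl_map_image[OF u c(2)]] by simp
qed

lemma T_commute:
  assumes XY: "X \<in> pi_fields \<A>" "Y \<in> pi_fields \<A>"
  shows "T X Y = T Y X"
proof -
  have "T X Y - T Y X = 0"
  proof (rule pi_field_nondegenerate[OF pi_field_diff[OF T_in[OF XY] T_in[OF XY(2,1)]]])
    fix u W assume u: "u \<in> slit \<A>" and W: "W \<in> pi_fields \<A>"
    note t = pi_fieldD(1)[OF _ u]
    show "g u ((T X Y - T Y X) u) (W u) = 0"
      unfolding minus_apply[of _ _ u]
        g_linear(2)[OF u t[OF T_in[OF XY]] t[OF T_in[OF XY(2,1)]] t[OF W]]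
      using hv_swap12[OF XY W u] by (simp only: hv_form_def right_minus_eq)
  qed
  then show ?thesis by (rule eq_iff_diff_eq_0[THEN iffD2])
qed

lemma T_eta:
  assumes X: "X \<in> pi_fields \<A>"
  shows "T X (eta \<A>) = 0"
proof (rule pi_field_nondegenerate[OF T_in[OF X eta_in]])
  fix u W assume u: "u \<in> slit \<A>" and W: "W \<in> pi_fields \<A>"
  obtain c where c: "c \<in> \<A>" "fst u \<in> chart_dom c" using slit_chart_ex[OF u] .
  note z = sl_map_image[OF u c(2)]
  have "eta \<A> u c = snd (chart_map (sl c) u)" using u by (simp add: eta_def on_slit_def sl_map)
  \<comment> \<open>\<open>g3_snd\<close> concerns the first slot, so the symmetry of
    \<open>g3\<close> moves \<eta> there.\<close>
  then have "hv X (eta \<A>) W u = 0"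
    unfolding hv_chart[OF X eta_in W u c] g3_sym(1)[OF c(1) z, of "X u c"]
    using g3_snd[OF c(1) z] by simp
  then show "g u (T X (eta \<A>) u) (W u) = 0" by (simp add: hv_form_def)
qed

section \<open>The covariant derivative of the torsion\<close>

lemma cov_T_in:
  assumes V: "V \<in> vector_fields (slit_atlas \<A>)" and XY: "X \<in> pi_fields \<A>" "Y \<in> pi_fields \<A>"
  shows "cov_hv_torsion \<A> D V X Y \<in> pi_fields \<A>"
  unfolding cov_hv_torsion_def by (intro pi_field_diff cov_in[OF V] T_in XY)

text \<open>Metricity applied to the fields \<open>T X Y\<close> and Z; the term containing the
  covariant derivative of Z cancels against the last correction term of the form.\<close>

lemma cov_hv_form_eq:
  assumes V: "V \<in> vector_fields (slit_atlas \<A>)"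
    and XYZ: "X \<in> pi_fields \<A>" "Y \<in> pi_fields \<A>" "Z \<in> pi_fields \<A>" and u: "u \<in> slit \<A>"
  shows "cov_hv_form \<A> L D V X Y Z u = g u (cov_hv_torsion \<A> D V X Y u) (Z u)"
proof -
  note t = pi_fieldD(1)[OF _ u]
  have in_pi: "cov \<A> D V (T X Y) \<in> pi_fields \<A>" "T (cov \<A> D V X) Y \<in> pi_fields \<A>"
    "T X (cov \<A> D V Y) \<in> pi_fields \<A>"
    by (intro cov_in[OF V] T_in XYZ)+
  have "hv X Y Z = (\<lambda>w. g w (T X Y w) (Z w))" by (rule ext) (simp only: hv_form_def)
  then have "dir_deriv (slit_atlas \<A>) u (V u) (hv X Y Z) =
      g u (cov \<A> D V (T X Y) u) (Z u) + g u (T X Y u) (cov \<A> D V Z u)"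
    by (simp only: metric[OF V T_in[OF XYZ(1,2)] XYZ(3) u])
  then show ?thesis
    unfolding cov_hv_form_def cov_hv_torsion_def minus_apply[of _ _ u]
      g_linear(2)[OF u tangent_diff[OF t[OF in_pi(1)] t[OF in_pi(2)]] t[OF in_pi(3)] t[OF XYZ(3)]]
      g_linear(2)[OF u t[OF in_pi(1)] t[OF in_pi(2)] t[OF XYZ(3)]]
    by (simp add: hv_form_def)
qed

lemma cov_hv_form_swap23:
  assumes V: "V \<in> vector_fields (slit_atlas \<A>)"
    and XYZ: "X \<in> pi_fields \<A>" "Y \<in> pi_fields \<A>" "Z \<in> pi_fields \<A>"
  shows "cov_hv_form \<A> L D V X Y Z u = cov_hv_form \<A> L D V X Z Y u"
  unfolding cov_hv_form_def
  using hv_swap23[OF XYZ] hv_swap23[OF cov_in[OF V XYZ(1)] XYZ(2,3)]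
    hv_swap23[OF XYZ(1) cov_in[OF V XYZ(2)] XYZ(3)] hv_swap23[OF XYZ(1,2) cov_in[OF V XYZ(3)]]
  by simp

text \<open>Both the fourth fibre derivative of the energy and the sum of the terms quadratic in \<open>T\<close> are
  symmetric in \<open>X\<close> and \<open>Y\<close>.\<close>

lemma cov_hv_form_gam:
  assumes F: "X \<in> pi_fields \<A>" "Y \<in> pi_fields \<A>" "Z \<in> pi_fields \<A>" "W \<in> pi_fields \<A>"
    and u: "u \<in> slit \<A>" and c: "c \<in> \<A>" "fst u \<in> chart_dom c"
  shows "cov_hv_form \<A> L D (\<gamma> X) Y Z W u =
    dd (0, X u c) (\<lambda>z. g3 c z (Y u c) (Z u c) (W u c)) (chart_map (sl c) u) / 2
    - g u (T Z W u) (T X Y u) - g u (T Y W u) (T X Z u) - g u (T Y Z u) (T X W u)"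
proof -
  let ?z = "chart_map (sl c) u"
  note z = sl_map_image[OF u c(2)]
  have eq: "g3 d z (pcomp d Y z) (pcomp d Z z) (pcomp d W z) / 2 = (hv Y Z W \<circ> chart_inv (sl d)) z"
    if d: "d \<in> \<A>" and z: "z \<in> chart_image (sl d)" for d z
    using hv_chart[OF F(2,3,4) sl_inv_slit(1)[OF d z] d sl_inv_slit(2)[OF d z]]
    by (simp add: sl_inv_slit(5)[OF d z] pcomp_def)
  have "(hv Y Z W \<circ> chart_inv (sl d)) differentiable (at (chart_map (sl d) u))"
    if d: "d \<in> \<A>" "fst u \<in> chart_dom d" for d
  proof -
    have "hv Y Z W = (\<lambda>w. g w (T Y Z w) (W w))" by (rule ext) (simp only: hv_form_def)
    then show ?thesis
      using g_fields_chart(1)[OF d(1) sl_map_image[OF u d(2)] T_in[OF F(2,3)] F(4)] by simp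
  qed
  then have "dir_deriv (slit_atlas \<A>) u (\<gamma> X u) (hv Y Z W) =
      dd (0, X u c) (hv Y Z W \<circ> chart_inv (sl c)) ?z"
    by (rule dir_deriv_gam[OF F(1) u c])
  also have "\<dots> = dd (0, X u c) (\<lambda>z. g3 c z (pcomp c Y z) (pcomp c Z z) (pcomp c W z) / 2) ?z"
    by (rule dd_cong[OF open_sl_image[OF c(1)] z]) (rule eq[OF c(1), symmetric])
  also have "\<dots> = dd (0, X u c) (\<lambda>z. g3 c z (Y u c) (Z u c) (W u c) / 2) ?z +
      g3 c ?z (vd X Y u c) (Z u c) (W u c) / 2 + g3 c ?z (Y u c) (vd X Z u c) (W u c) / 2 +
      g3 c ?z (Y u c) (Z u c) (vd X W u c) / 2"
  proof -
    have half: "linear (\<lambda>v. f v / 2)" if "linear f" for f :: "'e \<Rightarrow> real"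
      using linear_compose_scale_right[OF that, of "1/2"] by simp
    have sm: "smooth_on (chart_image (sl c)) (\<lambda>z. g3 c z v w x / 2)" for v w x
    proof -
      have "smooth_on (chart_image (sl c)) (\<lambda>z. (1/2) *\<^sub>R g3 c z v w x)"
        by (rule smooth_on_linear[OF open_sl_image[OF c(1)] bounded_linear_scaleR_right smooth_g3[OF c(1)]])
      then show ?thesis by simp
    qed
    show ?thesis
      using smooth_trilinear_family[OF open_sl_image[OF c(1)] z half[OF g3_linear(1)[OF c(1)]]
          half[OF g3_linear(2)[OF c(1)]] half[OF g3_linear(3)[OF c(1)]] sm
          pi_fieldD(3)[OF F(2) c(1)] pi_fieldD(3)[OF F(3) c(1)] pi_fieldD(3)[OF F(4) c(1)], of "(0, X u c)"]
      by (simp add: pcomp_at[OF u c] vd_apply[OF u c])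
  qed
  also have "dd (0, X u c) (\<lambda>z. g3 c z (Y u c) (Z u c) (W u c) / 2) ?z =
      dd (0, X u c) (\<lambda>z. g3 c z (Y u c) (Z u c) (W u c)) ?z / 2"
    by (rule dd_eq[OF bounded_linear.has_derivative[OF bounded_linear_divide
          has_derivative_dd[OF smooth_on_differentiable[OF smooth_g3[OF c(1)] z]]]])
  finally have 1: "dir_deriv (slit_atlas \<A>) u (\<gamma> X u) (hv Y Z W) =
      dd (0, X u c) (\<lambda>z. g3 c z (Y u c) (Z u c) (W u c)) ?z / 2 +
      g3 c ?z (vd X Y u c) (Z u c) (W u c) / 2 + g3 c ?z (Y u c) (vd X Z u c) (W u c) / 2 +
      g3 c ?z (Y u c) (Z u c) (vd X W u c) / 2" .
  \<comment> \<open>Along \<gamma>X the covariant derivative is the fibre derivative plus the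
    torsion. The fibre derivatives in the correction terms cancel those of the product rule, and the
    torsion leaves the quadratic terms.\<close>
  have vT: "cov \<A> D (\<gamma> X) V \<in> pi_fields \<A>" "T X V \<in> pi_fields \<A>"
    "cov \<A> D (\<gamma> X) V u c = vd X V u c + T X V u c" if "V \<in> pi_fields \<A>" for V
    using cov_in[OF gam_field_in[OF F(1)] that] T_in[OF F(1) that] cov_gam[OF F(1) that] by simp_all
  note lin = g3_linear[OF c(1) z]
  have 2: "hv (cov \<A> D (\<gamma> X) Y) Z W u = g3 c ?z (vd X Y u c) (Z u c) (W u c) / 2 + hv (T X Y) Z W u"
    unfolding hv_chart[OF vT(1)[OF F(2)] F(3,4) u c] hv_chart[OF vT(2)[OF F(2)] F(3,4) u c]
      vT(3)[OF F(2)] linear_add[OF lin(1)] by (simp only: add_divide_distrib)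
  have 3: "hv Y (cov \<A> D (\<gamma> X) Z) W u = g3 c ?z (Y u c) (vd X Z u c) (W u c) / 2 + hv Y (T X Z) W u"
    unfolding hv_chart[OF F(2) vT(1)[OF F(3)] F(4) u c] hv_chart[OF F(2) vT(2)[OF F(3)] F(4) u c]
      vT(3)[OF F(3)] linear_add[OF lin(2)] by (simp only: add_divide_distrib)
  have 4: "hv Y Z (cov \<A> D (\<gamma> X) W) u = g3 c ?z (Y u c) (Z u c) (vd X W u c) / 2 + hv Y Z (T X W) u"
    unfolding hv_chart[OF F(2,3) vT(1)[OF F(4)] u c] hv_chart[OF F(2,3) vT(2)[OF F(4)] u c]
      vT(3)[OF F(4)] linear_add[OF lin(3)] by (simp only: add_divide_distrib)
  \<comment> \<open>Total symmetry brings the factor \<open>T X Y\<close> to the last slot, so that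
    the term becomes an inner product of two torsion values.\<close>
  have "hv (T X Y) Z W u = hv Z W (T X Y) u"
    using hv_swap12[OF vT(2)[OF F(2)] F(3,4) u] fun_cong[OF hv_swap23[OF F(3) vT(2)[OF F(2)] F(4)], of u]
    by simp
  moreover have "hv Y (T X Z) W u = hv Y W (T X Z) u"
    using fun_cong[OF hv_swap23[OF F(2) vT(2)[OF F(3)] F(4)], of u] .
  ultimately show ?thesis
    unfolding cov_hv_form_def 1 2 3 4 by (simp add: hv_form_def)
qed

text \<open>Exchanging X and Y fixes the first quadratic term because T is symmetric, and
  interchanges the other two because g is.\<close>

lemma cov_T_gam_swap:
  assumes F: "X \<in> pi_fields \<A>" "Y \<in> pi_fields \<A>" "Z \<in> pi_fields \<A>"
  shows "cov_hv_torsion \<A> D (\<gamma> X) Y Z = cov_hv_torsion \<A> D (\<gamma> Y) X Z"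
proof -
  note in_X = cov_T_in[OF gam_field_in[OF F(1)] F(2,3)] and in_Y = cov_T_in[OF gam_field_in[OF F(2)] F(1,3)]
  have "cov_hv_torsion \<A> D (\<gamma> X) Y Z - cov_hv_torsion \<A> D (\<gamma> Y) X Z = 0"
  proof (rule pi_field_nondegenerate[OF pi_field_diff[OF in_X in_Y]])
    fix u W assume u: "u \<in> slit \<A>" and W: "W \<in> pi_fields \<A>"
    obtain c where c: "c \<in> \<A>" "fst u \<in> chart_dom c" using slit_chart_ex[OF u] .
    note t = pi_fieldD(1)[OF _ u]
    have "cov_hv_form \<A> L D (\<gamma> X) Y Z W u = cov_hv_form \<A> L D (\<gamma> Y) X Z W u"
      unfolding cov_hv_form_gam[OF F W u c] cov_hv_form_gam[OF F(2,1,3) W u c]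
      using dd_g3_sym[OF c(1) sl_map_image[OF u c(2)], of "X u c" "Y u c"] T_commute[OF F(1,2)]
        g_sym[OF u t[OF T_in[OF F(2) W]] t[OF T_in[OF F(1,3)]]]
        g_sym[OF u t[OF T_in[OF F(2,3)]] t[OF T_in[OF F(1) W]]]
      by simp
    then show "g u ((cov_hv_torsion \<A> D (\<gamma> X) Y Z - cov_hv_torsion \<A> D (\<gamma> Y) X Z) u) (W u) = 0"
      unfolding cov_hv_form_eq[OF gam_field_in[OF F(1)] F(2,3) W u]
        cov_hv_form_eq[OF gam_field_in[OF F(2)] F(1,3) W u]
      unfolding minus_apply[of _ _ u] g_linear(2)[OF u t[OF in_X] t[OF in_Y] t[OF W]]
      by (simp only: right_minus_eq)
  qed
  then show ?thesis by (rule eq_iff_diff_eq_0[THEN iffD2])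
qed

lemma cov_zero:
  assumes "V \<in> vector_fields (slit_atlas \<A>)"
  shows "cov \<A> D V 0 = 0"
  using D_field_zero[OF _ vector_fieldD[OF assms]] by (auto simp: cov_def on_slit_def fun_eq_iff)

text \<open>After \<eta> and X are exchanged, two of the three terms contain a torsion with \<eta>
  as an argument and vanish; the third is the torsion of the covariant derivative of \<eta> along
  \<gamma>X, which is X, and of Y.\<close>

lemma cov_T_gam_eta:
  assumes F: "X \<in> pi_fields \<A>" "Y \<in> pi_fields \<A>"
  shows "cov_hv_torsion \<A> D (\<gamma> (eta \<A>)) X Y = - T X Y"
proof -
  have eta_T: "T (eta \<A>) V = 0" if "V \<in> pi_fields \<A>" for V
    using T_commute[OF eta_in that] T_eta[OF that] by simp
  have "cov \<A> D (\<gamma> X) (eta \<A>) = X"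
    using cov_gam[OF F(1) eta_in] vd_eta[OF F(1)] T_eta[OF F(1)] by simp
  then have "cov_hv_torsion \<A> D (\<gamma> X) (eta \<A>) Y = - T X Y"
    unfolding cov_hv_torsion_def eta_T[OF F(2)] eta_T[OF cov_in[OF gam_field_in[OF F(1)] F(2)]]
    by (simp add: cov_zero[OF gam_field_in[OF F(1)]])
  then show ?thesis using cov_T_gam_swap[OF eta_in F] by simp
qed

end

theorem proposition3p3:
  fixes M :: "'a topology"
    and \<A> :: "('a, 'e::euclidean_space) chart set"
    and L :: "('a, 'e) tpoint \<Rightarrow> real"
    and D :: "('a, 'e) pi_connection"
    and X Y Z :: "('a, 'e) pi_field"
    and A :: "('a, 'e) slit_field"
  assumes "finsler_manifold M \<A> L"
    and "cartan_connection \<A> L D"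
    and "X \<in> pi_fields \<A>" and "Y \<in> pi_fields \<A>" and "Z \<in> pi_fields \<A>"
    and "A \<in> vector_fields (slit_atlas \<A>)"
  shows "(\<forall>u\<in>slit \<A>. hv_form \<A> L D X Y Z u = hv_form \<A> L D X Z Y u) \<and>
    (\<forall>u\<in>slit \<A>.
           cov_hv_form \<A> L D A X Y Z u = finsler_metric L u (cov_hv_torsion \<A> D A X Y u) (Z u) \<and>
           finsler_metric L u (cov_hv_torsion \<A> D A X Y u) (Z u) =
             finsler_metric L u (cov_hv_torsion \<A> D A X Z u) (Y u)) \<and>
    hv_torsion \<A> D X (eta \<A>) = 0 \<and>
    cov_hv_torsion \<A> D (gam_field \<A> X) Y Z = cov_hv_torsion \<A> D (gam_field \<A> Y) X Z \<and>
    cov_hv_torsion \<A> D (gam_field \<A> (eta \<A>)) X Y = - hv_torsion \<A> D X Y \<and>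
    (\<forall>u\<in>slit \<A>.
           hv_form \<A> L D X Z Y u = hv_form \<A> L D X Y Z u \<and>
           hv_form \<A> L D Y X Z u = hv_form \<A> L D X Y Z u \<and>
           hv_form \<A> L D Y Z X u = hv_form \<A> L D X Y Z u \<and>
           hv_form \<A> L D Z X Y u = hv_form \<A> L D X Y Z u \<and>
           hv_form \<A> L D Z Y X u = hv_form \<A> L D X Y Z u)"
proof -
  interpret cartan M \<A> L D
    by standard (use assms in \<open>auto simp: finsler_manifold_def\<close>)
  note F = assms(3-5) and V = assms(6)
  have b: "cov_hv_form \<A> L D A X Y Z u = g u (cov_hv_torsion \<A> D A X Y u) (Z u) \<and>
      g u (cov_hv_torsion \<A> D A X Y u) (Z u) = g u (cov_hv_torsion \<A> D A X Z u) (Y u)"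
    if u: "u \<in> slit \<A>" for u
    using cov_hv_form_eq[OF V F u] cov_hv_form_eq[OF V F(1,3,2) u] cov_hv_form_swap23[OF V F] by simp
  \<comment> \<open>The two transpositions, taken at permuted arguments, reach all five nontrivial
    permutations.\<close>
  have f: "hv X Z Y u = hv X Y Z u \<and> hv Y X Z u = hv X Y Z u \<and> hv Y Z X u = hv X Y Z u \<and>
      hv Z X Y u = hv X Y Z u \<and> hv Z Y X u = hv X Y Z u" if u: "u \<in> slit \<A>" for u
    using hv_swap23[OF F] hv_swap23[OF F(2,1,3)] hv_swap23[OF F(3,1,2)]
      hv_swap12[OF F u] hv_swap12[OF F(1,3,2) u]
    by simp
  show ?thesis
    using hv_swap23[OF F] b T_eta[OF F(1)] cov_T_gam_swap[OF F] cov_T_gam_eta[OF F(1,2)] f by simp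
qed

end
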